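(* (a) For every left-invariant complex structure on $\mathbb{R}\times\widetilde{SL}(2,\mathbb{R})$, the resulting complex manifold is biholomorphic to $\mathbb{H}\times\mathbb{C}$. (b) For every left-invariant complex structure on $\mathbb{R}\times SU(2)$, the resulting complex manifold is biholomorphic to $\mathbb{C}^2\setminus\{0\}$. (c) For every left-invariant complex structure on $GH_{2m+2}=\mathbb{R}\times H_{2m+1}$ ($m\ge1$), the resulting complex manifold is biholomorphic to $\mathbb{C}^{m+1}$. (d) For every linear map $\psi:\mathbb{R}^{2p+1}\to\mathfrak t^q$ ($p,q\ge0$, $m=p+q\geq 1$), the simply connected Lie group $GH_{2m+2}(\psi)$ with Lie algebra $\mathfrak{gh}_{2m+2}(\psi)$, endowed with the left-invariant complex structure determined by $J$, is biholomorphic to $\mathbb{C}^{m+1}$.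
   Context: $\mathbb{H}$ is the upper half plane; $\widetilde{SL}(2,\mathbb{R})$ is the universal cover of $SL(2,\mathbb{R})$; $H_{2m+1}$ is the simply connected Heisenberg group of dimension $2m+1$. A left-invariant complex structure on a Lie group with Lie algebra $\mathfrak g$ corresponds to $J\in\mathrm{End}(\mathfrak g)$ with $J^2=-\mathrm{Id}$ and $[JX,JY]-[X,Y]-J[X,JY]-J[JX,Y]=0$ for all $X,Y\in\mathfrak g$. The Lie algebras $\mathfrak{gh}_{2m+2}(\psi)$ and $J$. Let $\mathfrak t^q\cong\mathbb{R}^q$ be the Cartan subalgebra of $\mathfrak u(q)$ consisting of purely imaginary diagonal matrices. Given linear $\psi:\mathbb{R}^{2p+1}\to\mathfrak t^q$, let $\mathfrak m=\mathbb{R}^{2p+1}\ltimes_\psi\mathbb{C}^q$ be the Lie algebra in which $\mathbb{R}^{2p+1}$ is an abelian subalgebra acting on the abelian ideal $\mathbb{C}^q$ by $\psi$. Decompose $\mathbb{R}^{2p+1}=\mathbb{R}Z_0\oplus\mathbb{C}^p$ and let $\omega$ be the standard symplectic form on $V=\mathbb{C}^p\oplus\mathbb{C}^q=\mathbb{C}^m$. Its pull-back $\omega_{\mathfrak m}$ to $\mathfrak m$ via $\lambda Z_0+v\mapsto v$ is a $2$-cocycle, and $\mathfrak{gh}_{2m+2}(\psi)=\mathbb{R}Z_1\oplus\mathfrak m$ is the central extension with $[X,Y]=[X,Y]_{\mathfrak m}+\omega_{\mathfrak m}(X,Y)Z_1$ for $X,Y\in\mathfrak m$ and $[Z_1,\mathfrak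 m]=0$. In terms of a basis $X_1,Y_1,\dots,X_m,Y_m$ of $V$ adapted to $V=\mathbb{C}^p\oplus\mathbb{C}^q=\mathbb{C}^m$, with $\omega(X_i,Y_i)=1$ and all other pairings of basis vectors zero (up to skew-symmetry), the (integrable) complex structure $J$ is $JX_i=Y_i$, $JY_i=-X_i$ (multiplication by $\sqrt{-1}$ on $V=\mathbb{C}^m$), $JZ_0=Z_1$, $JZ_1=-Z_0$. *)

theory Defs
  imports "HOL-Analysis.Analysis" "HOL-Algebra.Group"
begin

section \<open>Smooth maps on subsets of Euclidean spaces\<close>

text \<open>
  On an open set \<open>S\<close> of a finite-dimensional space, \<open>f\<close> is of class \<open>C^(k+1)\<close> iff it is
  differentiable and all its directional derivatives are of class \<open>C^k\<close>.
\<close>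

primrec Ck_on :: "nat \<Rightarrow> 'a::euclidean_space set \<Rightarrow> ('a \<Rightarrow> 'b::real_normed_vector) \<Rightarrow> bool" where
  "Ck_on 0 S f \<longleftrightarrow> continuous_on S f"
| "Ck_on (Suc k) S f \<longleftrightarrow> (\<forall>x\<in>S. f differentiable (at x)) \<and>
     (\<forall>v. Ck_on k S (\<lambda>x. frechet_derivative f (at x) v))"

definition Cinf_on :: "'a::euclidean_space set \<Rightarrow> ('a \<Rightarrow> 'b::real_normed_vector) \<Rightarrow> bool" where
  "Cinf_on S f \<longleftrightarrow> (\<forall>k. Ck_on k S f)"

text \<open>Smoothness on an arbitrary subset: local existence of smooth extensions to open sets.\<close>

definition smooth_map_on :: "'a::euclidean_space set \<Rightarrow> ('a \<Rightarrow> 'b::real_normed_vector) \<Rightarrow> bool" where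
  "smooth_map_on S f \<longleftrightarrow>
     (\<forall>x\<in>S. \<exists>W g. open W \<and> x \<in> W \<and> Cinf_on W g \<and> (\<forall>y\<in>W \<inter> S. g y = f y))"

definition diffeomorphism_on ::
    "'a::euclidean_space set \<Rightarrow> 'b::euclidean_space set \<Rightarrow> ('a \<Rightarrow> 'b) \<Rightarrow> bool" where
  "diffeomorphism_on S T f \<longleftrightarrow>
     bij_betw f S T \<and> smooth_map_on S f \<and> smooth_map_on T (inv_into S f)"

definition tangent_space :: "'a::euclidean_space set \<Rightarrow> 'a \<Rightarrow> 'a set" where
  "tangent_space S x = {v. \<exists>\<gamma> e. (0::real) < e \<and> \<gamma> ` {-e<..<e} \<subseteq> S \<and> Cinf_on {-e<..<e} \<gamma> \<and>
     \<gamma> 0 = x \<and> (\<gamma> has_vector_derivative v) (at 0)}"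

text \<open>
  For a submanifold \<open>S\<close>, \<open>frechet_derivative f (at x within S)\<close> involves a choice of a linear map on
  the ambient space, but its values on tangent vectors are independent of that choice. It therefore
  serves as the differential of \<open>f\<close> on \<open>tangent_space S x\<close>.
\<close>

lemma frechet_derivative_tangent:
  assumes D: "(f has_derivative D) (at x within S)" and v: "v \<in> tangent_space S x"
  shows "frechet_derivative f (at x within S) v = D v"
proof -
  obtain \<gamma> e where e: "(0::real) < e" and S: "\<gamma> ` {-e<..<e} \<subseteq> S"
    and \<gamma>: "\<gamma> 0 = x" "(\<gamma> has_vector_derivative v) (at 0)"
    using v unfolding tangent_space_def by blast
  have *: "((f \<circ> \<gamma>) has_vector_derivative E v) (at 0)"
    if E: "(f has_derivative E) (at x within S)" for E
  proof -
    have "(\<gamma> has_derivative (\<lambda>t. t *\<^sub>R v)) (at 0 within {-e<..<e})"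
      using \<gamma>(2) has_derivative_at_withinI unfolding has_vector_derivative_def by blast
    moreover have "(f has_derivative E) (at (\<gamma> 0) within \<gamma> ` {-e<..<e})"
      using E S \<gamma>(1) has_derivative_subset by blast
    ultimately have "((f \<circ> \<gamma>) has_derivative (E \<circ> (\<lambda>t. t *\<^sub>R v))) (at 0 within {-e<..<e})"
      by (rule diff_chain_within)
    moreover have "E \<circ> (\<lambda>t. t *\<^sub>R v) = (\<lambda>t. t *\<^sub>R E v)"
      using linear_scale[OF has_derivative_linear[OF E]] by (auto simp: o_def)
    ultimately show ?thesis
      using e at_within_open[of "0::real" "{-e<..<e}"]
      by (simp add: has_vector_derivative_def)
  qed
  have "(f has_derivative frechet_derivative f (at x within S)) (at x within S)"
    using D frechet_derivative_works differentiable_def by blast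
  from *[OF this] *[OF D] show ?thesis
    by (rule vector_derivative_unique_at)
qed


lemma tangent_space_UNIV: "tangent_space UNIV (x::'a::euclidean_space) = UNIV"
proof -
  have c: "Ck_on k S (\<lambda>t::real. c :: 'a)" for k c S
    by (induction k arbitrary: c) (simp_all add: frechet_derivative_const)
  have d: "((\<lambda>t::real. x + t *\<^sub>R v) has_derivative (\<lambda>h. h *\<^sub>R v)) (at t)" for v t
    by (auto intro!: derivative_eq_intros)
  have fd: "frechet_derivative (\<lambda>t::real. x + t *\<^sub>R v) (at t) = (\<lambda>h. h *\<^sub>R v)" for v t
    using frechet_derivative_at[OF d] by simp
  have "Ck_on k S (\<lambda>t::real. x + t *\<^sub>R v)" for k v S
  proof (cases k)
    case 0 then show ?thesis by (auto intro!: continuous_intros)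
  next
    case (Suc n) then show ?thesis using d by (auto simp: differentiable_def fd c intro!: exI)
  qed
  then have "Cinf_on S (\<lambda>t::real. x + t *\<^sub>R v)" for v S by (simp add: Cinf_on_def)
  moreover have "((\<lambda>t::real. x + t *\<^sub>R v) has_vector_derivative v) (at 0)" for v
    using d by (simp add: has_vector_derivative_def)
  ultimately show ?thesis
    by (auto simp: tangent_space_def intro!: exI[of _ "\<lambda>t. x + t *\<^sub>R _"] exI[of _ "1::real"])
qed


section \<open>Lie groups and left-invariant complex structures\<close>

text \<open>
  A Lie group is represented by a group in the sense of HOL-Algebra whose carrier is a submanifold
  of a Euclidean space. The left-invariant vector field with value \<open>X\<close> at the identity is
  \<open>g \<mapsto> left_translate G g X\<close>; the bracket below is the value at the identity of the Lie bracket of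
  two such fields.
\<close>

definition lie_algebra :: "'a::euclidean_space monoid \<Rightarrow> 'a set" where
  "lie_algebra G = tangent_space (carrier G) \<one>\<^bsub>G\<^esub>"

definition left_translate :: "'a::euclidean_space monoid \<Rightarrow> 'a \<Rightarrow> 'a \<Rightarrow> 'a" where
  "left_translate G g = frechet_derivative (\<lambda>h. g \<otimes>\<^bsub>G\<^esub> h) (at \<one>\<^bsub>G\<^esub> within carrier G)"

definition lie_bracket :: "'a::euclidean_space monoid \<Rightarrow> 'a \<Rightarrow> 'a \<Rightarrow> 'a" where
  "lie_bracket G X Y =
     frechet_derivative (\<lambda>g. left_translate G g Y) (at \<one>\<^bsub>G\<^esub> within carrier G) X -
     frechet_derivative (\<lambda>g. left_translate G g X) (at \<one>\<^bsub>G\<^esub> within carrier G) Y"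

definition linear_map_on :: "'a::real_vector set \<Rightarrow> 'b::real_vector set \<Rightarrow> ('a \<Rightarrow> 'b) \<Rightarrow> bool" where
  "linear_map_on V W f \<longleftrightarrow> f ` V \<subseteq> W \<and>
     (\<forall>x\<in>V. \<forall>y\<in>V. f (x + y) = f x + f y) \<and> (\<forall>c. \<forall>x\<in>V. f (c *\<^sub>R x) = c *\<^sub>R f x)"

definition left_invariant_complex_structure ::
    "'a::euclidean_space monoid \<Rightarrow> ('a \<Rightarrow> 'a) \<Rightarrow> bool" where
  "left_invariant_complex_structure G J \<longleftrightarrow>
     linear_map_on (lie_algebra G) (lie_algebra G) J \<and>
     (\<forall>X\<in>lie_algebra G. J (J X) = - X) \<and>
     (\<forall>X\<in>lie_algebra G. \<forall>Y\<in>lie_algebra G.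
        lie_bracket G (J X) (J Y) - lie_bracket G X Y
          - J (lie_bracket G X (J Y)) - J (lie_bracket G (J X) Y) = 0)"

text \<open>
  The left-invariant almost complex structure on \<open>G\<close> determined by \<open>J\<close> sends the tangent vector
  \<open>left_translate G g X\<close> at \<open>g\<close> to \<open>left_translate G g (J X)\<close>. The charts of the resulting complex
  manifold are the diffeomorphisms between open subsets of \<open>G\<close> and of \<open>\<complex>^n\<close> whose differentials
  carry it to multiplication by \<open>\<i>\<close>; thus a biholomorphism of that manifold onto an open
  \<open>U \<subseteq> \<complex>^n\<close> is a diffeomorphism of \<open>G\<close> onto \<open>U\<close> with this property.
\<close>

definition biholomorphism_onto ::
    "'a::euclidean_space monoid \<Rightarrow> ('a \<Rightarrow> 'a) \<Rightarrow> (complex^'n) set \<Rightarrow> ('a \<Rightarrow> complex^'n) \<Rightarrow> bool" where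
  "biholomorphism_onto G J U F \<longleftrightarrow>
     open U \<and> diffeomorphism_on (carrier G) U F \<and>
     (\<forall>g\<in>carrier G. \<forall>X\<in>lie_algebra G.
        frechet_derivative F (at g within carrier G) (left_translate G g (J X)) =
        \<i> *s frechet_derivative F (at g within carrier G) (left_translate G g X))"

definition biholomorphic_to ::
    "'a::euclidean_space monoid \<Rightarrow> ('a \<Rightarrow> 'a) \<Rightarrow> (complex^'n) set \<Rightarrow> bool" where
  "biholomorphic_to G J U \<longleftrightarrow> (\<exists>F. biholomorphism_onto G J U F)"


section \<open>The groups\<close>

definition Real_group :: "real monoid" where
  "Real_group = \<lparr>carrier = UNIV, mult = (+), one = 0\<rparr>"

lemma group_Real: "group Real_group"
  by (rule groupI) (auto simp: Real_group_def intro: exI[of _ "- x" for x])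

subsection \<open>The special unitary group\<close>

definition ctranspose :: "complex^'n^'m \<Rightarrow> complex^'m^'n" where
  "ctranspose A = (\<chi> i j. cnj (A $ j $ i))"

definition SU2 :: "(complex^2^2) monoid" where
  "SU2 = \<lparr>carrier = {A. A ** ctranspose A = mat 1 \<and> det A = 1}, mult = (**), one = mat 1\<rparr>"

lemma group_SU2: "group SU2"
proof -
  have ct: "ctranspose (A ** B) = ctranspose B ** ctranspose A" for A B :: "complex^2^2"
    by (simp add: ctranspose_def matrix_matrix_mult_def vec_eq_iff cnj_sum mult.commute)
  have cc: "ctranspose (ctranspose A) = A" for A :: "complex^2^2"
    by (simp add: ctranspose_def vec_eq_iff)
  have c1: "ctranspose (mat 1) = (mat 1 :: complex^2^2)"
    by (auto simp: ctranspose_def mat_def vec_eq_iff)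
  have dc: "det (ctranspose A) = cnj (det A)" for A :: "complex^2^2"
    by (simp add: ctranspose_def det_2 mult.commute)
  show ?thesis
  proof (rule groupI)
    fix A B assume "A \<in> carrier SU2" "B \<in> carrier SU2"
    then have A: "A ** ctranspose A = mat 1" "det A = 1" and B: "B ** ctranspose B = mat 1" "det B = 1"
      by (auto simp: SU2_def)
    have "(A ** B) ** ctranspose (A ** B) = A ** (B ** ctranspose B) ** ctranspose A"
      by (simp add: ct matrix_mul_assoc)
    then show "A \<otimes>\<^bsub>SU2\<^esub> B \<in> carrier SU2" using A B by (simp add: SU2_def det_mul)
  next
    fix A assume "A \<in> carrier SU2"
    then show "\<exists>B\<in>carrier SU2. B \<otimes>\<^bsub>SU2\<^esub> A = \<one>\<^bsub>SU2\<^esub>"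
      by (intro bexI[of _ "ctranspose A"])
         (auto simp: SU2_def cc dc matrix_left_right_inverse[of "ctranspose A"])
  qed (auto simp: SU2_def c1 matrix_mul_assoc)
qed

subsection \<open>The universal cover of \<open>SL(2,\<real>)\<close>\<close>

definition SL2R :: "(real^2^2) monoid" where
  "SL2R = \<lparr>carrier = {A. det A = 1}, mult = (**), one = mat 1\<rparr>"

definition aut_factor :: "real^2^2 \<Rightarrow> complex \<Rightarrow> complex" where
  "aut_factor A z = of_real (A$2$1) * z + of_real (A$2$2)"

definition moebius_act :: "real^2^2 \<Rightarrow> complex \<Rightarrow> complex" where
  "moebius_act A z = (of_real (A$1$1) * z + of_real (A$1$2)) / aut_factor A z"

text \<open>
  An element of the universal cover is a matrix \<open>A\<close> together with a choice of an argument \<open>t\<close> of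
  \<open>aut_factor A \<i>\<close> (equivalently, of a logarithm of \<open>aut_factor A\<close> on the upper half plane). The
  multiplication lifts the cocycle rule
  \<open>aut_factor (A ** B) z = aut_factor A (moebius_act B z) * aut_factor B z\<close> at \<open>z = \<i>\<close>. For \<open>z\<close> in the
  upper half plane \<open>aut_factor A z / aut_factor A \<i>\<close> is never a negative real number, so the
  principal argument gives the continuous lift.
\<close>

definition SL2R_cover :: "((real^2^2) \<times> real) monoid" where
  "SL2R_cover =
     \<lparr>carrier = {(A, t). det A = 1 \<and> aut_factor A \<i> = of_real (cmod (aut_factor A \<i>)) * cis t},
      mult = (\<lambda>(A, s) (B, t).
        (A ** B, s + t + Arg (aut_factor A (moebius_act B \<i>) / aut_factor A \<i>))),
      one = (mat 1, 0)\<rparr>"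

lemma aut_factor_nonzero:
  assumes "det A = 1" "Im z > 0" shows "aut_factor A z \<noteq> 0"
proof
  assume 0: "aut_factor A z = 0"
  have "A$2$1 * Im z = Im (aut_factor A z)" by (simp add: aut_factor_def)
  then have "A$2$1 * Im z = 0" by (simp add: 0)
  then have "A$2$1 = 0" using assms by simp
  moreover then have "A$2$2 = 0" using arg_cong[OF 0, of Re] by (simp add: aut_factor_def)
  ultimately show False using assms by (simp add: det_2)
qed

lemma matrix_mult_2: "(A ** B) $ i $ j = A$i$1 * B$1$j + A$i$2 * B$2$j" for A B :: "real^2^2"
  by (simp add: matrix_matrix_mult_def sum_2)

lemma aut_factor_mult:
  assumes "aut_factor B z \<noteq> 0"
  shows "aut_factor (A ** B) z = aut_factor A (moebius_act B z) * aut_factor B z"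
proof -
  have "aut_factor A (moebius_act B z) * aut_factor B z =
      of_real (A$2$1) * (of_real (B$1$1) * z + of_real (B$1$2)) + of_real (A$2$2) * aut_factor B z"
    using assms by (simp add: aut_factor_def[of A] moebius_act_def field_simps)
  then show ?thesis by (simp add: aut_factor_def matrix_mult_2 algebra_simps)
qed

lemma moebius_act_mult:
  assumes "aut_factor B z \<noteq> 0" "aut_factor A (moebius_act B z) \<noteq> 0"
  shows "moebius_act (A ** B) z = moebius_act A (moebius_act B z)"
proof -
  have "(of_real (A$1$1) * moebius_act B z + of_real (A$1$2)) * aut_factor B z =
      of_real ((A**B)$1$1) * z + of_real ((A**B)$1$2)"
    using assms(1) by (simp add: moebius_act_def matrix_mult_2 field_simps)
      (simp add: aut_factor_def algebra_simps)
  then show ?thesis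
    using assms by (simp add: moebius_act_def[of "A ** B"] moebius_act_def[of A] aut_factor_mult divide_simps)
qed

lemma Im_moebius_act:
  assumes "det A = 1" "Im z > 0" shows "Im (moebius_act A z) > 0"
proof -
  let ?j = "aut_factor A z" let ?n = "of_real (A$1$1) * z + of_real (A$1$2)"
  have j: "?j \<noteq> 0" using assms by (rule aut_factor_nonzero)
  have "Im ?n * Re ?j - Re ?n * Im ?j = (A$1$1 * A$2$2 - A$1$2 * A$2$1) * Im z"
    by (simp add: aut_factor_def algebra_simps)
  also have "\<dots> = Im z" using assms(1) by (simp add: det_2)
  finally have "Im (moebius_act A z) = Im z / ((Re ?j)\<^sup>2 + (Im ?j)\<^sup>2)"
    by (simp add: moebius_act_def Im_divide)
  moreover have "(Re ?j)\<^sup>2 + (Im ?j)\<^sup>2 > 0" using j by (simp add: complex_neq_0)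
  ultimately show ?thesis using assms by simp
qed

lemma aut_factor_ratio:
  assumes "det A = 1" "Im z > 0" "Im w > 0"
  shows "aut_factor A z / aut_factor A w \<notin> \<real>\<^sub>\<le>\<^sub>0"
proof
  assume "aut_factor A z / aut_factor A w \<in> \<real>\<^sub>\<le>\<^sub>0"
  then obtain r where r: "r \<le> 0" "aut_factor A z / aut_factor A w = of_real r"
    by (auto elim: nonpos_Reals_cases)
  have w: "aut_factor A w \<noteq> 0" and z: "aut_factor A z \<noteq> 0"
    using assms aut_factor_nonzero by blast+
  have e: "aut_factor A z = of_real r * aut_factor A w" using r w by (simp add: field_simps)
  have "A$2$1 * Im z = r * (A$2$1 * Im w)" using arg_cong[OF e, of Im] by (simp add: aut_factor_def)
  then have "A$2$1 = 0 \<or> Im z = r * Im w" by auto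
  moreover have "r * Im w \<le> 0" using r assms by (simp add: mult_nonpos_nonneg)
  ultimately have c: "A$2$1 = 0" using assms by auto
  then have "A$2$2 = r * A$2$2" using arg_cong[OF e, of Re] by (simp add: aut_factor_def)
  moreover have "A$2$2 \<noteq> 0" using c z by (auto simp: aut_factor_def)
  ultimately show False using r by simp
qed

abbreviation (input) "arg_factor A z \<equiv> Arg (aut_factor A z / aut_factor A \<i>)"

lemma arg_factor_cocycle:
  assumes A: "det A = 1" and B: "det B = 1" and z: "Im z > 0"
  shows "arg_factor A (moebius_act B \<i>) + arg_factor (A ** B) z =
         arg_factor B z + arg_factor A (moebius_act B z)"
proof -
  let ?H = "{z. Im z > 0}"
  define f where "f z = arg_factor A (moebius_act B \<i>) + arg_factor (A ** B) z
      - arg_factor B z - arg_factor A (moebius_act B z)" for z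
  have AB: "det (A ** B) = 1" using A B by (simp add: det_mul)
  have nz: "aut_factor A z \<noteq> 0" "aut_factor B z \<noteq> 0" "aut_factor A (moebius_act B z) \<noteq> 0"
    "aut_factor (A ** B) z \<noteq> 0" if "Im z > 0" for z
    using that A B AB aut_factor_nonzero Im_moebius_act by blast+
  have cj: "continuous_on S (aut_factor A)" for A S
    unfolding aut_factor_def by (intro continuous_intros)
  have cm: "continuous_on ?H (moebius_act B)"
    unfolding moebius_act_def by (intro continuous_intros cj) (use nz in auto)
  have "continuous_on ?H (\<lambda>z. aut_factor A (moebius_act B z))"
    using continuous_on_compose2[OF cj cm] by blast
  then have cont: "continuous_on ?H f"
    unfolding f_def using A B AB Im_moebius_act nz
    by (intro continuous_intros cj) (auto simp: aut_factor_ratio)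
  have "f constant_on ?H"
  proof (rule continuous_discrete_range_constant[OF _ cont])
    show "connected ?H" by (simp add: convex_connected convex_halfspace_Im_gt)
    have int: "\<exists>n::int. f z = 2 * pi * n" if "z \<in> ?H" for z
    proof -
      have "cis (f z) = 1"
        using that by (simp add: f_def cis_mult[symmetric] cis_divide[symmetric] cis_Arg nz
            sgn_mult sgn_divide aut_factor_mult nz[of \<i>])
          (simp add: field_simps nz sgn_zero_iff)
      then have "cos (f z) = 1" by (simp add: complex_eq_iff)
      then show ?thesis by (auto simp: cos_one_2pi_int mult.commute)
    qed
    show "\<exists>e>0. \<forall>y. y \<in> ?H \<and> f y \<noteq> f x \<longrightarrow> e \<le> norm (f y - f x)" if x: "x \<in> ?H" for x
    proof (intro exI[of _ "2 * pi"] conjI allI impI)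
      fix y assume y: "y \<in> ?H \<and> f y \<noteq> f x"
      obtain m n :: int where e: "f x = 2 * pi * m" "f y = 2 * pi * n" using int x y by blast
      then have "n \<noteq> m" using y by auto
      then have "1 \<le> \<bar>real_of_int (n - m)\<bar>" by linarith
      then have "2 * pi * 1 \<le> 2 * pi * \<bar>real_of_int (n - m)\<bar>" by (intro mult_left_mono) auto
      also have "\<dots> = \<bar>2 * pi * real_of_int (n - m)\<bar>" by (simp add: abs_mult)
      also have "2 * pi * real_of_int (n - m) = f y - f x" by (simp add: e algebra_simps)
      finally show "2 * pi \<le> norm (f y - f x)" by simp
    qed simp
  qed
  then have "f z = f \<i>" using z by (auto simp: constant_on_def)
  also have "f \<i> = 0" by (simp add: f_def nz[of \<i>])
  finally show ?thesis by (simp add: f_def)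
qed

lemma SL2R_cover_carrier:
  "(A, t) \<in> carrier SL2R_cover \<longleftrightarrow> det A = 1 \<and> cis t = sgn (aut_factor A \<i>)"
proof (cases "det A = 1")
  case True
  then have "aut_factor A \<i> \<noteq> 0" by (simp add: aut_factor_nonzero)
  then show ?thesis using True by (auto simp: SL2R_cover_def sgn_div_norm scaleR_conv_of_real field_simps)
qed (simp add: SL2R_cover_def)

lemma SL2R_cover_mult:
  "(A, s) \<otimes>\<^bsub>SL2R_cover\<^esub> (B, t) = (A ** B, s + t + arg_factor A (moebius_act B \<i>))"
  by (simp add: SL2R_cover_def)

lemma SL2R_cover_one: "\<one>\<^bsub>SL2R_cover\<^esub> = (mat 1, 0)"
  by (simp add: SL2R_cover_def)

lemma aut_factor_one: "aut_factor (mat 1) z = 1"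
  by (simp add: aut_factor_def mat_def)

lemma SL2R_cover_closed:
  assumes "x \<in> carrier SL2R_cover" "y \<in> carrier SL2R_cover"
  shows "x \<otimes>\<^bsub>SL2R_cover\<^esub> y \<in> carrier SL2R_cover"
proof -
  obtain A s B t where e: "x = (A, s)" "y = (B, t)" by (cases x, cases y)
  have d: "det A = 1" "det B = 1" and c: "cis s = sgn (aut_factor A \<i>)" "cis t = sgn (aut_factor B \<i>)"
    using assms by (auto simp: e SL2R_cover_carrier)
  have nz: "aut_factor A \<i> \<noteq> 0" "aut_factor B \<i> \<noteq> 0" "aut_factor A (moebius_act B \<i>) \<noteq> 0"
    using d aut_factor_nonzero Im_moebius_act by auto
  then show ?thesis
    using d c by (simp add: e SL2R_cover_mult SL2R_cover_carrier det_mul cis_mult[symmetric]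
        cis_Arg aut_factor_mult sgn_mult sgn_divide sgn_zero_iff)
qed

text \<open>The following facts show that this is the universal cover of \<open>SL(2,\<real>)\<close>.\<close>

lemma group_SL2R_cover: "group SL2R_cover"
proof (rule groupI)
  fix x y z assume c: "x \<in> carrier SL2R_cover" "y \<in> carrier SL2R_cover" "z \<in> carrier SL2R_cover"
  obtain A r B s C t where e: "x = (A, r)" "y = (B, s)" "z = (C, t)" by (cases x, cases y, cases z)
  have d: "det A = 1" "det B = 1" "det C = 1" using c by (auto simp: e SL2R_cover_carrier)
  then have "Im (moebius_act C \<i>) > 0" by (simp add: Im_moebius_act)
  moreover from this have "moebius_act (B ** C) \<i> = moebius_act B (moebius_act C \<i>)"
    using d by (intro moebius_act_mult aut_factor_nonzero) auto
  ultimately show "x \<otimes>\<^bsub>SL2R_cover\<^esub> y \<otimes>\<^bsub>SL2R_cover\<^esub> z = x \<otimes>\<^bsub>SL2R_cover\<^esub> (y \<otimes>\<^bsub>SL2R_cover\<^esub> z)"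
    using arg_factor_cocycle[of A B "moebius_act C \<i>"] d
    by (simp add: e SL2R_cover_mult matrix_mul_assoc)
next
  fix x assume c: "x \<in> carrier SL2R_cover"
  obtain A t where x: "x = (A, t)" by (cases x)
  have d: "det A = 1" and t: "cis t = sgn (aut_factor A \<i>)" using c by (auto simp: x SL2R_cover_carrier)
  then obtain B where B: "B ** A = mat 1"
    by (metis invertible_det_nz invertible_left_inverse zero_neq_one)
  have dB: "det B = 1" using det_mul[of B A] B d by simp
  have nz: "aut_factor A \<i> \<noteq> 0" "aut_factor B \<i> \<noteq> 0" "aut_factor B (moebius_act A \<i>) \<noteq> 0"
    using d dB aut_factor_nonzero Im_moebius_act by auto
  let ?s = "- t - arg_factor B (moebius_act A \<i>)"
  have "aut_factor B (moebius_act A \<i>) * aut_factor A \<i> = 1"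
    using aut_factor_mult[of A \<i> B] nz B by (simp add: aut_factor_one)
  then have "sgn (aut_factor B (moebius_act A \<i>)) * sgn (aut_factor A \<i>) = 1"
    by (metis sgn_mult sgn_one)
  then have "cis ?s = sgn (aut_factor B \<i>)"
    using nz by (simp add: cis_divide[symmetric] cis_inverse[symmetric] t cis_Arg sgn_divide field_simps sgn_zero_iff)
  then show "\<exists>y\<in>carrier SL2R_cover. y \<otimes>\<^bsub>SL2R_cover\<^esub> x = \<one>\<^bsub>SL2R_cover\<^esub>"
    using dB B by (intro bexI[of _ "(B, ?s)"]) (auto simp: x SL2R_cover_mult SL2R_cover_one SL2R_cover_carrier)
next
  fix x assume "x \<in> carrier SL2R_cover"
  then show "\<one>\<^bsub>SL2R_cover\<^esub> \<otimes>\<^bsub>SL2R_cover\<^esub> x = x"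
    by (cases x) (simp add: SL2R_cover_mult SL2R_cover_one aut_factor_one)
qed (auto simp: SL2R_cover_closed SL2R_cover_one SL2R_cover_carrier aut_factor_one)

lemma fst_hom_SL2R: "fst \<in> hom SL2R_cover SL2R"
  by (auto simp: hom_def SL2R_def SL2R_cover_def)

lemma covering_SL2R: "covering_space (carrier SL2R_cover) fst (carrier SL2R)"
proof
  show "continuous_on (carrier SL2R_cover) fst" by (intro continuous_intros)
  show "fst ` carrier SL2R_cover = carrier SL2R"
  proof safe
    fix A assume "A \<in> carrier SL2R"
    then have "(A, Arg (aut_factor A \<i>)) \<in> carrier SL2R_cover"
      by (simp add: SL2R_def SL2R_cover_carrier cis_Arg aut_factor_nonzero)
    then show "A \<in> fst ` carrier SL2R_cover" by force
  qed (simp add: SL2R_def SL2R_cover_carrier)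
  fix A0 assume "A0 \<in> carrier SL2R"
  then have j0: "aut_factor A0 \<i> \<noteq> 0" by (simp add: SL2R_def aut_factor_nonzero)
  define t0 where "t0 = Arg (aut_factor A0 \<i>)"
  define h where "h A = aut_factor A \<i> / aut_factor A0 \<i>" for A
  have ch: "continuous_on S h" for S
    unfolding h_def aut_factor_def by (intro continuous_intros) (use j0 in \<open>simp add: aut_factor_def\<close>)
  define T where "T = carrier SL2R \<inter> {A. Re (h A) > 0}"
  define u where "u n = carrier SL2R_cover \<inter> {(A, t). Re (h A) > 0 \<and> \<bar>t - t0 - 2 * pi * real_of_int n\<bar> < pi / 2}" for n
  define q where "q n A = (A, t0 + 2 * pi * real_of_int n + Arg (h A))" for n A
  have cis_per: "cis (2 * pi * real_of_int n) = 1" for n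
    by (rule cis_multiple_2pi) simp
  have cis_t0: "cis t0 = sgn (aut_factor A0 \<i>)" by (simp add: t0_def cis_Arg j0)
  have q1: "q n A \<in> u n" if "A \<in> T" for n A
  proof -
    have A: "det A = 1" "Re (h A) > 0" using that by (auto simp: T_def SL2R_def)
    then have nz: "aut_factor A \<i> \<noteq> 0" by (simp add: aut_factor_nonzero)
    have "h A \<noteq> 0" using A by auto
    then have "cis (t0 + 2 * pi * real_of_int n + Arg (h A)) = sgn (aut_factor A \<i>)"
      using j0 by (simp add: cis_mult[symmetric] cis_per cis_t0 cis_Arg) (simp add: h_def sgn_divide sgn_zero_iff)
    moreover have "\<bar>Arg (h A)\<bar> < pi / 2" using A Arg_Re_pos by blast
    ultimately show ?thesis using A by (simp add: u_def q_def SL2R_cover_carrier)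
  qed
  have cis_h: "cis (t - t0) = sgn (h A)" if "(A, t) \<in> carrier SL2R_cover" for A t
    using that by (simp add: SL2R_cover_carrier cis_divide[symmetric] cis_t0 h_def sgn_divide)
  have q2: "q n A = (A, t)" if "(A, t) \<in> u n" for n A t
  proof -
    have A: "Re (h A) > 0" "\<bar>t - t0 - 2 * pi * real_of_int n\<bar> < pi / 2"
      and m: "(A, t) \<in> carrier SL2R_cover" using that by (auto simp: u_def)
    have hA: "h A \<noteq> 0" using A by auto
    have "cis (t - t0 - 2 * pi * real_of_int n) = sgn (h A)"
      using cis_h[OF m] by (simp add: cis_divide[symmetric] cis_per)
    then have "of_real (cmod (h A)) * cis (t - t0 - 2 * pi * real_of_int n) = h A"
      using hA by (simp add: sgn_div_norm scaleR_conv_of_real field_simps)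
    then have "of_real (cmod (h A)) * exp (\<i> * of_real (t - t0 - 2 * pi * real_of_int n)) = h A"
      by (simp only: cis_conv_exp)
    then have "Arg (h A) = t - t0 - 2 * pi * real_of_int n"
      by (rule Arg_unique) (use A hA pi_gt_zero in \<open>simp_all add: abs_less_iff, linarith+\<close>)
    then show ?thesis by (simp add: q_def)
  qed
  show "\<exists>T. A0 \<in> T \<and> openin (top_of_set (carrier SL2R)) T \<and>
      (\<exists>v. \<Union> v = carrier SL2R_cover \<inter> fst -` T \<and> (\<forall>u\<in>v. openin (top_of_set (carrier SL2R_cover)) u) \<and>
        disjoint v \<and> (\<forall>u\<in>v. \<exists>q. homeomorphism u T fst q))"
  proof (intro exI[of _ T] conjI exI[of _ "range u"] ballI)
    show "A0 \<in> T" using \<open>A0 \<in> carrier SL2R\<close> j0 by (simp add: T_def h_def)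
    have "open {A. Re (h A) > 0}"
      using ch by (intro open_Collect_less continuous_intros) auto
    then show "openin (top_of_set (carrier SL2R)) T" by (auto simp: T_def openin_open)
    have sub: "u n \<subseteq> carrier SL2R_cover \<inter> fst -` T" for n
      by (auto simp: u_def T_def SL2R_cover_carrier SL2R_def)
    have sup: "\<exists>n. (A, t) \<in> u n" if "(A, t) \<in> carrier SL2R_cover" "A \<in> T" for A t
    proof -
      have h: "Re (h A) > 0" using that by (simp add: T_def)
      then have "cis (Arg (h A)) = cis (t - t0)" using cis_h[OF that(1)] by (subst cis_Arg) auto
      then have "sin (t - t0) = sin (Arg (h A)) \<and> cos (t - t0) = cos (Arg (h A))"
        by (simp add: complex_eq_iff)
      then obtain n :: int where "t - t0 = Arg (h A) + 2 * pi * n"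
        using sin_cos_eq_iff[of "t - t0" "Arg (h A)"] by blast
      then have "(A, t) = q n A" by (simp add: q_def)
      then show ?thesis using q1[OF that(2)] by metis
    qed
    show "\<Union> (range u) = carrier SL2R_cover \<inter> fst -` T"
    proof
      show "\<Union> (range u) \<subseteq> carrier SL2R_cover \<inter> fst -` T" using sub by blast
      show "carrier SL2R_cover \<inter> fst -` T \<subseteq> \<Union> (range u)"
      proof
        fix x assume "x \<in> carrier SL2R_cover \<inter> fst -` T"
        then show "x \<in> \<Union> (range u)" using sup[of "fst x" "snd x"] by auto
      qed
    qed
    have "open {(A, t). Re (h A) > 0 \<and> \<bar>t - t0 - 2 * pi * real_of_int n\<bar> < pi / 2}" for n
    proof -
      have "open {x :: (real^2^2) \<times> real. 0 < Re (h (fst x))}"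
        by (intro open_Collect_less continuous_intros continuous_on_compose2[OF ch[of UNIV]]) auto
      moreover have "open {x :: (real^2^2) \<times> real. \<bar>snd x - t0 - 2 * pi * real_of_int n\<bar> < pi / 2}"
        by (intro open_Collect_less continuous_intros)
      ultimately show ?thesis
        using open_Int by (fastforce simp: case_prod_unfold Collect_conj_eq)
    qed
    then show "openin (top_of_set (carrier SL2R_cover)) w" if "w \<in> range u" for w
      using that by (auto simp: u_def openin_open)
    show "disjoint (range u)"
    proof (clarsimp simp: pairwise_def disjnt_iff)
      fix m n A t assume ne: "u m \<noteq> u n" and "(A, t) \<in> u m" "(A, t) \<in> u n"
      then have "q m A = q n A" using q2 by simp
      then have "m = n" by (simp add: q_def)
      then show False using ne by simp
    qed
    show "\<exists>q. homeomorphism w T fst q" if "w \<in> range u" for w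
    proof -
      obtain n where w: "w = u n" using \<open>w \<in> range u\<close> by blast
      have hn: "h A \<notin> \<real>\<^sub>\<le>\<^sub>0" if "A \<in> T" for A
        using that by (auto simp: T_def complex_nonpos_Reals_iff)
      have "homeomorphism (u n) T fst (q n)"
      proof
        show "continuous_on (u n) fst" by (intro continuous_intros)
        show "continuous_on T (q n)" unfolding q_def by (intro continuous_intros ch) (rule hn)
        show "fst ` u n \<subseteq> T" using sub by blast
        show "q n ` T \<subseteq> u n" using q1 by blast
        show "q n (fst x) = x" if "x \<in> u n" for x using q2[of "fst x" "snd x"] that by simp
      qed (simp add: q_def)
      then show ?thesis using w by blast
    qed
  qed
qed

lemma simply_connected_SL2R_cover: "simply_connected (carrier SL2R_cover)"
proof -
  define f :: "(real^2^2) \<times> real \<Rightarrow> real \<times> complex" where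
    "f = (\<lambda>(A, t). ((A$1$1 * A$2$1 + A$1$2 * A$2$2) / ((A$2$1)\<^sup>2 + (A$2$2)\<^sup>2),
        Complex (ln (cmod (aut_factor A \<i>))) t))"
  define g :: "real \<times> complex \<Rightarrow> (real^2^2) \<times> real" where
    "g = (\<lambda>(x, w). let c = Im (exp w); d = Re (exp w); r = (cmod (exp w))\<^sup>2 in
        (\<chi> i j. if i = 1 then (if j = 1 then x * c + d / r else x * d - c / r)
                else (if j = 1 then c else d), Im w))"
  have aut: "aut_factor A \<i> = Complex (A$2$2) (A$2$1)" for A
    by (simp add: aut_factor_def complex_eq_iff)
  have e0: "(Im (exp w))\<^sup>2 + (Re (exp w))\<^sup>2 = (cmod (exp w))\<^sup>2" for w
    by (simp add: cmod_def)
  have e1: "cmod (exp w) \<noteq> 0" for w :: complex by simp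
  have fg: "f (g y) = y" for y
  proof (cases y)
    case (Pair x w)
    define c where "c = Im (exp w)" define d where "d = Re (exp w)" define r where "r = (cmod (exp w))\<^sup>2"
    have r: "r \<noteq> 0" "c\<^sup>2 + d\<^sup>2 = r" using e0[of w] by (auto simp: r_def c_def d_def)
    have "((x * c + d / r) * c + (x * d - c / r) * d) = x * r"
      unfolding r(2)[symmetric] by (simp add: power2_eq_square algebra_simps)
    moreover have "Complex d c = exp w" by (simp add: c_def d_def)
    then have "ln (cmod (Complex d c)) = Re w" by simp
    ultimately show ?thesis
      using r by (simp add: f_def g_def Pair aut Let_def del: norm_exp_eq_Re flip: c_def d_def r_def)
  qed
  have gc: "g y \<in> carrier SL2R_cover" for y
  proof (cases y)
    case (Pair x w)
    define c where "c = Im (exp w)" define d where "d = Re (exp w)" define r where "r = (cmod (exp w))\<^sup>2"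
    have r: "r \<noteq> 0" "c\<^sup>2 + d\<^sup>2 = r" using e0[of w] by (auto simp: r_def c_def d_def)
    have "(x * c + d / r) * d - (x * d - c / r) * c = (c\<^sup>2 + d\<^sup>2) / r"
      by (simp add: power2_eq_square algebra_simps add_divide_distrib)
    then have "(x * c + d / r) * d - (x * d - c / r) * c = 1" using r by simp
    moreover have "Complex d c = exp w" by (simp add: c_def d_def)
    moreover have "sgn (exp w) = cis (Im w)" 
      by (subst exp_eq_polar) (simp add: sgn_div_norm norm_mult scaleR_conv_of_real)
    ultimately show ?thesis
      by (simp add: g_def Pair Let_def SL2R_cover_carrier det_2 aut del: norm_exp_eq_Re flip: c_def d_def r_def)
  qed
  have gf: "g (f y) = y" if "y \<in> carrier SL2R_cover" for y
  proof (cases y)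
    case (Pair A t)
    define a b c d where "a = A$1$1" and "b = A$1$2" and "c = A$2$1" and "d = A$2$2"
    have m: "det A = 1" "cis t = sgn (Complex d c)"
      using that by (auto simp: Pair SL2R_cover_carrier aut c_def d_def)
    then have det: "a * d - b * c = 1" by (simp add: det_2 a_def b_def c_def d_def)
    then have nz: "Complex d c \<noteq> 0" by (auto simp: complex_eq_iff)
    have nn: "c\<^sup>2 + d\<^sup>2 \<noteq> 0" using nz by (auto simp: complex_eq_iff sum_power2_eq_zero_iff)
    have "exp (Complex (ln (cmod (Complex d c))) t) = of_real (cmod (Complex d c)) * cis t"
      using nz by (simp add: exp_eq_polar exp_of_real)
    also have "\<dots> = Complex d c" using m nz by (simp add: sgn_div_norm scaleR_conv_of_real)
    finally have ex: "exp (Complex (ln (cmod (Complex d c))) t) = Complex d c" .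
    have r: "(cmod (Complex d c))\<^sup>2 = c\<^sup>2 + d\<^sup>2" by (simp add: cmod_power2)
    have add: "x / n * y + z / n = (x * y + z * 1) / n" and diff: "x / n * y - z / n = (x * y - z * 1) / n"
      for x y z n :: real by (simp_all add: add_divide_distrib diff_divide_distrib)
    have "(a * c + b * d) / (c\<^sup>2 + d\<^sup>2) * c + d / (c\<^sup>2 + d\<^sup>2) = ((a * c + b * d) * c + d * 1) / (c\<^sup>2 + d\<^sup>2)"
      by (rule add)
    also have "(a * c + b * d) * c + d * 1 = a * (c\<^sup>2 + d\<^sup>2)"
      unfolding det[symmetric] by (simp add: power2_eq_square algebra_simps)
    finally have 1: "(a * c + b * d) / (c\<^sup>2 + d\<^sup>2) * c + d / (c\<^sup>2 + d\<^sup>2) = a" by (simp only: nonzero_mult_div_cancel_right[OF nn])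
    have "(a * c + b * d) / (c\<^sup>2 + d\<^sup>2) * d - c / (c\<^sup>2 + d\<^sup>2) = ((a * c + b * d) * d - c * 1) / (c\<^sup>2 + d\<^sup>2)"
      by (rule diff)
    also have "(a * c + b * d) * d - c * 1 = b * (c\<^sup>2 + d\<^sup>2)"
      unfolding det[symmetric] by (simp add: power2_eq_square algebra_simps)
    finally have 2: "(a * c + b * d) / (c\<^sup>2 + d\<^sup>2) * d - c / (c\<^sup>2 + d\<^sup>2) = b" by (simp only: nonzero_mult_div_cancel_right[OF nn])
    have "fst (g (f y)) = A"
      using 1 2 by (simp add: Pair f_def g_def aut Let_def vec_eq_iff forall_2 ex r del: norm_exp_eq_Re
          flip: a_def b_def c_def d_def) 
    then show ?thesis by (simp add: Pair f_def g_def Let_def prod_eq_iff)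
  qed
  have "homeomorphism (carrier SL2R_cover) UNIV f g"
  proof
    have nz: "(A$2$1)\<^sup>2 + (A$2$2)\<^sup>2 \<noteq> 0" "aut_factor A \<i> \<noteq> 0" if "(A, t) \<in> carrier SL2R_cover" for A t
      using that aut_factor_nonzero[of A \<i>]
      by (auto simp: SL2R_cover_carrier aut complex_eq_iff sum_power2_eq_zero_iff)
    show "continuous_on (carrier SL2R_cover) f"
      unfolding f_def case_prod_unfold aut_factor_def Complex_eq
      by (intro continuous_intros) (use nz in \<open>auto simp: aut_factor_def\<close>)
    have cif: "continuous_on UNIV (\<lambda>x. if Q then u x else v x)"
      if "continuous_on UNIV u" "continuous_on UNIV v" for Q and u v :: "real \<times> complex \<Rightarrow> real"
      using that by (cases Q) simp_all
    show "continuous_on UNIV g"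
      unfolding g_def case_prod_unfold Let_def
      by (intro continuous_intros continuous_on_vec_lambda cif) auto
  qed (use fg gf gc in auto)
  then have "carrier SL2R_cover homeomorphic (UNIV :: (real \<times> complex) set)"
    unfolding homeomorphic_def by blast
  then show ?thesis
    using homeomorphic_simply_connected_eq convex_imp_simply_connected[OF convex_UNIV] by blast
qed

subsection \<open>The Heisenberg groups\<close>

text \<open>With \<open>X\<^sub>j = e\<^sub>j\<close> and \<open>Y\<^sub>j = \<i> e\<^sub>j\<close> one has \<open>\<omega>(X\<^sub>j, Y\<^sub>j) = 1\<close>.\<close>

definition std_symplectic :: "complex^'m \<Rightarrow> complex^'m \<Rightarrow> real" where
  "std_symplectic v w = (\<Sum>j\<in>UNIV. Im (cnj (v$j) * w$j))"

lemma bilinear_std_symplectic: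
  "bilinear (std_symplectic :: complex^'m \<Rightarrow> complex^'m \<Rightarrow> real)"
  unfolding bilinear_def
  by (auto intro!: linearI simp: std_symplectic_def sum.distrib[symmetric] sum_distrib_left algebra_simps)

lemmas std_symplectic_simps =
  bilinear_ladd[OF bilinear_std_symplectic] bilinear_radd[OF bilinear_std_symplectic]
  bilinear_lmul[OF bilinear_std_symplectic] bilinear_rmul[OF bilinear_std_symplectic]
  bilinear_lneg[OF bilinear_std_symplectic] bilinear_rneg[OF bilinear_std_symplectic]
  bilinear_lzero[OF bilinear_std_symplectic] bilinear_rzero[OF bilinear_std_symplectic]

lemma std_symplectic_flip: "std_symplectic v w = - std_symplectic w v"
  by (simp add: std_symplectic_def sum_negf[symmetric] algebra_simps)

definition Heisenberg :: "((complex^'m) \<times> real) monoid" where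
  "Heisenberg =
     \<lparr>carrier = UNIV,
      mult = (\<lambda>(v, s) (w, t). (v + w, s + t + std_symplectic v w / 2)),
      one = 0\<rparr>"

lemma group_Heisenberg: "group (Heisenberg :: ((complex^'m) \<times> real) monoid)"
proof (rule groupI)
  fix x :: "(complex^'m) \<times> real" assume "x \<in> carrier Heisenberg"
  have "std_symplectic (fst x) (fst x) = 0" using std_symplectic_flip[of "fst x" "fst x"] by simp
  then show "\<exists>y\<in>carrier Heisenberg. y \<otimes>\<^bsub>Heisenberg\<^esub> x = \<one>\<^bsub>Heisenberg\<^esub>"
    by (intro bexI[of _ "- x"])
       (auto simp: Heisenberg_def std_symplectic_simps case_prod_unfold prod_eq_iff)
qed (auto simp: Heisenberg_def std_symplectic_simps zero_prod_def field_simps)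

subsection \<open>The groups \<open>GH(\<psi>)\<close>\<close>

text \<open>
  To allow \<open>p = 0\<close> or \<open>q = 0\<close>, the splitting \<open>\<complex>^m = \<complex>^p \<oplus> \<complex>^q\<close> is given by a set \<open>P\<close> of indices:
  \<open>\<complex>^p\<close> consists of the vectors supported on \<open>P\<close> and \<open>\<complex>^q\<close> of those supported on \<open>- P\<close>.
  Accordingly \<open>t^q\<close> consists of \<open>'m \<times> 'm\<close> matrices acting trivially on \<open>\<complex>^p\<close>.
\<close>

definition coord_proj :: "'m set \<Rightarrow> complex^'m \<Rightarrow> complex^'m" where
  "coord_proj P v = (\<chi> j. if j \<in> P then v$j else 0)"

definition cartan_u :: "'m set \<Rightarrow> (complex^'m^'m) set" where
  "cartan_u Q = {A. (\<forall>i j. i \<noteq> j \<longrightarrow> A$i$j = 0) \<and> (\<forall>j\<in>Q. Re (A$j$j) = 0) \<and> (\<forall>j. j \<notin> Q \<longrightarrow> A$j$j = 0)}"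

text \<open>\<open>\<real>^(2p+1) = \<real> Z\<^sub>0 \<oplus> \<complex>^p\<close>\<close>

definition abelian_part :: "'m set \<Rightarrow> (real \<times> (complex^'m)) set" where
  "abelian_part P = UNIV \<times> range (coord_proj P)"

text \<open>
  The triple \<open>(s, l, v)\<close> stands for \<open>s Z\<^sub>1 + l Z\<^sub>0 + v\<close>; in the bracket, the action of
  \<open>\<psi>\<close> is the one of \<open>\<real>^(2p+1)\<close> on \<open>\<complex>^q\<close>.
\<close>

definition gh_bracket :: "'m set \<Rightarrow> (real \<times> (complex^'m) \<Rightarrow> complex^'m^'m) \<Rightarrow>
    real \<times> real \<times> (complex^'m) \<Rightarrow> real \<times> real \<times> (complex^'m) \<Rightarrow> real \<times> real \<times> (complex^'m::finite)" where
  "gh_bracket P \<psi> = (\<lambda>(s, l, v) (s', l', v').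
     (std_symplectic v v', 0,
      \<psi> (l, coord_proj P v) *v coord_proj (- P) v' - \<psi> (l', coord_proj P v') *v coord_proj (- P) v))"

definition gh_J :: "real \<times> real \<times> (complex^'m) \<Rightarrow> real \<times> real \<times> (complex^'m)" where
  "gh_J = (\<lambda>(s, l, v). (l, - s, \<i> *s v))"

definition exp_diag :: "complex^'m^'m \<Rightarrow> complex^'m^'m" where
  "exp_diag A = (\<chi> i j. if i = j then exp (A$i$i) else 0)"

text \<open>
  \<open>GH(\<psi>)\<close> is the central extension of \<open>\<real>^(2p+1) \<ltimes> \<complex>^q\<close> (with \<open>x\<close> acting by \<open>exp (\<psi> x)\<close>) which
  integrates the cocycle \<open>\<omega>\<^sub>m\<close>. Note that \<open>exp (\<psi> x)\<close> is the identity on \<open>\<complex>^p\<close>.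
\<close>

definition GH :: "'m set \<Rightarrow> (real \<times> (complex^'m) \<Rightarrow> complex^'m^'m) \<Rightarrow>
    (real \<times> real \<times> (complex^'m::finite)) monoid" where
  "GH P \<psi> =
     \<lparr>carrier = UNIV,
      mult = (\<lambda>(s, l, v) (s', l', v').
        let w = exp_diag (\<psi> (l, coord_proj P v)) *v v'
        in (s + s' + std_symplectic v w / 2, l + l', v + w)),
      one = 0\<rparr>"

lemma coord_proj_linear: "linear (coord_proj P)"
  by (auto intro!: linearI simp: coord_proj_def vec_eq_iff)

lemma exp_diag_mult: "exp_diag A *v v = (\<chi> j. exp (A$j$j) * v$j)"
proof -
  have "(\<Sum>j\<in>UNIV. (if i = j then exp (A$i$i) else 0) * v$j) = exp (A$i$i) * v$i" for i
    by (subst sum.cong[OF refl, of _ _ "\<lambda>j. if i = j then exp (A$i$i) * v$j else 0"]) auto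
  then show ?thesis by (simp add: exp_diag_def matrix_vector_mult_def vec_eq_iff)
qed

lemma coord_proj_in: "(l, coord_proj P v) \<in> abelian_part P"
  by (simp add: abelian_part_def)

lemma has_derivative_vec_lambda:
  fixes f :: "'c::finite \<Rightarrow> 'd::real_normed_vector \<Rightarrow> complex"
  assumes "\<And>j. (f j has_derivative f' j) F"
  shows "((\<lambda>x. \<chi> j. f j x) has_derivative (\<lambda>h. \<chi> j. f' j h)) F"
proof -
  have e: "(\<chi> j. g j) = (\<Sum>j\<in>UNIV. axis j (g j))" for g :: "'c::finite \<Rightarrow> complex"
    by (simp add: vec_eq_iff axis_def)
  have bl: "bounded_linear (axis j :: complex \<Rightarrow> complex^'c)" for j :: 'c
    by (intro linear_conv_bounded_linear[THEN iffD1] linearI) (auto simp: axis_def vec_eq_iff)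
  show ?thesis unfolding e
    by (rule has_derivative_sum, rule bounded_linear.has_derivative[OF bl assms])
qed

context
  fixes P :: "'m::finite set" and \<psi> :: "real \<times> (complex^'m) \<Rightarrow> complex^'m^'m"
  assumes psi: "linear_map_on (abelian_part P) (cartan_u (- P)) \<psi>"
begin

lemma psi_linear: "linear (\<lambda>(l, v). \<psi> (l, coord_proj P v))"
proof (rule linearI)
  fix x y :: "real \<times> (complex^'m)" and c :: real
  obtain l v l' v' where e: "x = (l, v)" "y = (l', v')" by (metis prod.collapse)
  have "\<psi> ((l, coord_proj P v) + (l', coord_proj P v')) = \<psi> (l, coord_proj P v) + \<psi> (l', coord_proj P v')"
    "\<psi> (c *\<^sub>R (l, coord_proj P v)) = c *\<^sub>R \<psi> (l, coord_proj P v)"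
    using psi coord_proj_in[of _ P] unfolding linear_map_on_def by blast+
  then show "(case x + y of (l, v) \<Rightarrow> \<psi> (l, coord_proj P v)) =
      (case x of (l, v) \<Rightarrow> \<psi> (l, coord_proj P v)) + (case y of (l, v) \<Rightarrow> \<psi> (l, coord_proj P v))"
    "(case c *\<^sub>R x of (l, v) \<Rightarrow> \<psi> (l, coord_proj P v)) =
      c *\<^sub>R (case x of (l, v) \<Rightarrow> \<psi> (l, coord_proj P v))"
    by (simp_all add: e linear_add[OF coord_proj_linear] linear_scale[OF coord_proj_linear])
qed

definition gh_angle where "gh_angle j x = (case x of (l, v) \<Rightarrow> \<psi> (l, coord_proj P v) $ j $ j)"

lemma gh_angle_linear: "linear (gh_angle j)"
  using linear_compose[OF psi_linear, of "\<lambda>A. A $ j $ j"]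
  by (simp add: gh_angle_def o_def case_prod_unfold linear_iff)

lemma psi_cartan: "\<psi> (l, coord_proj P v) \<in> cartan_u (- P)"
  using psi coord_proj_in unfolding linear_map_on_def by blast

lemma gh_angle_P: "j \<in> P \<Longrightarrow> gh_angle j x = 0"
  using psi_cartan by (cases x) (auto simp: gh_angle_def cartan_u_def)

lemma Re_ang: "Re (gh_angle j x) = 0"
proof (cases x)
  case (Pair l v)
  then show ?thesis using psi_cartan[of l v] gh_angle_P[of j x]
    by (cases "j \<in> P") (auto simp: gh_angle_def cartan_u_def)
qed

definition gh_rot where "gh_rot x v = (\<chi> j. exp (gh_angle j x) * v$j)"

lemma gh_rot_eq: "exp_diag (\<psi> (l, coord_proj P v)) *v w = gh_rot (l, v) w"
  by (simp add: exp_diag_mult gh_rot_def gh_angle_def)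

lemma gh_rot_simps:
  "gh_rot x (v + w) = gh_rot x v + gh_rot x w" "gh_rot 0 v = v" "gh_rot x 0 = 0"
  "gh_rot x (c *\<^sub>R v) = c *\<^sub>R gh_rot x v" "gh_rot x (gh_rot y v) = gh_rot (x + y) v"
  by (simp_all add: gh_rot_def vec_eq_iff distrib_left linear_0[OF gh_angle_linear] linear_add[OF gh_angle_linear] exp_add)

lemma gh_rot_cong: "coord_proj P v = coord_proj P w \<Longrightarrow> gh_rot (l, v) = gh_rot (l, w)"
  by (simp add: gh_rot_def gh_angle_def fun_eq_iff)

lemma coord_proj_rot: "coord_proj P (gh_rot x v) = coord_proj P v"
  by (auto simp: coord_proj_def gh_rot_def gh_angle_P vec_eq_iff)

lemma rot_sympl: "std_symplectic (gh_rot x v) (gh_rot x w) = std_symplectic v w"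
proof -
  have "cnj (exp (gh_angle j x) * v$j) * (exp (gh_angle j x) * w$j) = cnj (v$j) * w$j" for j
  proof -
    have "cnj (exp (gh_angle j x)) * exp (gh_angle j x) = exp (cnj (gh_angle j x) + gh_angle j x)"
      by (simp add: exp_cnj exp_add)
    also have "cnj (gh_angle j x) + gh_angle j x = 0" by (simp add: complex_eq_iff Re_ang)
    finally show ?thesis by (simp add: algebra_simps)
  qed
  then show ?thesis by (simp only: std_symplectic_def gh_rot_def vec_lambda_beta)
qed

lemma GH_mult: "(s, l, v) \<otimes>\<^bsub>GH P \<psi>\<^esub> (s', l', v') =
    (s + s' + std_symplectic v (gh_rot (l, v) v') / 2, l + l', v + gh_rot (l, v) v')"
  by (simp add: GH_def gh_rot_eq Let_def)

lemma rot_add_rot: "gh_rot (l + l', v + gh_rot y v') = gh_rot (l + l', v + v')"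
  by (rule gh_rot_cong) (simp add: linear_add[OF coord_proj_linear] coord_proj_rot)

lemma group_GH: "group (GH P \<psi>)"
proof (rule groupI)
  fix x y z :: "real \<times> real \<times> (complex^'m)"
  obtain s l v where x: "x = (s, l, v)" by (rule prod_cases3)
  obtain s' l' v' where y: "y = (s', l', v')" by (rule prod_cases3)
  obtain t k w where z: "z = (t, k, w)" by (rule prod_cases3)
  note e = x y z
  have "gh_rot (l, v) (gh_rot (l', v') w) = gh_rot (l + l', v + gh_rot (l, v) v') w"
    by (simp add: rot_add_rot gh_rot_simps)
  then show "x \<otimes>\<^bsub>GH P \<psi>\<^esub> y \<otimes>\<^bsub>GH P \<psi>\<^esub> z = x \<otimes>\<^bsub>GH P \<psi>\<^esub> (y \<otimes>\<^bsub>GH P \<psi>\<^esub> z)"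
    using rot_sympl[of "(l, v)" v' "gh_rot (l', v') w"]
    by (simp add: e GH_mult gh_rot_simps(1) std_symplectic_simps field_simps)
next
  fix x :: "real \<times> real \<times> (complex^'m)"
  obtain s l v where x: "x = (s, l, v)" by (rule prod_cases3)
  define v' where "v' = gh_rot (- l, - v) (- v)"
  have v'': "gh_rot (- l, v') v = - v'"
  proof -
    have "gh_rot (- l, v') = gh_rot (- l, - v)"
      by (rule gh_rot_cong) (simp add: v'_def coord_proj_rot)
    then show ?thesis
      using gh_rot_simps(4)[of "(- l, - v)" "-1" v] by (simp add: v'_def)
  qed
  have "std_symplectic v' v' = 0" using std_symplectic_flip[of v' v'] by simp
  then show "\<exists>y\<in>carrier (GH P \<psi>). y \<otimes>\<^bsub>GH P \<psi>\<^esub> x = \<one>\<^bsub>GH P \<psi>\<^esub>"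
    by (intro bexI[of _ "(- s, - l, v')"])
       (simp_all add: x GH_mult v'' std_symplectic_simps, simp_all add: GH_def zero_prod_def)
next
  fix x :: "real \<times> real \<times> (complex^'m)"
  have rot0: "gh_rot (0, 0) v = v" for v
    using gh_rot_simps(2) by (simp add: zero_prod_def)
  have "\<one>\<^bsub>GH P \<psi>\<^esub> = (0, 0, 0)" by (simp add: GH_def zero_prod_def)
  then show "\<one>\<^bsub>GH P \<psi>\<^esub> \<otimes>\<^bsub>GH P \<psi>\<^esub> x = x"
    by (cases x) (simp add: GH_mult std_symplectic_simps rot0)
qed (simp_all add: GH_def)

lemma psi_action:
  "\<psi> (l, coord_proj P v) *v coord_proj (- P) w = (\<chi> j. gh_angle j (l, v) * w$j)"
proof -
  have "(\<psi> (l, coord_proj P v) *v coord_proj (- P) w) $ i = gh_angle i (l, v) * w$i" for i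
  proof -
    have "(\<psi> (l, coord_proj P v) *v coord_proj (- P) w) $ i =
        (\<Sum>j\<in>UNIV. if j = i then gh_angle i (l, v) * w$i else 0)"
      unfolding matrix_vector_mult_def vec_lambda_beta
      using psi_cartan[of l v] gh_angle_P[of _ "(l, v)"]
      by (intro sum.cong refl) (auto simp: coord_proj_def cartan_u_def gh_angle_def)
    then show ?thesis by simp
  qed
  then show ?thesis by (simp add: vec_eq_iff)
qed

lemma lie_algebra_GH: "lie_algebra (GH P \<psi>) = UNIV"
  by (simp add: lie_algebra_def GH_def tangent_space_UNIV)

lemma left_translate_GH:
  "left_translate (GH P \<psi>) (s, l, v) (s', l', v') =
     (s' + std_symplectic v (gh_rot (l, v) v') / 2, l', gh_rot (l, v) v')"
proof -
  let ?L = "\<lambda>(s'::real, l'::real, v'::complex^'m). (s' + std_symplectic v (gh_rot (l, v) v') / 2, l', gh_rot (l, v) v')"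
  have "linear ?L"
    by (auto intro!: linearI simp: gh_rot_simps std_symplectic_simps field_simps)
  then have "(?L has_derivative ?L) (at 0)"
    by (intro bounded_linear_imp_has_derivative linear_conv_bounded_linear[THEN iffD1])
  then have "((\<lambda>h. (s, l, v) + ?L h) has_derivative ?L) (at 0)"
    using has_derivative_add[OF has_derivative_const] by fastforce
  moreover have "(\<lambda>h. (s, l, v) + ?L h) = (\<lambda>h. (s, l, v) \<otimes>\<^bsub>GH P \<psi>\<^esub> h)"
    by (auto simp: fun_eq_iff GH_mult)
  ultimately have "((\<lambda>h. (s, l, v) \<otimes>\<^bsub>GH P \<psi>\<^esub> h) has_derivative ?L) (at 0)"
    by simp
  from frechet_derivative_at[OF this, symmetric] show ?thesis
    by (simp add: left_translate_def GH_def)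
qed

lemma left_translate_GH_derivative:
  "((\<lambda>g. left_translate (GH P \<psi>) g (s', l', v')) has_derivative
     (\<lambda>(s, l, v). (std_symplectic v v' / 2, 0, \<chi> j. gh_angle j (l, v) * v'$j))) (at 0)"
proof -
  have bl: "bounded_linear (gh_angle j)" for j
    using gh_angle_linear linear_conv_bounded_linear by blast
  have bls: "bounded_linear (\<lambda>g::real \<times> real \<times> (complex^'m). snd g)"
    by (rule bounded_linear_snd)
  have a: "((\<lambda>g::real \<times> real \<times> (complex^'m). gh_angle j (snd g)) has_derivative (\<lambda>h. gh_angle j (snd h))) (at 0)" for j
    by (rule bounded_linear_imp_has_derivative[OF bounded_linear_compose[OF bl bls]])
  have "((\<lambda>g::real \<times> real \<times> (complex^'m). exp (gh_angle j (snd g)) * v'$j) has_derivative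
      (\<lambda>h. gh_angle j (snd h) * v'$j)) (at 0)" for j
    using has_derivative_mult_left[OF has_derivative_compose[OF a
        DERIV_exp[unfolded has_field_derivative_def]], of j "v'$j"]
    by (simp add: linear_0[OF gh_angle_linear])
  then have rot: "((\<lambda>g::real \<times> real \<times> (complex^'m). gh_rot (snd g) v') has_derivative (\<lambda>h. \<chi> j. gh_angle j (snd h) * v'$j)) (at 0)"
    unfolding gh_rot_def by (rule has_derivative_vec_lambda)
  have vv: "((\<lambda>g::real \<times> real \<times> (complex^'m). snd (snd g)) has_derivative (\<lambda>h. snd (snd h))) (at 0)"
    by (intro has_derivative_snd has_derivative_ident)
  have "bounded_bilinear (std_symplectic :: complex^'m \<Rightarrow> _)"
    using bilinear_std_symplectic bilinear_conv_bounded_bilinear by blast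
  from bounded_bilinear.FDERIV[OF this vv rot]
  have om: "((\<lambda>g::real \<times> real \<times> (complex^'m). std_symplectic (snd (snd g)) (gh_rot (snd g) v')) has_derivative
      (\<lambda>h. std_symplectic (snd (snd h)) v')) (at 0)"
    by (simp add: gh_rot_simps std_symplectic_simps)
  have p: "((\<lambda>g::real \<times> real \<times> (complex^'m). s' + std_symplectic (snd (snd g)) (gh_rot (snd g) v') / 2)
      has_derivative (\<lambda>h. std_symplectic (snd (snd h)) v' / 2)) (at 0)"
    using has_derivative_add[OF has_derivative_const[of s']
        bounded_linear.has_derivative[OF bounded_linear_divide[of 2] om]] by simp
  have "((\<lambda>g::real \<times> real \<times> (complex^'m). (s' + std_symplectic (snd (snd g)) (gh_rot (snd g) v') / 2, l', gh_rot (snd g) v'))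
      has_derivative (\<lambda>h. (std_symplectic (snd (snd h)) v' / 2, 0, \<chi> j. gh_angle j (snd h) * v'$j))) (at 0)"
    by (intro has_derivative_Pair has_derivative_const rot p)
  moreover have "left_translate (GH P \<psi>) g (s', l', v') =
      (s' + std_symplectic (snd (snd g)) (gh_rot (snd g) v') / 2, l', gh_rot (snd g) v')" for g
    using left_translate_GH[of "fst g" "fst (snd g)" "snd (snd g)"] by simp
  ultimately show ?thesis by (simp add: case_prod_unfold)
qed

text \<open>
  The next facts show that \<open>GH P \<psi>\<close> is the simply connected Lie group with Lie algebra \<open>gh(\<psi>)\<close> and
  that \<open>gh_J\<close> is integrable.
\<close>

lemma lie_bracket_GH: "lie_bracket (GH P \<psi>) X Y = gh_bracket P \<psi> X Y"
proof -
  obtain s l v where X: "X = (s, l, v)" by (rule prod_cases3)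
  obtain s' l' v' where Y: "Y = (s', l', v')" by (rule prod_cases3)
  have D: "frechet_derivative (\<lambda>g. left_translate (GH P \<psi>) g (s', l', v')) (at 0) (s, l, v) =
      (std_symplectic v v' / 2, 0, \<chi> j. gh_angle j (l, v) * v'$j)" for s l v s' l' v'
    using frechet_derivative_at[OF left_translate_GH_derivative, symmetric] by simp
  have om: "std_symplectic v v' / 2 - std_symplectic v' v / 2 = std_symplectic v v'"
    using std_symplectic_flip[of v' v] by simp
  have c: "carrier (GH P \<psi>) = UNIV" "\<one>\<^bsub>GH P \<psi>\<^esub> = 0" by (simp_all add: GH_def)
  show ?thesis
    by (simp only: lie_bracket_def X Y c D gh_bracket_def prod.case psi_action om diff_Pair diff_self)
qed

lemma simply_connected_GH: "simply_connected (carrier (GH P \<psi>))"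
  by (simp add: GH_def convex_imp_simply_connected)

lemma gh_J_left_invariant: "left_invariant_complex_structure (GH P \<psi>) gh_J"
proof -
  have add: "gh_J (X + Y) = gh_J X + gh_J Y" and scale: "gh_J (c *\<^sub>R X) = c *\<^sub>R gh_J X"
    and square: "gh_J (gh_J X) = - X" for c and X Y :: "real \<times> real \<times> (complex^'m)"
    by (cases X, cases Y, simp add: gh_J_def vector_add_ldistrib vec_eq_iff)+
  have om: "std_symplectic (\<i> *s v) (\<i> *s v') = std_symplectic v v'"
    "std_symplectic v (\<i> *s v') = - std_symplectic (\<i> *s v) v'" for v v' :: "complex^'m"
    by (simp_all add: std_symplectic_def sum_negf[symmetric] algebra_simps)
  have "gh_bracket P \<psi> (gh_J X) (gh_J Y) - gh_bracket P \<psi> X Y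
      - gh_J (gh_bracket P \<psi> X (gh_J Y)) - gh_J (gh_bracket P \<psi> (gh_J X) Y) = 0" for X Y
  proof -
    obtain s l v where X: "X = (s, l, v)" by (rule prod_cases3)
    obtain s' l' v' where Y: "Y = (s', l', v')" by (rule prod_cases3)
    show ?thesis
      by (simp add: X Y gh_bracket_def gh_J_def psi_action om std_symplectic_simps prod_eq_iff)
         (simp add: vec_eq_iff algebra_simps)
  qed
  then show ?thesis
    by (simp add: left_invariant_complex_structure_def lie_algebra_GH lie_bracket_GH
        linear_map_on_def add scale square)
qed

end

end

(*
  In each case G acts on the target by holomorphic maps, and the biholomorphism is an orbit map, so
  that only its differential at the identity has to be compared with J.

  (a), (b): Integrability forces ad (J E), for E spanning the centre R, to commute with J. This yields a
  vector v in C^2 and a number l with Re l <> 0 such that (s, X) |-> (l s + X) v carries J to i. For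
  SU(2) the map is (s, A) |-> exp (l s) A v. For SL(2,R) one may take v = (z, 1), and the map is the lift
  (s, A) |-> (A.z, l s + log (c z + d)) of the same map in the coordinates (w1 / w2, log w2). If z lies
  in the lower half plane, pass to the conjugate structure.

  (c), (d): The quotient by the centre is holomorphic already in the linear coordinates, and the central
  coordinate becomes holomorphic after adding a quadratic function of the quotient coordinates.
*)

theory Submission
  imports Defs
begin

subsection \<open>Calculus of smooth maps\<close>

text \<open>\<open>diffeomorphism_on\<close> demands a smooth inverse. No inverse function theorem
  is used: every orbit map gets an inverse in closed form, and both maps are smooth on open subsets
  of the ambient spaces.

  (a), (b): Putting \<open>X = E\<close> in the integrability condition leaves [J E, J Y] = J
  [J E, Y]. The condition Re l \<noteq> 0 makes the line parameter \<open>s\<close> recoverable from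
  a point of the orbit: in (b) from its norm, in (a) from the real part of the logarithm corrected
  by the height in the upper half plane. In (a) the linear orbit map would forget the sheet of the
  covering, since it sees only the matrix; the logarithm of the second coordinate keeps it.

  (c), (d): The group law adds the real number \<omega>(v, w) / 2 to the central coordinate, which
  is not complex linear in \<open>w\<close>. The cross term of the quadratic correction supplies the
  other half of a Hermitian form. The sum is complex linear in \<open>w\<close>, so left
  translations become complex affine.\<close>

lemma Ck_on_cong:
  assumes "open S" "\<And>x. x \<in> S \<Longrightarrow> f x = g x"
  shows "Ck_on k S f \<longleftrightarrow> Ck_on k S g"
  using assms(2)
proof (induction k arbitrary: f g)
  case 0 then show ?case by (simp cong: continuous_on_cong)
next
  case (Suc k)
  have hd: "(f has_derivative D) (at x) \<longleftrightarrow> (g has_derivative D) (at x)" if "x \<in> S" for x D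
    using that Suc.prems assms(1)
    by (metis has_derivative_transform_within_open)
  then have fd: "frechet_derivative f (at x) = frechet_derivative g (at x)" if "x \<in> S" for x
    using that by (simp add: frechet_derivative_def)
  have "Ck_on k S (\<lambda>x. frechet_derivative f (at x) v) \<longleftrightarrow> Ck_on k S (\<lambda>x. frechet_derivative g (at x) v)" for v
    by (rule Suc.IH) (simp add: fd)
  with hd show ?case by (simp add: differentiable_def)
qed

text \<open>\<open>Ck_on\<close> is phrased with the choice operator
  \<open>frechet_derivative\<close>. Derivatives at a point are unique, so an explicit family
  \<open>D\<close> may take its place.\<close>

lemma Ck_on_SucI:
  assumes S: "open S" and D: "\<And>x. x \<in> S \<Longrightarrow> (f has_derivative D x) (at x)"
    and C: "\<And>v. Ck_on k S (\<lambda>x. D x v)"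
  shows "Ck_on (Suc k) S f"
proof -
  have "Ck_on k S (\<lambda>x. frechet_derivative f (at x) v) \<longleftrightarrow> Ck_on k S (\<lambda>x. D x v)" for v
    by (rule Ck_on_cong[OF S]) (simp add: frechet_derivative_at[OF D, symmetric])
  with C D show ?thesis by (auto simp: differentiable_def)
qed

lemma Ck_on_SucD: "Ck_on (Suc k) S f \<Longrightarrow> Ck_on k S f"
proof (induction k arbitrary: f)
  case 0 then show ?case
    by (auto intro!: continuous_at_imp_continuous_on differentiable_imp_continuous_within)
next
  case (Suc k)
  have "Ck_on k S (\<lambda>x. frechet_derivative f (at x) v)" for v
    using Suc.IH Suc.prems by auto
  then show ?case using Suc.prems by simp
qed

lemma Ck_on_derivative:
  assumes "Ck_on (Suc k) S f" "x \<in> S"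
  shows "(f has_derivative frechet_derivative f (at x)) (at x)"
  using assms by (simp add: frechet_derivative_works)

lemma Ck_on_const: "Ck_on k S (\<lambda>x. c)"
  by (induction k arbitrary: c) (simp_all add: frechet_derivative_const)

lemma Ck_on_bounded_linear:
  assumes S: "open S" and h: "bounded_linear h" and f: "Ck_on k S f"
  shows "Ck_on k S (\<lambda>x. h (f x))"
  using f
proof (induction k arbitrary: f)
  case 0 then show ?case using bounded_linear.continuous_on[OF h] by simp
next
  case (Suc k)
  show ?case
  proof (rule Ck_on_SucI[OF S])
    show "((\<lambda>x. h (f x)) has_derivative (\<lambda>v. h (frechet_derivative f (at x) v))) (at x)" if "x \<in> S" for x
      by (rule bounded_linear.has_derivative[OF h Ck_on_derivative[OF Suc.prems that]])
    show "Ck_on k S (\<lambda>x. h (frechet_derivative f (at x) v))" for v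
      using Suc by simp
  qed
qed

lemma Ck_on_add:
  assumes S: "open S" and "Ck_on k S f" "Ck_on k S g"
  shows "Ck_on k S (\<lambda>x. f x + g x)"
  using assms(2,3)
proof (induction k arbitrary: f g)
  case 0 then show ?case by (simp add: continuous_on_add)
next
  case (Suc k)
  show ?case
  proof (rule Ck_on_SucI[OF S])
    show "((\<lambda>x. f x + g x) has_derivative (\<lambda>v. frechet_derivative f (at x) v + frechet_derivative g (at x) v)) (at x)"
      if "x \<in> S" for x
      by (intro has_derivative_add Ck_on_derivative[OF Suc.prems(1) that] Ck_on_derivative[OF Suc.prems(2) that])
    show "Ck_on k S (\<lambda>x. frechet_derivative f (at x) v + frechet_derivative g (at x) v)" for v
      using Suc by simp
  qed
qed

lemma Ck_on_bilinear:
  assumes S: "open S" and p: "bounded_bilinear p" and "Ck_on k S f" "Ck_on k S g"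
  shows "Ck_on k S (\<lambda>x. p (f x) (g x))"
  using assms(3,4)
proof (induction k arbitrary: f g)
  case 0 then show ?case using bounded_bilinear.continuous_on[OF p] by simp
next
  case (Suc k)
  show ?case
  proof (rule Ck_on_SucI[OF S])
    show "((\<lambda>x. p (f x) (g x)) has_derivative
        (\<lambda>v. p (f x) (frechet_derivative g (at x) v) + p (frechet_derivative f (at x) v) (g x))) (at x)"
      if "x \<in> S" for x
      by (intro bounded_bilinear.FDERIV[OF p] Ck_on_derivative[OF Suc.prems(1) that] Ck_on_derivative[OF Suc.prems(2) that])
    show "Ck_on k S (\<lambda>x. p (f x) (frechet_derivative g (at x) v) + p (frechet_derivative f (at x) v) (g x))" for v
      using Suc.prems Suc.prems[THEN Ck_on_SucD] by (intro Ck_on_add[OF S] Suc.IH) simp_all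
  qed
qed

lemma Ck_on_sum:
  assumes "open S" "\<And>i. i \<in> I \<Longrightarrow> Ck_on k S (f i)"
  shows "Ck_on k S (\<lambda>x. \<Sum>i\<in>I. f i x)"
  using assms(2)
  by (induction I rule: infinite_finite_induct) (auto simp: Ck_on_const intro!: Ck_on_add[OF assms(1)])

text \<open>\<open>Ck_on\<close> controls the derivative of \<open>g\<close> in fixed directions
  only, while the chain rule evaluates it in the moving direction \<open>?f' x v\<close>. Expanding
  that direction in \<open>Basis\<close> gives a finite sum of products, and the induction
  hypothesis applies to each directional derivative of \<open>g\<close>.\<close>

lemma Ck_on_compose:
  fixes g :: "'b::euclidean_space \<Rightarrow> 'c::real_normed_vector"
  assumes S: "open S" and T: "open T" and im: "f ` S \<subseteq> T" and "Ck_on k S f" "Ck_on k T g"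
  shows "Ck_on k S (\<lambda>x. g (f x))"
  using assms(4,5)
proof (induction k arbitrary: g)
  case 0 then show ?case using im continuous_on_compose2 by (metis Ck_on.simps(1))
next
  case (Suc k)
  let ?f' = "\<lambda>x. frechet_derivative f (at x)" and ?g' = "\<lambda>y. frechet_derivative g (at y)"
  show ?case
  proof (rule Ck_on_SucI[OF S])
    fix x assume x: "x \<in> S"
    then have g: "(g has_derivative ?g' (f x)) (at (f x))"
      using im by (intro Ck_on_derivative[OF Suc.prems(2)]) auto
    have expand: "?g' (f x) w = (\<Sum>b\<in>Basis. (w \<bullet> b) *\<^sub>R ?g' (f x) b)" for w
    proof -
      have "?g' (f x) (\<Sum>b\<in>Basis. (w \<bullet> b) *\<^sub>R b) = (\<Sum>b\<in>Basis. (w \<bullet> b) *\<^sub>R ?g' (f x) b)"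
        using has_derivative_linear[OF g] by (simp add: linear_sum linear_scale)
      then show ?thesis by (simp add: euclidean_representation)
    qed
    have "((\<lambda>x. g (f x)) has_derivative (\<lambda>v. ?g' (f x) (?f' x v))) (at x)"
      by (rule has_derivative_compose[OF Ck_on_derivative[OF Suc.prems(1) x] g])
    also have "(\<lambda>v. ?g' (f x) (?f' x v)) = (\<lambda>v. \<Sum>b\<in>Basis. (?f' x v \<bullet> b) *\<^sub>R ?g' (f x) b)"
      by (rule ext) (rule expand)
    finally show "((\<lambda>x. g (f x)) has_derivative (\<lambda>v. \<Sum>b\<in>Basis. (?f' x v \<bullet> b) *\<^sub>R ?g' (f x) b)) (at x)" .
  next
    fix v
    have "Ck_on k S (\<lambda>x. ?f' x v \<bullet> b)" for b
      using Suc.prems(1) by (intro Ck_on_bounded_linear[OF S bounded_linear_inner_left]) simp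
    moreover have "Ck_on k S (\<lambda>x. ?g' (f x) b)" for b
      using Suc.prems Suc.prems(1)[THEN Ck_on_SucD] by (intro Suc.IH) simp_all
    ultimately show "Ck_on k S (\<lambda>x. \<Sum>b\<in>Basis. (?f' x v \<bullet> b) *\<^sub>R ?g' (f x) b)"
      by (intro Ck_on_sum[OF S] Ck_on_bilinear[OF S bounded_bilinear_scaleR])
  qed
qed

section \<open>Closure rules for smooth functions\<close>

named_theorems Cinf_intros

lemma Cinf_on_const [Cinf_intros]: "Cinf_on S (\<lambda>x. c)"
  by (simp add: Cinf_on_def Ck_on_const)

lemma Cinf_on_bounded_linear:
  "bounded_linear h \<Longrightarrow> open S \<Longrightarrow> Cinf_on S f \<Longrightarrow> Cinf_on S (\<lambda>x. h (f x))"
  by (simp add: Cinf_on_def Ck_on_bounded_linear)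

lemma Cinf_on_bilinear:
  "bounded_bilinear p \<Longrightarrow> open S \<Longrightarrow> Cinf_on S f \<Longrightarrow> Cinf_on S g \<Longrightarrow> Cinf_on S (\<lambda>x. p (f x) (g x))"
  by (simp add: Cinf_on_def Ck_on_bilinear)

lemma Cinf_on_id [Cinf_intros]:
  assumes "open S" shows "Cinf_on S (\<lambda>x. x)"
proof -
  have "Ck_on k S (\<lambda>x. x)" for k
  proof (cases k)
    case (Suc n)
    show ?thesis unfolding Suc by (rule Ck_on_SucI[OF assms has_derivative_ident Ck_on_const])
  qed (simp add: continuous_on_id)
  then show ?thesis by (simp add: Cinf_on_def)
qed

lemma Cinf_on_linear:
  "linear h \<Longrightarrow> open S \<Longrightarrow> Cinf_on S f \<Longrightarrow> Cinf_on S (\<lambda>x. h (f x :: 'b::euclidean_space))"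
  by (simp add: Cinf_on_bounded_linear linear_conv_bounded_linear)

lemma Cinf_on_compose:
  assumes "Cinf_on T g" "open T" "open S" "Cinf_on S f" "f ` S \<subseteq> T"
  shows "Cinf_on S (\<lambda>x. g (f x))"
  using assms Ck_on_compose unfolding Cinf_on_def by blast

lemma Cinf_on_differentiable: "Cinf_on S f \<Longrightarrow> x \<in> S \<Longrightarrow> f differentiable (at x)"
  unfolding Cinf_on_def by (drule spec[of _ "Suc 0"]) simp

lemma Cinf_on_add [Cinf_intros]:
  "open S \<Longrightarrow> Cinf_on S f \<Longrightarrow> Cinf_on S g \<Longrightarrow> Cinf_on S (\<lambda>x. f x + g x)"
  by (simp add: Cinf_on_def Ck_on_add)

lemma Cinf_on_sum [Cinf_intros]:
  "open S \<Longrightarrow> (\<And>i. i \<in> I \<Longrightarrow> Cinf_on S (f i)) \<Longrightarrow> Cinf_on S (\<lambda>x. \<Sum>i\<in>I. f i x)"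
  by (simp add: Cinf_on_def Ck_on_sum)

lemma Cinf_on_minus [Cinf_intros]: "open S \<Longrightarrow> Cinf_on S f \<Longrightarrow> Cinf_on S (\<lambda>x. - f x)"
  by (rule Cinf_on_bounded_linear[OF bounded_linear_minus[OF bounded_linear_ident]])

lemma Cinf_on_diff [Cinf_intros]:
  "open S \<Longrightarrow> Cinf_on S f \<Longrightarrow> Cinf_on S g \<Longrightarrow> Cinf_on S (\<lambda>x. f x - g x)"
  using Cinf_on_add[of S f "\<lambda>x. - g x"] Cinf_on_minus[of S g] by simp

lemma Cinf_on_scaleR [Cinf_intros]:
  "open S \<Longrightarrow> Cinf_on S f \<Longrightarrow> Cinf_on S g \<Longrightarrow> Cinf_on S (\<lambda>x. f x *\<^sub>R g x)"
  by (rule Cinf_on_bilinear[OF bounded_bilinear_scaleR])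

lemma Cinf_on_mult [Cinf_intros]:
  fixes f g :: "'a::euclidean_space \<Rightarrow> 'b::real_normed_algebra"
  shows "open S \<Longrightarrow> Cinf_on S f \<Longrightarrow> Cinf_on S g \<Longrightarrow> Cinf_on S (\<lambda>x. f x * g x)"
  by (rule Cinf_on_bilinear[OF bounded_bilinear_mult])

lemma Cinf_on_power [Cinf_intros]:
  fixes f :: "'a::euclidean_space \<Rightarrow> 'b::real_normed_algebra_1"
  shows "open S \<Longrightarrow> Cinf_on S f \<Longrightarrow> Cinf_on S (\<lambda>x. f x ^ n)"
  by (induction n) (auto intro: Cinf_intros)

lemmas Cinf_on_bounded_linear_intros [Cinf_intros] =
  Cinf_on_bounded_linear[OF bounded_linear_fst] Cinf_on_bounded_linear[OF bounded_linear_snd]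
  Cinf_on_bounded_linear[OF bounded_linear_of_real]
  Cinf_on_bounded_linear[OF bounded_linear_Re] Cinf_on_bounded_linear[OF bounded_linear_Im]
  Cinf_on_bounded_linear[OF bounded_linear_cnj] Cinf_on_bounded_linear[OF bounded_linear_vec_nth]

lemma Cinf_on_Pair [Cinf_intros]:
  fixes f :: "'a::euclidean_space \<Rightarrow> 'b::real_normed_vector" and g :: "'a \<Rightarrow> 'c::real_normed_vector"
  assumes "open S" "Cinf_on S f" "Cinf_on S g"
  shows "Cinf_on S (\<lambda>x. (f x, g x))"
proof -
  have "Cinf_on S (\<lambda>x. (f x, 0) + (0, g x))"
    using assms by (intro Cinf_on_add Cinf_on_bounded_linear[where h = "\<lambda>y. (y, 0)"]
      Cinf_on_bounded_linear[where h = "\<lambda>y. (0, y)"] bounded_linear_Pair bounded_linear_ident bounded_linear_zero)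
  then show ?thesis by simp
qed

lemma Cinf_on_vec [Cinf_intros]:
  fixes f :: "'n::finite \<Rightarrow> 'a::euclidean_space \<Rightarrow> 'b::euclidean_space"
  assumes "open S" "\<And>i. Cinf_on S (f i)"
  shows "Cinf_on S (\<lambda>x. \<chi> i. f i x)"
proof -
  have lin: "linear (axis i :: 'b \<Rightarrow> 'b^'n)" for i :: 'n
    by (rule linearI) (auto simp: axis_def vec_eq_iff)
  have e: "(\<chi> i. f i x) = (\<Sum>i\<in>UNIV. axis i (f i x))" for x
    by (simp add: vec_eq_iff axis_def)
  show ?thesis unfolding e
    by (rule Cinf_on_sum[OF assms(1)]) (rule Cinf_on_linear[OF lin assms])
qed

lemma Cinf_on_if [Cinf_intros]:
  "(Q \<Longrightarrow> Cinf_on S f) \<Longrightarrow> (\<not> Q \<Longrightarrow> Cinf_on S g) \<Longrightarrow> Cinf_on S (\<lambda>x. if Q then f x else g x)"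
  by (cases Q) simp_all

lemma Cinf_on_exp [Cinf_intros]:
  fixes f :: "'a::euclidean_space \<Rightarrow> 'b::{real_normed_field,banach,euclidean_space}"
  assumes "open S" "Cinf_on S f" shows "Cinf_on S (\<lambda>x. exp (f x))"
proof -
  have "Ck_on k UNIV (exp :: 'b \<Rightarrow> 'b)" for k
  proof (induction k)
    case (Suc k)
    show ?case
    proof (rule Ck_on_SucI)
      show "(exp has_derivative (\<lambda>v. exp x * v)) (at x)" for x :: 'b
        using DERIV_exp[of x] by (simp add: has_field_derivative_def)
      show "Ck_on k UNIV (\<lambda>x :: 'b. exp x * v)" for v
        by (intro Ck_on_bilinear[OF _ bounded_bilinear_mult] Suc Ck_on_const) simp
    qed simp
  qed (simp add: continuous_on_exp continuous_on_id)
  then have "Cinf_on UNIV (exp :: 'b \<Rightarrow> 'b)" by (simp add: Cinf_on_def)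
  from Cinf_on_compose[OF this _ assms] show ?thesis by simp
qed

lemma Cinf_on_inverse [Cinf_intros]:
  fixes f :: "'a::euclidean_space \<Rightarrow> 'b::{real_normed_field,euclidean_space}"
  assumes "open S" "Cinf_on S f" "\<And>x. x \<in> S \<Longrightarrow> f x \<noteq> 0" shows "Cinf_on S (\<lambda>x. inverse (f x))"
proof -
  let ?U = "- {0 :: 'b}"
  have U: "open ?U" by auto
  have "Ck_on k ?U (inverse :: 'b \<Rightarrow> 'b)" for k
  proof (induction k)
    case 0 show ?case by (auto intro!: continuous_intros)
  next
    case (Suc k)
    show ?case
    proof (rule Ck_on_SucI[OF U])
      show "(inverse has_derivative (\<lambda>v. - (inverse x * v * inverse x))) (at x)" if "x \<in> ?U" for x :: 'b
        using that has_derivative_inverse'[of x UNIV] by simp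
      show "Ck_on k ?U (\<lambda>x :: 'b. - (inverse x * v * inverse x))" for v
        by (intro Ck_on_bounded_linear[OF U bounded_linear_minus[OF bounded_linear_ident]]
          Ck_on_bilinear[OF U bounded_bilinear_mult] Suc Ck_on_const)
    qed
  qed
  then have "Cinf_on ?U (inverse :: 'b \<Rightarrow> 'b)" by (simp add: Cinf_on_def)
  then show ?thesis by (rule Cinf_on_compose[OF _ U assms(1,2)]) (use assms(3) in auto)
qed

lemma Cinf_on_divide [Cinf_intros]:
  fixes f g :: "'a::euclidean_space \<Rightarrow> 'b::{real_normed_field,euclidean_space}"
  assumes "open S" "Cinf_on S f" "Cinf_on S g" "\<And>x. x \<in> S \<Longrightarrow> g x \<noteq> 0"
  shows "Cinf_on S (\<lambda>x. f x / g x)"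
  unfolding divide_inverse by (intro Cinf_intros assms)

text \<open>Reduces the smoothness of \<open>ln\<close> and \<open>Ln\<close> to that of
  \<open>inverse\<close>.\<close>

lemma Cinf_on_primitive:
  fixes F f :: "'b::{real_normed_field,euclidean_space} \<Rightarrow> 'b"
  assumes T: "open T" and D: "\<And>x. x \<in> T \<Longrightarrow> (F has_field_derivative f x) (at x)" and f: "Cinf_on T f"
  shows "Cinf_on T F"
proof -
  have "Ck_on k T F" for k
  proof (cases k)
    case 0
    then show ?thesis using D by (auto intro!: continuous_at_imp_continuous_on DERIV_isCont)
  next
    case (Suc n)
    have "Cinf_on T (\<lambda>x. f x * v)" for v
      by (intro Cinf_intros T f)
    then show ?thesis unfolding Suc
      using D by (intro Ck_on_SucI[OF T, where D = "\<lambda>x v. f x * v"])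
         (auto simp: has_field_derivative_def Cinf_on_def)
  qed
  then show ?thesis by (simp add: Cinf_on_def)
qed

lemma Cinf_on_ln [Cinf_intros]:
  fixes f :: "'a::euclidean_space \<Rightarrow> real"
  assumes "open S" "Cinf_on S f" "\<And>x. x \<in> S \<Longrightarrow> f x > 0" shows "Cinf_on S (\<lambda>x. ln (f x))"
proof -
  have "Cinf_on {0<..} (\<lambda>x::real. inverse x)" by (intro Cinf_intros) auto
  then have "Cinf_on {0<..} (ln :: real \<Rightarrow> real)"
    by (rule Cinf_on_primitive[rotated 2]) (auto intro: DERIV_ln)
  then show ?thesis by (rule Cinf_on_compose[OF _ _ assms(1,2)]) (use assms(3) in auto)
qed

lemma Cinf_on_Ln [Cinf_intros]:
  fixes f :: "'a::euclidean_space \<Rightarrow> complex"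
  assumes "open S" "Cinf_on S f" "\<And>x. x \<in> S \<Longrightarrow> f x \<notin> \<real>\<^sub>\<le>\<^sub>0" shows "Cinf_on S (\<lambda>x. Ln (f x))"
proof -
  have U: "open (- \<real>\<^sub>\<le>\<^sub>0 :: complex set)" by (simp add: open_Compl)
  have "Cinf_on (- \<real>\<^sub>\<le>\<^sub>0) (\<lambda>x::complex. inverse x)" by (intro Cinf_intros U) auto
  then have "Cinf_on (- \<real>\<^sub>\<le>\<^sub>0) Ln"
    by (rule Cinf_on_primitive[rotated 2]) (auto intro: U has_field_derivative_Ln)
  then show ?thesis by (rule Cinf_on_compose[OF _ U assms(1,2)]) (use assms(3) in auto)
qed

lemma smooth_map_onI:
  assumes "open W" "S \<subseteq> W" "Cinf_on W f" shows "smooth_map_on S f"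
  unfolding smooth_map_on_def using assms by blast

text \<open>For an explicit inverse \<open>g\<close>, which agrees with \<open>inv_into S f\<close>
  on \<open>T\<close>. The open sets \<open>W\<close> and \<open>V\<close> carry the smooth
  extensions, because the carrier of a group may have empty interior in its ambient space.\<close>

lemma diffeomorphism_onI:
  assumes "f ` S \<subseteq> T" "g ` T \<subseteq> S" "\<And>x. x \<in> S \<Longrightarrow> g (f x) = x" "\<And>y. y \<in> T \<Longrightarrow> f (g y) = y"
    and "open W" "S \<subseteq> W" "Cinf_on W f" and "open V" "T \<subseteq> V" "Cinf_on V g"
  shows "diffeomorphism_on S T f"
proof -
  have b: "bij_betw f S T" using assms(1-4) by (intro bij_betw_byWitness[of _ g]) auto
  have inv: "inv_into S f y = g y" if "y \<in> T" for y
    using inv_into_f_f[OF bij_betw_imp_inj_on[OF b], of "g y"] assms(2,4) that by auto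
  have "\<exists>W h. open W \<and> y \<in> W \<and> Cinf_on W h \<and> (\<forall>z\<in>W \<inter> T. h z = inv_into S f z)" if "y \<in> T" for y
    using that assms(8-10) inv by (intro exI[of _ V] exI[of _ g]) auto
  then have "smooth_map_on T (inv_into S f)" unfolding smooth_map_on_def by blast
  then show ?thesis using b smooth_map_onI[OF assms(5-7)] unfolding diffeomorphism_on_def by blast
qed

subsection \<open>Left-invariant structures and biholomorphisms\<close>

text \<open>Within \<open>S\<close> both \<open>D\<close> and 0 are derivatives of \<open>f\<close>,
  and derivatives within \<open>S\<close> agree on tangent vectors. Applied to the defining
  equations of a group, this bounds its Lie algebra from above.\<close>

lemma tangent_space_kernel:
  assumes D: "(f has_derivative D) (at x)" and c: "\<And>y. y \<in> S \<Longrightarrow> f y = c" and v: "v \<in> tangent_space S x"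
  shows "D v = 0"
proof -
  obtain \<gamma> e where "(0::real) < e" "\<gamma> ` {-e<..<e} \<subseteq> S" "\<gamma> 0 = x"
    using v unfolding tangent_space_def by blast
  then have x: "x \<in> S" by fastforce
  have "(f has_derivative (\<lambda>_. 0)) (at x within S)"
    by (rule has_derivative_transform[OF x c has_derivative_const])
  from frechet_derivative_tangent[OF this v]
    frechet_derivative_tangent[OF has_derivative_at_withinI[OF D] v]
  show ?thesis by simp
qed

lemma left_translate_eq:
  assumes "((\<lambda>h. g \<otimes>\<^bsub>G\<^esub> h) has_derivative L) (at \<one>\<^bsub>G\<^esub> within carrier G)" "X \<in> lie_algebra G"
  shows "left_translate G g X = L X"
  unfolding left_translate_def
  by (rule frechet_derivative_tangent[OF assms(1) assms(2)[unfolded lie_algebra_def]])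

text \<open>Values on tangent vectors do not depend on the chosen derivatives, so any computed
  \<open>L\<close> and \<open>E\<close> can replace the \<open>frechet_derivative\<close> terms in
  the bracket.\<close>

lemma lie_bracket_eq:
  assumes one: "\<one>\<^bsub>G\<^esub> \<in> carrier G"
    and L: "\<And>g. g \<in> carrier G \<Longrightarrow> ((\<lambda>h. g \<otimes>\<^bsub>G\<^esub> h) has_derivative L g) (at \<one>\<^bsub>G\<^esub> within carrier G)"
    and E: "\<And>X. X \<in> lie_algebra G \<Longrightarrow> ((\<lambda>g. L g X) has_derivative E X) (at \<one>\<^bsub>G\<^esub> within carrier G)"
    and X: "X \<in> lie_algebra G" and Y: "Y \<in> lie_algebra G"
  shows "lie_bracket G X Y = E Y X - E X Y"
proof -
  have "frechet_derivative (\<lambda>g. left_translate G g X) (at \<one>\<^bsub>G\<^esub> within carrier G) Y = E X Y"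
    if X: "X \<in> lie_algebra G" and Y: "Y \<in> lie_algebra G" for X Y
  proof -
    have "((\<lambda>g. left_translate G g X) has_derivative E X) (at \<one>\<^bsub>G\<^esub> within carrier G)"
      by (rule has_derivative_transform[OF one _ E[OF X]]) (rule left_translate_eq[OF L X])
    from frechet_derivative_tangent[OF this Y[unfolded lie_algebra_def]] show ?thesis .
  qed
  with X Y show ?thesis by (simp add: lie_bracket_def)
qed

lemma smooth_map_on_differentiable:
  assumes "smooth_map_on S f" "x \<in> S" shows "f differentiable (at x within S)"
proof -
  obtain W g where W: "open W" "x \<in> W" "Cinf_on W g" "\<forall>y\<in>W \<inter> S. g y = f y"
    using assms unfolding smooth_map_on_def by blast
  obtain D where "(g has_derivative D) (at x)"
    using Cinf_on_differentiable[OF W(3,2)] unfolding differentiable_def by blast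
  then have D: "(g has_derivative D) (at x within S)" by (rule has_derivative_at_withinI)
  obtain d where d: "0 < d" "ball x d \<subseteq> W" using W(1,2) open_contains_ball by blast
  have "(f has_derivative D) (at x within S)"
  proof (rule has_derivative_transform_within[OF D d(1) assms(2)])
    fix y assume y: "y \<in> S" "dist y x < d"
    then have "y \<in> W" using d(2) by (meson dist_commute_lessI mem_ball subsetD)
    with y show "g y = f y" using W(4) by blast
  qed
  then show ?thesis unfolding differentiable_def by blast
qed

text \<open>Differentiability of left translations at the identity makes
  \<open>left_translate\<close> a true differential, so that derivatives at \<open>g\<close> can be
  pulled back to the identity by the chain rule.\<close>

locale translation_group = group G for G :: "'a::euclidean_space monoid" (structure) +
  assumes translation_differentiable:
    "g \<in> carrier G \<Longrightarrow> (\<lambda>h. g \<otimes> h) differentiable (at \<one> within carrier G)"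
begin

lemma left_translate_derivative:
  "g \<in> carrier G \<Longrightarrow> ((\<lambda>h. g \<otimes> h) has_derivative left_translate G g) (at \<one> within carrier G)"
  using translation_differentiable unfolding left_translate_def by (simp add: frechet_derivative_works)

text \<open>By the chain rule the left side is, as a function of \<open>X\<close>, a derivative at
  the identity of the same function as \<open>E\<close>; the two agree on tangent vectors.\<close>

lemma derivative_left_translate:
  assumes g: "g \<in> carrier G" and X: "X \<in> lie_algebra G"
    and D: "(F has_derivative D) (at g within carrier G)"
    and E: "((\<lambda>h. F (g \<otimes> h)) has_derivative E) (at \<one> within carrier G)"
  shows "D (left_translate G g X) = E X"
proof -
  have "(F has_derivative D) (at (g \<otimes> \<one>) within (\<lambda>h. g \<otimes> h) ` carrier G)"
    unfolding r_one[OF g] by (rule has_derivative_subset[OF D]) (use g in auto)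
  from diff_chain_within[OF left_translate_derivative[OF g] this]
  have "((\<lambda>h. F (g \<otimes> h)) has_derivative (\<lambda>X. D (left_translate G g X))) (at \<one> within carrier G)"
    by (simp add: o_def)
  from frechet_derivative_tangent[OF this] frechet_derivative_tangent[OF E] X
  show ?thesis by (simp add: lie_algebra_def)
qed

text \<open>
  If \<open>G\<close> acts on the target by maps \<open>\<Phi>\<close> with complex linear differentials and \<open>F\<close> is equivariant, then
  holomorphy of \<open>F\<close> at the identity propagates to all of \<open>G\<close>.
\<close>

lemma biholomorphism_onto_equivariant:
  fixes F :: "'a \<Rightarrow> complex^'n"
  assumes U: "open U" and F: "diffeomorphism_on (carrier G) U F"
    and equiv: "\<And>g h. g \<in> carrier G \<Longrightarrow> h \<in> carrier G \<Longrightarrow> F (g \<otimes> h) = \<Phi> g (F h)"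
    and \<Phi>: "\<And>g. g \<in> carrier G \<Longrightarrow> (\<Phi> g has_derivative \<Phi>' g) (at (F \<one>))"
    and \<Phi>': "\<And>g y. g \<in> carrier G \<Longrightarrow> \<Phi>' g (\<i> *s y) = \<i> *s \<Phi>' g y"
    and D: "(F has_derivative D) (at \<one> within carrier G)"
    and J: "\<And>X. X \<in> lie_algebra G \<Longrightarrow> J X \<in> lie_algebra G \<and> D (J X) = \<i> *s D X"
  shows "biholomorphism_onto G J U F"
proof -
  have *: "frechet_derivative F (at g within carrier G) (left_translate G g X) = \<Phi>' g (D X)"
    if g: "g \<in> carrier G" and X: "X \<in> lie_algebra G" for g X
  proof -
    have hd: "(F has_derivative frechet_derivative F (at g within carrier G)) (at g within carrier G)"
      using smooth_map_on_differentiable[OF _ g, of F] F by (simp add: frechet_derivative_works diffeomorphism_on_def)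
    have "((\<lambda>h. \<Phi> g (F h)) has_derivative (\<lambda>X. \<Phi>' g (D X))) (at \<one> within carrier G)"
      by (rule has_derivative_compose[OF D \<Phi>[OF g]])
    then have "((\<lambda>h. F (g \<otimes> h)) has_derivative (\<lambda>X. \<Phi>' g (D X))) (at \<one> within carrier G)"
      by (rule has_derivative_transform[OF one_closed, rotated]) (rule equiv[OF g])
    then show ?thesis by (rule derivative_left_translate[OF g X hd])
  qed
  show ?thesis
    unfolding biholomorphism_onto_def using U F J by (simp add: * \<Phi>')
qed

end

section \<open>Passage to the conjugate complex structure\<close>

lemma smooth_map_on_compose_left:
  assumes h: "bounded_linear h" and f: "smooth_map_on S f"
  shows "smooth_map_on S (\<lambda>x. h (f x))"
  unfolding smooth_map_on_def
proof
  fix x assume "x \<in> S"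
  then obtain W g where "open W" "x \<in> W" "Cinf_on W g" "\<forall>y\<in>W \<inter> S. g y = f y"
    using f unfolding smooth_map_on_def by blast
  then show "\<exists>W k. open W \<and> x \<in> W \<and> Cinf_on W k \<and> (\<forall>y\<in>W \<inter> S. k y = h (f y))"
    using Cinf_on_bounded_linear[OF h] by (intro exI[of _ W] exI[of _ "\<lambda>y. h (g y)"]) auto
qed

lemma smooth_map_on_compose_right:
  fixes h :: "'c::euclidean_space \<Rightarrow> 'a::euclidean_space"
  assumes h: "bounded_linear h" and f: "smooth_map_on S f" and T: "h ` T \<subseteq> S"
  shows "smooth_map_on T (\<lambda>x. f (h x))"
  unfolding smooth_map_on_def
proof
  fix x assume "x \<in> T"
  then obtain W g where W: "open W" "h x \<in> W" "Cinf_on W g" "\<forall>y\<in>W \<inter> S. g y = f y"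
    using f T unfolding smooth_map_on_def by blast
  let ?V = "h -` W"
  have V: "open ?V"
    by (rule continuous_open_vimage[OF W(1)]) (rule linear_continuous_at[OF h])
  have "Cinf_on ?V (\<lambda>x. g (h x))"
    by (rule Cinf_on_compose[OF W(3,1) V Cinf_on_bounded_linear[OF h V Cinf_on_id[OF V]]]) auto
  then show "\<exists>W k. open W \<and> x \<in> W \<and> Cinf_on W k \<and> (\<forall>y\<in>W \<inter> T. k y = f (h y))"
    using V W T by (intro exI[of _ ?V] exI[of _ "\<lambda>x. g (h x)"]) auto
qed

text \<open>\<open>\<kappa>\<close> is an antiholomorphic involution of the target, so it turns a
  map that is holomorphic for \<open>- J\<close> into one that is holomorphic for \<open>J\<close>.
  The inverse of the composite is the old inverse after \<open>\<kappa>\<close>.\<close>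

lemma (in translation_group) biholomorphic_to_conjugate:
  fixes U :: "(complex^'n) set"
  assumes "biholomorphic_to G (\<lambda>X. - J X) U"
    and \<kappa>: "bounded_linear \<kappa>" "\<And>y. \<kappa> (\<kappa> y) = y" "\<And>y. \<kappa> (\<i> *s y) = - (\<i> *s \<kappa> y)" "\<kappa> ` U \<subseteq> U"
    and J: "\<And>X. X \<in> lie_algebra G \<Longrightarrow> J X \<in> lie_algebra G"
  shows "biholomorphic_to G J U"
proof -
  obtain F where F: "biholomorphism_onto G (\<lambda>X. - J X) U F"
    using assms(1) unfolding biholomorphic_to_def by blast
  then have U: "open U" and d: "diffeomorphism_on (carrier G) U F"
    and hol: "\<And>g X. g \<in> carrier G \<Longrightarrow> X \<in> lie_algebra G \<Longrightarrow>
        frechet_derivative F (at g within carrier G) (left_translate G g (- J X)) =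
        \<i> *s frechet_derivative F (at g within carrier G) (left_translate G g X)"
    by (auto simp: biholomorphism_onto_def)
  have b: "bij_betw F (carrier G) U" and s: "smooth_map_on (carrier G) F" "smooth_map_on U (inv_into (carrier G) F)"
    using d by (auto simp: diffeomorphism_on_def)
  have b\<kappa>: "bij_betw \<kappa> U U" using \<kappa>(2,4) by (intro bij_betw_byWitness[of _ \<kappa>]) auto
  define H where "H x = \<kappa> (F x)" for x
  have bH: "bij_betw H (carrier G) U" using bij_betw_trans[OF b b\<kappa>] by (simp add: H_def[abs_def] o_def)
  have inv: "inv_into (carrier G) H y = inv_into (carrier G) F (\<kappa> y)" if "y \<in> U" for y
  proof -
    have y: "\<kappa> y \<in> U" using \<kappa>(4) that by auto
    let ?x = "inv_into (carrier G) F (\<kappa> y)"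
    have "?x \<in> carrier G" "F ?x = \<kappa> y" using b y by (auto simp: bij_betw_def inv_into_into f_inv_into_f)
    then show ?thesis
      using inv_into_f_f[OF bij_betw_imp_inj_on[OF bH], of ?x] by (simp add: H_def \<kappa>(2))
  qed
  have "smooth_map_on U (\<lambda>y. inv_into (carrier G) F (\<kappa> y))"
    by (rule smooth_map_on_compose_right[OF \<kappa>(1) s(2) \<kappa>(4)])
  then have "smooth_map_on U (inv_into (carrier G) H)"
    unfolding smooth_map_on_def using inv by auto
  moreover have "smooth_map_on (carrier G) H"
    unfolding H_def[abs_def] by (rule smooth_map_on_compose_left[OF \<kappa>(1) s(1)])
  ultimately have dH: "diffeomorphism_on (carrier G) U H" using bH by (simp add: diffeomorphism_on_def)
  have "frechet_derivative H (at g within carrier G) (left_translate G g (J X)) =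
      \<i> *s frechet_derivative H (at g within carrier G) (left_translate G g X)"
    if g: "g \<in> carrier G" and X: "X \<in> lie_algebra G" for g X
  proof -
    let ?D = "frechet_derivative F (at g within carrier G)"
    have hd: "(F has_derivative ?D) (at g within carrier G)"
      using smooth_map_on_differentiable[OF s(1) g] by (simp add: frechet_derivative_works)
    have "(H has_derivative frechet_derivative H (at g within carrier G)) (at g within carrier G)"
      using smooth_map_on_differentiable[OF _ g, of H] dH by (simp add: frechet_derivative_works diffeomorphism_on_def)
    moreover have "((\<lambda>h. H (g \<otimes> h)) has_derivative (\<lambda>X. \<kappa> (?D (left_translate G g X)))) (at \<one> within carrier G)"
    proof -
      have "(F has_derivative ?D) (at (g \<otimes> \<one>) within (\<lambda>h. g \<otimes> h) ` carrier G)"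
        unfolding r_one[OF g] by (rule has_derivative_subset[OF hd]) (use g in auto)
      from bounded_linear.has_derivative[OF \<kappa>(1) diff_chain_within[OF left_translate_derivative[OF g] this]]
      show ?thesis by (simp add: o_def H_def)
    qed
    ultimately have e: "frechet_derivative H (at g within carrier G) (left_translate G g X) =
        \<kappa> (?D (left_translate G g X))" if "X \<in> lie_algebra G" for X
      using derivative_left_translate[OF g that] by blast
    have "?D (left_translate G g (- J X)) = - ?D (left_translate G g (J X))"
      using has_derivative_linear[OF hd] has_derivative_linear[OF left_translate_derivative[OF g]]
      by (simp add: linear_neg)
    then have "?D (left_translate G g (J X)) = - (\<i> *s ?D (left_translate G g X))"
      using hol[OF g X] by (simp add: eq_neg_iff_add_eq_0 add.commute)
    then show ?thesis
      using e[OF X] e[OF J[OF X]] \<kappa>(3) linear_neg[OF bounded_linear.linear[OF \<kappa>(1)]] by simp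
  qed
  then show ?thesis
    unfolding biholomorphic_to_def biholomorphism_onto_def using U dH by blast
qed

lemma affine_has_derivative:
  fixes f :: "'a::euclidean_space \<Rightarrow> 'b::real_normed_vector"
  assumes "linear f" shows "((\<lambda>x. a + f x) has_derivative f) (at x within S)"
  using has_derivative_add[OF has_derivative_const bounded_linear_imp_has_derivative] assms
  by (simp add: linear_conv_bounded_linear)

lemma linear_has_derivative:
  fixes f :: "'a::euclidean_space \<Rightarrow> 'b::real_normed_vector"
  assumes "linear f" shows "(f has_derivative f) (at x within S)"
  using affine_has_derivative[OF assms, of 0] by simp

lemma linear_two_sided_inverse:
  assumes f: "linear f" and "\<And>x. g (f x) = x" "\<And>y. f (g y) = y"
  shows "linear g"
proof (rule linearI)
  show "g (x + y) = g x + g y" for x y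
    using assms(2)[of "g x + g y"] by (simp add: linear_add[OF f] assms(3))
  show "g (c *\<^sub>R x) = c *\<^sub>R g x" for c x
    using assms(2)[of "c *\<^sub>R g x"] by (simp add: linear_scale[OF f] assms(3))
qed

subsection \<open>Complex coordinates\<close>

text \<open>A complex basis with a prescribed member \<open>z\<close> is built one index at a time,
  \<open>S K b y\<close> being the complex combination of the \<open>b j\<close>, \<open>j\<close>
  in \<open>K\<close>, with coefficients \<open>y\<close>. A vector outside the complex span
  constructed so far is automatically complex independent of it. The full combination map is
  injective, hence bijective by dimension, and \<open>T\<close> is its inverse.\<close>

lemma complex_structure_coordinates:
  fixes J :: "'a::euclidean_space \<Rightarrow> 'a" and k :: "'n::finite"
  assumes J: "linear J" and JJ: "\<And>x. J (J x) = - x" and z: "z \<noteq> 0"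
    and dim: "DIM('a) = 2 * CARD('n)"
  obtains T :: "'a \<Rightarrow> complex^'n" where "linear T" "bij T" "\<And>x. T (J x) = \<i> *s T x" "T z = axis k 1"
proof -
  define S :: "'n set \<Rightarrow> ('n \<Rightarrow> 'a) \<Rightarrow> complex^'n \<Rightarrow> 'a" where
    "S K b y = (\<Sum>j\<in>K. Re (y$j) *\<^sub>R b j + Im (y$j) *\<^sub>R J (b j))" for K b y
  have S_lin: "linear (S K b)" for K b
    by (rule linearI) (simp_all add: S_def sum.distrib[symmetric] scaleR_sum_right algebra_simps)
  have S_J: "J (S K b y) = S K b (\<i> *s y)" for K b y
    by (simp add: S_def linear_sum[OF J] linear_add[OF J] linear_diff[OF J] linear_scale[OF J] JJ algebra_simps)
  have pos: "a * a + b * b \<noteq> 0" if "Complex a b \<noteq> 0" for a b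
    using that by (auto simp: complex_eq_iff sum_squares_eq_zero_iff)
  \<comment> \<open>For a complex scalar \<open>c\<close> this multiplies \<open>c u\<close> by the
    conjugate of \<open>c\<close>, which gives |c|^2 u.\<close>
  have free: "Re c *\<^sub>R u + Im c *\<^sub>R J u \<in> W \<Longrightarrow> c \<noteq> 0 \<Longrightarrow> u \<in> W"
    if W: "subspace W" and JW: "\<And>x. x \<in> W \<Longrightarrow> J x \<in> W" for W c u
  proof -
    let ?w = "Re c *\<^sub>R u + Im c *\<^sub>R J u" let ?n = "Re c * Re c + Im c * Im c"
    assume w: "?w \<in> W" and c: "c \<noteq> 0"
    have "Re c *\<^sub>R ?w - Im c *\<^sub>R J ?w \<in> W"
      by (intro subspace_diff[OF W] subspace_scale[OF W] w JW)
    also have "Re c *\<^sub>R ?w - Im c *\<^sub>R J ?w = ?n *\<^sub>R u"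
      by (simp add: linear_add[OF J] linear_scale[OF J] JJ algebra_simps)
    finally have "(1 / ?n) *\<^sub>R (?n *\<^sub>R u) \<in> W" by (rule subspace_scale[OF W])
    moreover have "?n \<noteq> 0" using pos[of "Re c" "Im c"] c by simp
    ultimately show "u \<in> W" by (simp only: scaleR_scaleR times_divide_eq_left mult_1_left divide_self
        simp_thms if_True scaleR_one)
  qed
  \<comment> \<open>The index \<open>k\<close> belongs to every stage, so the prescribed vector is
    placed before any choice is made.\<close>
  have "\<exists>b. b k = z \<and> (\<forall>y. S (insert k K) b y = 0 \<longrightarrow> (\<forall>j\<in>insert k K. y$j = 0))" for K :: "'n set"
    using finite[of K]
  proof induction
    case empty
    have "y$k = 0" if "S {k} (\<lambda>_. z) y = 0" for y
      using that free[of "{0}" "y$k" z] z linear_0[OF J] by (auto simp: S_def)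
    then show ?case by auto
  next
    case (insert i K)
    then obtain b where b: "b k = z" "\<And>y. S (insert k K) b y = 0 \<Longrightarrow> \<forall>j\<in>insert k K. y$j = 0" by blast
    let ?K = "insert k K"
    show ?case
    proof (cases "i \<in> ?K")
      case True
      then have "insert k (insert i K) = ?K" by auto
      then show ?thesis using b by metis
    next
      case False
      let ?W = "range (S ?K b)"
      have W: "subspace ?W" by (rule linear_subspace_image[OF S_lin subspace_UNIV])
      have JW: "J x \<in> ?W" if "x \<in> ?W" for x using that S_J by auto
      have "?W \<subseteq> span (b ` ?K \<union> (J \<circ> b) ` ?K)"
        by (auto simp: S_def intro!: span_sum span_add span_scale intro: span_base)
      then have "dim ?W \<le> card (b ` ?K \<union> (J \<circ> b) ` ?K)" by (rule dim_le_card) simp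
      also have "\<dots> \<le> card ?K + card ?K"
        by (rule order_trans[OF card_Un_le add_mono]) (rule card_image_le, simp)+
      also have "\<dots> < DIM('a)"
      proof -
        have "card ?K < CARD('n)" by (rule psubset_card_mono) (use False in auto)
        then show ?thesis using dim by simp
      qed
      finally obtain u where u: "u \<notin> ?W" by (metis UNIV_eq_I dim_UNIV less_irrefl)
      let ?b = "b(i := u)"
      have Sb: "S (insert i ?K) ?b y = S ?K b y + (Re (y$i) *\<^sub>R u + Im (y$i) *\<^sub>R J u)" for y
      proof -
        have "S ?K ?b y = S ?K b y" unfolding S_def by (rule sum.cong) (use False in auto)
        moreover have "S (insert i ?K) ?b y = (Re (y$i) *\<^sub>R u + Im (y$i) *\<^sub>R J u) + S ?K ?b y"
          unfolding S_def by (subst sum.insert) (use False in auto)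
        ultimately show ?thesis by simp
      qed
      have "y$j = 0" if y: "S (insert i ?K) ?b y = 0" and j: "j \<in> insert i ?K" for y j
      proof -
        have "Re (y$i) *\<^sub>R u + Im (y$i) *\<^sub>R J u = S ?K b (- y)"
          using y unfolding Sb linear_neg[OF S_lin] by (simp add: eq_neg_iff_add_eq_0 add.commute)
        then have "y$i = 0" using free[OF W JW, of "y$i" u] u by auto
        then show ?thesis using y Sb[of y] b(2)[of y] j by auto
      qed
      moreover have "?b k = z" using b False by auto
      ultimately show ?thesis by (metis insert_commute)
    qed
  qed
  from this[of UNIV] obtain b where b: "b k = z" "\<And>y. S UNIV b y = 0 \<Longrightarrow> \<forall>j. y$j = 0" by auto
  let ?S = "S UNIV b"
  have inj: "inj ?S"
    using b(2) by (auto simp: linear_injective_0[OF S_lin] vec_eq_iff)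
  have "surj ?S"
    by (rule linear_injective_imp_surjective[OF S_lin inj]) (simp add: dim)
  with inj have bij: "bij ?S" by (rule bijI)
  let ?T = "inv_into UNIV ?S"
  have TS: "?T (?S y) = y" and ST: "?S (?T x) = x" for x y
    using bij by (simp_all add: bij_is_inj bij_is_surj surj_f_inv_f)
  have "?S (axis k 1) = z"
  proof -
    have "?S (axis k 1) = (\<Sum>j\<in>UNIV. if j = k then b j else 0)"
      unfolding S_def by (rule sum.cong) (auto simp: axis_def)
    then show ?thesis by (simp add: b)
  qed
  then have "?T z = axis k 1" using TS by metis
  moreover have "?T (J x) = \<i> *s ?T x" for x
    using S_J[of UNIV b "?T x"] TS ST by metis
  moreover have "linear ?T" by (rule linear_two_sided_inverse[OF S_lin TS ST])
  ultimately show ?thesis using that bij_imp_bij_inv[OF bij] by blast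
qed

subsection \<open>The groups GH(psi)\<close>

text \<open>The inner product and \<omega> are the real and imaginary parts of one Hermitian form,
  complex linear in \<open>w\<close>. This is why the squared norm is the right correction in
  \<open>biholomorphic_GH\<close>.\<close>

lemma std_symplectic_inner:
  "Complex (v \<bullet> w) (std_symplectic v w) = (\<Sum>j\<in>UNIV. cnj (v$j) * w$j)"
  by (simp add: complex_eq_iff std_symplectic_def inner_vec_def inner_complex_def)

text \<open>The index \<open>None\<close> carries the coordinate l + i s + |v|^2 / 4. For w =
  \<open>?rot (l, v) v'\<close> the norm expands as |v + w|^2 = |v|^2 + 2 v.w + |w|^2, and the cross
  term v.w / 2 joins i \<omega>(v, w) / 2 from the group law to half the Hermitian form. This fixes
  the factor 1/4.\<close>

theorem biholomorphic_GH:
  fixes P :: "'m::finite set"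
  assumes psi: "linear_map_on (abelian_part P) (cartan_u (- P)) \<psi>"
  shows "biholomorphic_to (GH P \<psi>) gh_J (UNIV :: (complex^('m option)) set)"
proof -
  let ?G = "GH P \<psi>"
  let ?rot = "gh_rot P \<psi>" and ?ang = "gh_angle P \<psi>"
  interpret group ?G using psi by (rule group_GH)
  have carrier: "carrier ?G = UNIV" and one: "\<one>\<^bsub>?G\<^esub> = 0" by (simp_all add: GH_def)
  have L: "((\<lambda>h. (s, l, v) \<otimes>\<^bsub>?G\<^esub> h) has_derivative
      (\<lambda>(s', l', v'). (s' + std_symplectic v (?rot (l, v) v') / 2, l', ?rot (l, v) v'))) (at 0)"
    (is "(_ has_derivative ?L) _") for s l v
  proof -
    have "linear ?L"
      by (auto intro!: linearI simp: gh_rot_simps[OF psi] std_symplectic_simps field_simps)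
    then have "((\<lambda>h. (s, l, v) + ?L h) has_derivative ?L) (at 0)" by (rule affine_has_derivative)
    moreover have "(\<lambda>h. (s, l, v) + ?L h) = (\<lambda>h. (s, l, v) \<otimes>\<^bsub>?G\<^esub> h)"
      by (auto simp: fun_eq_iff GH_mult[OF psi])
    ultimately show ?thesis by simp
  qed
  interpret translation_group ?G
  proof
    show "(\<lambda>h. g \<otimes>\<^bsub>?G\<^esub> h) differentiable (at \<one>\<^bsub>?G\<^esub> within carrier ?G)" if "g \<in> carrier ?G" for g
      using L by (cases g) (auto simp: differentiable_def carrier one)
  qed
  define D :: "real \<times> real \<times> (complex^'m) \<Rightarrow> complex^('m option)" where
    "D x = (\<chi> k. case k of None \<Rightarrow> Complex (fst (snd x)) (fst x) | Some j \<Rightarrow> snd (snd x) $ j)" for x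
  define q :: "real \<times> real \<times> (complex^'m) \<Rightarrow> complex^('m option)" where
    "q x = axis None (of_real (snd (snd x) \<bullet> snd (snd x) / 4))" for x
  define F where "F x = D x + q x" for x
  define F' :: "complex^('m option) \<Rightarrow> real \<times> real \<times> (complex^'m)" where
    "F' y = (let v = (\<chi> j. y $ Some j) in (Im (y$None), Re (y$None) - v \<bullet> v / 4, v))" for y
  \<comment> \<open>The linear part of the affine action; \<open>F g\<close> is the translation
    part. Conjugates fall on the fixed vector \<open>v\<close> only, so the map is complex linear in
    \<open>y\<close>.\<close>
  define \<Phi>' :: "real \<times> real \<times> (complex^'m) \<Rightarrow> complex^('m option) \<Rightarrow> complex^('m option)" where
    "\<Phi>' g y = (case g of (s, l, v) \<Rightarrow> \<chi> k. case k of
        None \<Rightarrow> y$None + (\<Sum>j\<in>UNIV. cnj (v$j) * (exp (?ang j (l, v)) * y$(Some j))) / 2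
      | Some j \<Rightarrow> exp (?ang j (l, v)) * y$(Some j))" for g y
  have ix: "(\<forall>k. Q k) \<longleftrightarrow> Q None \<and> (\<forall>j. Q (Some j))" for Q :: "'m option \<Rightarrow> bool"
    by (metis option.exhaust)
  have F_None: "F (s, l, v) $ None = Complex l s + of_real (v \<bullet> v / 4)"
    and F_Some: "F (s, l, v) $ Some j = v $ j" for s l v j
    by (simp_all add: F_def D_def q_def axis_def)
  have "biholomorphism_onto ?G gh_J UNIV F"
  proof (rule biholomorphism_onto_equivariant)
    have 1: "F' (F x) = x" for x
      by (cases x) (simp add: F'_def Let_def F_None F_Some)
    have 2: "F (F' y) = y" for y
      by (simp add: F'_def Let_def vec_eq_iff ix F_None F_Some complex_eq_iff)
    have cD: "Cinf_on UNIV D"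
      unfolding D_def
    proof (rule Cinf_on_vec)
      fix i :: "'m option"
      show "Cinf_on UNIV (\<lambda>x::real \<times> real \<times> (complex^'m).
          case i of None \<Rightarrow> Complex (fst (snd x)) (fst x) | Some j \<Rightarrow> snd (snd x) $ j)"
        by (cases i) (auto simp: Complex_eq intro!: Cinf_intros)
    qed simp
    have axis: "bounded_linear (axis None :: complex \<Rightarrow> complex^('m option))"
      by (intro linear_conv_bounded_linear[THEN iffD1] linearI) (auto simp: axis_def vec_eq_iff)
    have "Cinf_on UNIV q"
      unfolding q_def
      by (rule Cinf_on_bounded_linear[OF axis])
         (auto intro!: Cinf_intros Cinf_on_bilinear[OF bounded_bilinear_inner])
    with cD have cF: "Cinf_on UNIV F"
      unfolding F_def[abs_def] by (intro Cinf_intros) auto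
    have cF': "Cinf_on UNIV F'"
      unfolding F'_def Let_def
      by (intro Cinf_intros Cinf_on_bilinear[OF bounded_bilinear_inner]) auto
    show "diffeomorphism_on (carrier ?G) UNIV F"
      by (rule diffeomorphism_onI[where g = F' and W = UNIV and V = UNIV])
         (auto simp: carrier 1 2 cF cF')
    show "F (g \<otimes>\<^bsub>?G\<^esub> h) = F g + \<Phi>' g (F h)" for g h
    proof (cases g, cases h)
      fix s l v s' l' v'
      assume g: "g = (s, l, v)" and h: "h = (s', l', v')"
      let ?w = "?rot (l, v) v'"
      have w: "?w $ j = exp (?ang j (l, v)) * v' $ j" for j by (simp add: gh_rot_def[OF psi])
      \<comment> \<open>The rotation angles are purely imaginary, so the term |w|^2 / 4 is exactly
        the one already contained in \<open>F h\<close>.\<close>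
      have "norm (?w $ j) = norm (v' $ j)" for j by (simp add: w norm_mult Re_ang[OF psi])
      then have ww: "?w \<bullet> ?w = v' \<bullet> v'" by (simp add: inner_vec_def dot_square_norm)
      have sum: "(\<Sum>j\<in>UNIV. cnj (v$j) * (exp (?ang j (l, v)) * v'$j)) = Complex (v \<bullet> ?w) (std_symplectic v ?w)"
        by (simp add: std_symplectic_inner w)
      show ?thesis
        by (simp add: g h GH_mult[OF psi] vec_eq_iff ix F_None F_Some \<Phi>'_def sum w)
           (simp add: complex_eq_iff inner_add_left inner_add_right ww inner_commute field_simps)
    qed
    show "((\<lambda>y. F g + \<Phi>' g y) has_derivative \<Phi>' g) (at (F \<one>\<^bsub>?G\<^esub>))" for g
    proof -
      have "linear (\<Phi>' g)"
        by (rule linearI)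
           (auto simp: \<Phi>'_def vec_eq_iff ix case_prod_unfold distrib_left sum.distrib
             add_divide_distrib scaleR_conv_of_real[where 'a = complex] sum_distrib_left mult_ac sum_divide_distrib)
      then show ?thesis by (rule affine_has_derivative)
    qed
    show "\<Phi>' g (\<i> *s y) = \<i> *s \<Phi>' g y" for g y
      by (auto simp: \<Phi>'_def vec_eq_iff ix case_prod_unfold distrib_left sum_distrib_left mult_ac sum_divide_distrib)
    have "linear D"
      by (rule linearI) (auto simp: D_def vec_eq_iff ix complex_eq_iff)
    show "(F has_derivative D) (at \<one>\<^bsub>?G\<^esub> within carrier ?G)"
    proof -
      have "((\<lambda>x::real \<times> real \<times> (complex^'m). snd (snd x) \<bullet> snd (snd x)) has_derivative (\<lambda>_. 0)) (at 0)"
        by (auto intro!: derivative_eq_intros)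
      from bounded_linear.has_derivative[OF bounded_linear_compose[OF axis
          bounded_linear_compose[OF bounded_linear_of_real bounded_linear_divide[of 4]]] this]
      have "(q has_derivative (\<lambda>_. 0)) (at 0)" by (simp add: q_def[abs_def] axis_def zero_vec_def)
      from has_derivative_add[OF bounded_linear_imp_has_derivative this, of D] \<open>linear D\<close>
      show ?thesis by (simp add: F_def[abs_def] one carrier linear_conv_bounded_linear)
    qed
    show "gh_J X \<in> lie_algebra ?G \<and> D (gh_J X) = \<i> *s D X" for X
      by (cases X) (auto simp: lie_algebra_GH[OF psi] D_def gh_J_def vec_eq_iff ix complex_eq_iff)
  qed simp
  then show ?thesis unfolding biholomorphic_to_def by blast
qed

subsection \<open>The product of the line with a Heisenberg group\<close>

lemma Real_Heisenberg_mult: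
  "(a, v, s) \<otimes>\<^bsub>Real_group \<times>\<times> Heisenberg\<^esub> (b, w, t) = (a + b, v + w, s + t + std_symplectic v w / 2)"
  by (simp add: Real_group_def Heisenberg_def)

lemma Real_Heisenberg_translation:
  "((\<lambda>h. g \<otimes>\<^bsub>Real_group \<times>\<times> (Heisenberg :: ((complex^'m) \<times> real) monoid)\<^esub> h) has_derivative
     (\<lambda>X. X + (0, 0, std_symplectic (fst (snd g)) (fst (snd X)) / 2))) (at x within S)"
    (is "(_ has_derivative ?L) _")
proof -
  have "linear ?L" by (rule linearI) (auto simp: std_symplectic_simps field_simps)
  then have "((\<lambda>h. g + ?L h) has_derivative ?L) (at x within S)" by (rule affine_has_derivative)
  moreover have "g + ?L h = g \<otimes>\<^bsub>Real_group \<times>\<times> (Heisenberg :: ((complex^'m) \<times> real) monoid)\<^esub> h" for h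
    by (cases g, cases h) (simp add: Real_Heisenberg_mult del: mult_DirProd)
  ultimately show ?thesis by simp
qed

lemma
  fixes G :: "(real \<times> (complex^'m) \<times> real) monoid"
  defines "G \<equiv> Real_group \<times>\<times> Heisenberg"
  shows Real_Heisenberg_carrier: "carrier G = UNIV" and Real_Heisenberg_one: "\<one>\<^bsub>G\<^esub> = 0"
    and lie_algebra_Real_Heisenberg: "lie_algebra G = UNIV"
    and lie_bracket_Real_Heisenberg: "lie_bracket G X Y = (0, 0, std_symplectic (fst (snd X)) (fst (snd Y)))"
    and translation_group_Real_Heisenberg: "translation_group G"
proof -
  show c: "carrier G = UNIV" "\<one>\<^bsub>G\<^esub> = 0" by (simp_all add: G_def Real_group_def Heisenberg_def zero_prod_def)
  show l: "lie_algebra G = UNIV" by (simp add: lie_algebra_def c tangent_space_UNIV)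
  have "((\<lambda>g. X + (0, 0, std_symplectic (fst (snd g)) (fst (snd X)) / 2)) has_derivative
      (\<lambda>h. (0, 0, std_symplectic (fst (snd h)) (fst (snd X)) / 2))) (at \<one>\<^bsub>G\<^esub> within carrier G)"
    for X :: "real \<times> (complex^'m) \<times> real"
    by (rule affine_has_derivative, rule linearI) (auto simp: std_symplectic_simps field_simps)
  moreover have LT: "((\<lambda>h. g \<otimes>\<^bsub>G\<^esub> h) has_derivative
      (\<lambda>X. X + (0, 0, std_symplectic (fst (snd g)) (fst (snd X)) / 2))) (at x within S)" for g x S
    unfolding G_def by (rule Real_Heisenberg_translation)
  ultimately have "lie_bracket G X Y = (0, 0, std_symplectic (fst (snd X)) (fst (snd Y)) / 2) -
      (0, 0, std_symplectic (fst (snd Y)) (fst (snd X)) / 2)"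
    by (intro lie_bracket_eq[where L = "\<lambda>g X. X + (0, 0, std_symplectic (fst (snd g)) (fst (snd X)) / 2)"])
       (auto simp: c l)
  then
  show "lie_bracket G X Y = (0, 0, std_symplectic (fst (snd X)) (fst (snd Y)))"
    using std_symplectic_flip[of "fst (snd Y)" "fst (snd X)"] by simp
  interpret group G unfolding G_def by (intro DirProd_group group_Real group_Heisenberg)
  show "translation_group G"
    by unfold_locales (unfold differentiable_def, rule exI, rule LT)
qed

text \<open>
  Integrability forces the complex structure to preserve the centre and the induced structure \<open>K\<close> on
  the quotient to preserve \<open>\<omega>\<close>. Adding \<open>- (\<i>/4) \<omega>(v, K v)\<close> to the central coordinate of a complex linear
  isomorphism \<open>T\<close> makes it equivariant under an action by complex affine maps.
\<close>

theorem biholomorphic_Real_Heisenberg: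
  assumes J: "left_invariant_complex_structure
      (Real_group \<times>\<times> (Heisenberg :: ((complex^'m) \<times> real) monoid)) J"
  shows "biholomorphic_to (Real_group \<times>\<times> (Heisenberg :: ((complex^'m) \<times> real) monoid)) J
      (UNIV :: (complex^('m option)) set)"
proof -
  define G where "G = Real_group \<times>\<times> (Heisenberg :: ((complex^'m) \<times> real) monoid)"
  note carrier = Real_Heisenberg_carrier[where 'm = 'm, folded G_def]
    and one = Real_Heisenberg_one[where 'm = 'm, folded G_def]
    and lie = lie_algebra_Real_Heisenberg[where 'm = 'm, folded G_def]
    and bracket = lie_bracket_Real_Heisenberg[where 'm = 'm, folded G_def]
  interpret translation_group G unfolding G_def by (rule translation_group_Real_Heisenberg)
  have lin: "linear J" and JJ: "\<And>X. J (J X) = - X"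
    and N: "\<And>X Y. lie_bracket G (J X) (J Y) - lie_bracket G X Y
        - J (lie_bracket G X (J Y)) - J (lie_bracket G (J X) Y) = 0"
    using J by (auto simp: left_invariant_complex_structure_def linear_map_on_def lie linear_iff simp flip: G_def)
  define \<pi> :: "real \<times> (complex^'m) \<times> real \<Rightarrow> complex^'m" where "\<pi> x = fst (snd x)" for x
  define z :: "real \<times> (complex^'m) \<times> real" where "z = (0, 0, 1)"
  have \<pi>_lin: "linear \<pi>" by (rule linearI) (simp_all add: \<pi>_def)
  have br: "lie_bracket G X Y = std_symplectic (\<pi> X) (\<pi> Y) *\<^sub>R z" for X Y
    by (simp add: bracket \<pi>_def z_def)
  have \<pi>z: "\<pi> z = 0" by (simp add: \<pi>_def z_def)
  have NJ: "(std_symplectic (\<pi> (J X)) (\<pi> (J Y)) - std_symplectic (\<pi> X) (\<pi> Y)) *\<^sub>R z =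
      (std_symplectic (\<pi> X) (\<pi> (J Y)) + std_symplectic (\<pi> (J X)) (\<pi> Y)) *\<^sub>R J z" for X Y
    using N[of X Y] by (simp add: br linear_scale[OF lin] algebra_simps)
  \<comment> \<open>A nontrivial relation between \<open>z\<close> and \<open>J z\<close> would give
    \<open>J\<close> a real eigenvalue. Both coefficients in \<open>NJ\<close> therefore vanish
    separately.\<close>
  have indep: "b = 0 \<and> a = 0" if "a *\<^sub>R z = b *\<^sub>R J z" for a b
  proof -
    have "a *\<^sub>R J z = - (b *\<^sub>R z)" using arg_cong[OF that, of J] by (simp add: linear_scale[OF lin] JJ)
    then have "a *\<^sub>R (a *\<^sub>R z) = - (b *\<^sub>R (b *\<^sub>R z))"
      using that by (metis scaleR_left_commute scaleR_minus_right)
    then have "a * a = - (b * b)" by (simp add: z_def)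
    then show ?thesis by (metis add_eq_0_iff add.inverse_inverse sum_squares_eq_zero_iff)
  qed
  \<comment> \<open>Brackets with the central \<open>z\<close> vanish, so \<open>NJ\<close> leaves
    \<omega>(\<pi>(J z), w) as the coefficient of \<open>J z\<close>. Testing with w = i \<pi>(J z)
    turns \<omega> into the inner product.\<close>
  have \<pi>Jz: "\<pi> (J z) = 0"
  proof -
    have "std_symplectic (\<pi> (J z)) w = 0" for w
      using indep[OF NJ[of z "(0, w, 0)"]] by (simp add: \<pi>z std_symplectic_simps) (simp add: \<pi>_def)
    from this[of "\<i> *s \<pi> (J z)"] have "\<pi> (J z) \<bullet> \<pi> (J z) = 0"
      by (simp add: std_symplectic_def inner_vec_def inner_complex_def algebra_simps)
    then show ?thesis by simp
  qed
  define \<alpha> where "\<alpha> = fst (J z)" define \<beta> where "\<beta> = snd (snd (J z))"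
  have Jz: "J z = (\<alpha>, 0, \<beta>)" using \<pi>Jz by (simp add: \<alpha>_def \<beta>_def \<pi>_def prod_eq_iff)
  have \<alpha>: "\<alpha> \<noteq> 0"
  proof
    assume "\<alpha> = 0"
    then have "\<beta> *\<^sub>R z = 1 *\<^sub>R J z" unfolding Jz by (simp add: z_def)
    from indep[OF this] show False by simp
  qed
  \<comment> \<open>The kernel of \<open>\<pi>\<close> is a complex line spanned by
    \<open>z\<close>; hence \<open>J\<close> descends to a map \<open>K\<close> on the
    quotient.\<close>
  have centre: "\<exists>a b. X = a *\<^sub>R z + b *\<^sub>R J z" if "\<pi> X = 0" for X
    using that \<alpha> unfolding Jz by (intro exI[of _ "snd (snd X) - fst X / \<alpha> * \<beta>"] exI[of _ "fst X / \<alpha>"])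
      (simp add: z_def \<pi>_def prod_eq_iff)
  define K where "K v = \<pi> (J (0, v, 0))" for v
  have K_lin: "linear K"
    by (rule linearI) (simp_all add: K_def flip: linear_add[OF lin] linear_add[OF \<pi>_lin] linear_scale[OF lin] linear_scale[OF \<pi>_lin])
  have \<pi>J: "\<pi> (J X) = K (\<pi> X)" for X
  proof -
    have "\<pi> (X - (0, \<pi> X, 0)) = 0" by (simp add: \<pi>_def)
    then obtain a b where "X - (0, \<pi> X, 0) = a *\<^sub>R z + b *\<^sub>R J z" using centre by blast
    then have "\<pi> (J (X - (0, \<pi> X, 0))) = 0"
      by (simp add: linear_add[OF lin] linear_scale[OF lin] linear_add[OF \<pi>_lin] linear_scale[OF \<pi>_lin]
          linear_diff[OF \<pi>_lin] linear_neg[OF \<pi>_lin] JJ \<pi>z \<pi>Jz)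
    then show ?thesis by (simp add: linear_diff[OF lin] linear_diff[OF \<pi>_lin] K_def)
  qed
  have KK: "K (K v) = - v" for v
    using \<pi>J[of "J (0, v, 0)"] by (simp add: JJ K_def) (simp add: \<pi>_def)
  \<comment> \<open>This is the coefficient of \<open>J z\<close> in \<open>NJ\<close>. It makes
    \<omega>(v, K w) symmetric, so that \<open>q\<close> below has this form as its
    polarisation.\<close>
  have \<omega>K: "std_symplectic v (K w) = - std_symplectic (K v) w" for v w
    using indep[OF NJ[of "(0, v, 0)" "(0, w, 0)"]] by (simp add: \<pi>J) (simp add: \<pi>_def)
  have \<omega>K_sym: "std_symplectic v (K w) = std_symplectic w (K v)" for v w
    using \<omega>K[of v w] std_symplectic_flip[of w "K v"] by simp
  have z0: "z \<noteq> 0" by (simp add: z_def zero_prod_def)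
  obtain T :: "real \<times> (complex^'m) \<times> real \<Rightarrow> complex^('m option)"
    where T: "linear T" "bij T" "\<And>X. T (J X) = \<i> *s T X" "T z = axis None 1"
    by (rule complex_structure_coordinates[OF lin JJ z0, of "None :: 'm option"]) auto
  define T' where "T' = inv_into UNIV T"
  have T': "T' (T X) = X" "T (T' y) = y" for X y
    using T(2) by (simp_all add: T'_def bij_is_inj bij_is_surj surj_f_inv_f)
  have T'_lin: "linear T'" by (rule linear_two_sided_inverse[OF T(1) T'])
  have T'i: "T' (\<i> *s y) = J (T' y)" for y using T'(1) T(3) T'(2) by metis
  have ax: "axis None c = Re c *\<^sub>R T z + Im c *\<^sub>R T (J z)" for c
    by (simp add: T(3,4) axis_def vec_eq_iff complex_eq_iff)
  have "T' (axis None c) = Re c *\<^sub>R z + Im c *\<^sub>R J z" for c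
    unfolding ax by (simp add: linear_add[OF T'_lin] linear_scale[OF T'_lin] T')
  then have \<pi>T': "\<pi> (T' (y + axis None c)) = \<pi> (T' y)" for y c
    by (simp add: linear_add[OF T'_lin] linear_add[OF \<pi>_lin] linear_scale[OF \<pi>_lin] \<pi>z \<pi>Jz)
  have axis_lin: "bounded_linear (axis None :: complex \<Rightarrow> complex^('m option))"
    by (intro linear_conv_bounded_linear[THEN iffD1] linearI) (auto simp: axis_def vec_eq_iff)
  have ax_add: "axis None (c + d) = axis None c + (axis None d :: complex^('m option))" for c d
    using linear_add[OF bounded_linear.linear[OF axis_lin]] .
  have ax_scale: "axis None (complex_of_real r * c) = r *\<^sub>R (axis None c :: complex^('m option))" for r c
    using linear_scale[OF bounded_linear.linear[OF axis_lin]] by (simp add: scaleR_conv_of_real)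
  \<comment> \<open>Expanding \<open>q\<close> at a sum contributes - i \<omega>(v, K w) / 2.
    Together with \<omega>(v, w) / 2 from the group law this is (\<omega>(v, w) - i \<omega>(v, K
    w)) / 2, and replacing \<open>w\<close> by \<open>K w\<close> multiplies it by i because K^2 =
    -1.\<close>
  define q :: "complex^'m \<Rightarrow> complex^('m option)" where "q v = axis None (- \<i> / 4 * of_real (std_symplectic v (K v)))" for v
  define F where "F X = T X + q (\<pi> X)" for X
  define F' where "F' y = T' (y - q (\<pi> (T' y)))" for y
  define \<Phi>' :: "_ \<Rightarrow> complex^('m option) \<Rightarrow> _" where "\<Phi>' g y = y + axis None ((of_real (std_symplectic (\<pi> g) (\<pi> (T' y)))
      - \<i> * of_real (std_symplectic (\<pi> g) (K (\<pi> (T' y))))) / 2)" for g y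
  have q_diff: "y - q v = y + axis None (\<i> / 4 * of_real (std_symplectic v (K v)))" for y v
    unfolding q_def by (auto simp: axis_def vec_eq_iff)
  have \<pi>F: "\<pi> (T' (F X)) = \<pi> X" for X by (simp add: F_def q_def \<pi>T' T')
  have "bounded_bilinear (std_symplectic :: complex^'m \<Rightarrow> _)"
    using bilinear_std_symplectic bilinear_conv_bounded_bilinear by blast
  note Cinf_sympl = Cinf_on_bilinear[OF this] and FDERIV_sympl = bounded_bilinear.FDERIV[OF this]
  have cq: "Cinf_on UNIV (\<lambda>x. q (f x))" if "Cinf_on UNIV f" for f :: "'b::euclidean_space \<Rightarrow> _"
    unfolding q_def
    by (rule Cinf_on_bounded_linear[OF axis_lin])
      (auto intro!: Cinf_intros Cinf_sympl Cinf_on_linear[OF K_lin] that)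
  have "biholomorphism_onto G J UNIV F"
  proof (rule biholomorphism_onto_equivariant)
    have F'F: "F' (F X) = X" for X
      unfolding F'_def \<pi>F by (simp add: F_def T')
    have FF': "F (F' y) = y" for y
    proof -
      have "\<pi> (F' y) = \<pi> (T' y)" unfolding F'_def q_diff \<pi>T' ..
      then show ?thesis by (simp add: F_def) (simp add: F'_def T')
    qed
    have "Cinf_on UNIV F"
      unfolding F_def by (intro Cinf_on_add cq Cinf_on_linear[OF T(1)] Cinf_on_linear[OF \<pi>_lin] Cinf_on_id open_UNIV)
    moreover have "Cinf_on UNIV F'"
      unfolding F'_def
      by (rule Cinf_on_linear[OF T'_lin open_UNIV], intro Cinf_on_diff cq open_UNIV Cinf_on_id)
        (intro Cinf_on_linear[OF \<pi>_lin] Cinf_on_linear[OF T'_lin] Cinf_on_id open_UNIV)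
    ultimately show "diffeomorphism_on (carrier G) UNIV F"
      by (intro diffeomorphism_onI[where g = F' and W = UNIV and V = UNIV])
         (auto simp: carrier F'F FF')
    show "F (g \<otimes>\<^bsub>G\<^esub> h) = F g + \<Phi>' g (F h)" for g h
    proof -
      let ?\<omega> = "std_symplectic (\<pi> g) (\<pi> h)" and ?S = "std_symplectic (\<pi> g) (K (\<pi> h))"
      have gh: "g \<otimes>\<^bsub>G\<^esub> h = g + h + (?\<omega> / 2) *\<^sub>R z"
        by (cases g, cases h) (simp add: G_def Real_Heisenberg_mult z_def \<pi>_def del: mult_DirProd)
      have \<pi>gh: "\<pi> (g \<otimes>\<^bsub>G\<^esub> h) = \<pi> g + \<pi> h"
        by (simp add: gh linear_add[OF \<pi>_lin] linear_scale[OF \<pi>_lin] \<pi>z)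
      have "T (g \<otimes>\<^bsub>G\<^esub> h) = T g + T h + axis None (of_real (?\<omega> / 2))"
        using ax_scale[of "?\<omega> / 2" 1] by (simp add: gh linear_add[OF T(1)] linear_scale[OF T(1)] T(4))
      moreover have "q (\<pi> (g \<otimes>\<^bsub>G\<^esub> h)) = q (\<pi> g) + q (\<pi> h) + axis None (- \<i> / 2 * of_real ?S)"
        unfolding q_def \<pi>gh ax_add[symmetric]
        by (simp add: linear_add[OF K_lin] std_symplectic_simps \<omega>K_sym[of "\<pi> h" "\<pi> g"] algebra_simps)
      moreover have "axis None ((of_real ?\<omega> - \<i> * of_real ?S) / 2) =
          axis None (of_real (?\<omega> / 2)) + (axis None (- \<i> / 2 * of_real ?S) :: complex^('m option))"
        unfolding ax_add[symmetric] by (simp add: diff_divide_distrib)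
      ultimately show ?thesis unfolding \<Phi>'_def \<pi>F by (simp add: F_def)
    qed
    show "((\<lambda>y. F g + \<Phi>' g y) has_derivative \<Phi>' g) (at (F \<one>\<^bsub>G\<^esub>))" for g
    proof (rule affine_has_derivative)
      show "linear (\<Phi>' g)"
        by (rule linearI)
           (simp_all add: \<Phi>'_def linear_add[OF T'_lin] linear_add[OF \<pi>_lin] linear_add[OF K_lin]
             linear_scale[OF T'_lin] linear_scale[OF \<pi>_lin] linear_scale[OF K_lin] std_symplectic_simps
             scaleR_add_right flip: ax_add ax_scale, simp_all add: algebra_simps add_divide_distrib diff_divide_distrib flip: ax_add)
    qed
    show "\<Phi>' g (\<i> *s y) = \<i> *s \<Phi>' g y" for g y
      unfolding \<Phi>'_def T'i \<pi>J KK
      by (auto simp: vec_eq_iff axis_def std_symplectic_simps distrib_left field_simps)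
    have "((\<lambda>X. q (\<pi> X)) has_derivative (\<lambda>_. 0)) (at 0)"
    proof -
      have "(\<pi> has_derivative \<pi>) (at 0)" "((\<lambda>X. K (\<pi> X)) has_derivative (\<lambda>X. K (\<pi> X))) (at 0)"
        using affine_has_derivative[OF \<pi>_lin, of 0] affine_has_derivative[OF linear_compose[OF \<pi>_lin K_lin], of 0]
        by (simp_all add: o_def)
      from FDERIV_sympl[OF this]
      have "((\<lambda>X. std_symplectic (\<pi> X) (K (\<pi> X))) has_derivative (\<lambda>_. 0)) (at 0)"
        by (simp add: linear_0[OF \<pi>_lin] linear_0[OF K_lin] std_symplectic_simps)
      from bounded_linear.has_derivative[OF bounded_linear_compose[OF axis_lin
          bounded_linear_compose[OF bounded_linear_mult_right[of "- \<i> / 4"] bounded_linear_of_real]] this]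
      show ?thesis by (simp add: q_def axis_def zero_vec_def)
    qed
    from has_derivative_add[OF bounded_linear_imp_has_derivative this, of T] T(1)
    show "(F has_derivative T) (at \<one>\<^bsub>G\<^esub> within carrier G)"
      by (simp add: F_def[abs_def] one carrier linear_conv_bounded_linear)
    show "J X \<in> lie_algebra G \<and> T (J X) = \<i> *s T X" for X
      by (simp add: lie T(3))
  qed simp
  then show ?thesis unfolding biholomorphic_to_def G_def by blast
qed

subsection \<open>Complex structures on the reductive algebras\<close>

text \<open>
  Both \<open>\<real> \<oplus> su(2)\<close> (\<open>\<kappa> = 1\<close>) and \<open>\<real> \<oplus> sl(2,\<real>) = \<real> \<oplus> su(1,1)\<close> (\<open>\<kappa> = -1\<close>) are given by the matrices
  with rows \<open>(\<i> p, w)\<close> and \<open>(- \<kappa> cnj w, - \<i> p)\<close>.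
\<close>

definition br3 :: "real \<Rightarrow> real \<times> complex \<Rightarrow> real \<times> complex \<Rightarrow> real \<times> complex" where
  "br3 \<kappa> = (\<lambda>(p, w) (p', w'). (- 2 * \<kappa> * Im (w * cnj w'), 2 * \<i> * (p * w' - p' * w)))"

definition det3 :: "real \<Rightarrow> real \<times> complex \<Rightarrow> real" where
  "det3 \<kappa> = (\<lambda>(p, w). p\<^sup>2 + \<kappa> * (cmod w)\<^sup>2)"

lemma linear_br3: "linear (br3 \<kappa> y)"
  by (rule linearI) (auto simp: br3_def split_beta complex_eq_iff algebra_simps)

text \<open>The eigenvalues of ad y are the differences of those of the traceless matrix
  \<open>y\<close>, namely 0 and plus or minus 2 sqrt(- det y). This is the Cayley-Hamilton relation
  for ad y.\<close>

lemma br3_cube: "br3 \<kappa> y (br3 \<kappa> y (br3 \<kappa> y x)) = (- 4 * det3 \<kappa> y) *\<^sub>R br3 \<kappa> y x"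
  unfolding br3_def det3_def split_beta cmod_power2
  by (simp add: prod_eq_iff complex_eq_iff power2_eq_square) (auto simp: algebra_simps)

text \<open>Pairing with \<open>(fst y, \<kappa> *\<^sub>R snd y)\<close> is, up to a factor,
  pairing with \<open>y\<close> under the Killing form, for which ad y is skew.\<close>

lemma br3_orthogonal: "(fst y, \<kappa> *\<^sub>R snd y) \<bullet> br3 \<kappa> y x = 0"
  by (simp add: br3_def split_beta inner_prod_def inner_complex_def algebra_simps)

text \<open>Excludes that ad y acts on its image by a real scalar. For a diagonal \<open>y\<close>
  it rotates the \<open>w\<close> plane by a quarter turn, up to scale; otherwise it moves
  \<open>br3 \<kappa> y (1, 0)\<close>, whose first coordinate is 0, to a vector whose first
  coordinate is not.\<close>

lemma br3_not_eigenvector: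
  assumes "y \<noteq> 0" and \<kappa>: "\<kappa> \<noteq> 0"
  obtains x where "\<And>a. br3 \<kappa> y (br3 \<kappa> y x) \<noteq> a *\<^sub>R br3 \<kappa> y x"
proof (cases "snd y = 0")
  case True
  then have "fst y \<noteq> 0" using assms by (simp add: prod_eq_iff)
  then show ?thesis using True
    by (intro that[of "(0, 1)"]) (auto simp: br3_def split_beta complex_eq_iff)
next
  case False
  then have "(Re (snd y))\<^sup>2 + (Im (snd y))\<^sup>2 \<noteq> 0" by (simp add: sum_power2_eq_zero_iff complex_eq_iff)
  moreover have "fst (br3 \<kappa> y (br3 \<kappa> y (1, 0))) = - 4 * \<kappa> * ((Re (snd y))\<^sup>2 + (Im (snd y))\<^sup>2)"
    "fst (br3 \<kappa> y (1, 0)) = 0"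
    by (simp_all add: br3_def split_beta power2_eq_square algebra_simps)
  ultimately have "fst (br3 \<kappa> y (br3 \<kappa> y (1, 0))) \<noteq> fst (a *\<^sub>R br3 \<kappa> y (1, 0))" for a
    using \<kappa> by simp
  then show ?thesis by (intro that[of "(1, 0)"]) metis
qed

lemma hyperplane3:
  fixes n u v m :: "real \<times> complex"
  assumes "n \<noteq> 0" "n \<bullet> u = 0" "n \<bullet> v = 0" "n \<bullet> m = 0"
    and ind: "\<And>a b. a *\<^sub>R u + b *\<^sub>R v = 0 \<Longrightarrow> a = 0 \<and> b = 0"
  obtains a b where "m = a *\<^sub>R u + b *\<^sub>R v"
proof -
  have ne: "u \<noteq> v" using ind[of 1 "-1"] by auto
  have "independent {u, v}"
  proof -
    have "v \<noteq> 0" using ind[of 0 1] by auto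
    moreover have "u \<notin> span {v}"
      using ind[of 1 "- k" for k] by (auto simp: span_singleton)
    ultimately show ?thesis by (simp add: independent_insert ne)
  qed
  then have "{x. n \<bullet> x = 0} \<subseteq> span {u, v}"
    by (intro card_ge_dim_independent) (use assms ne in \<open>auto simp: dim_hyperplane\<close>)
  then have "m \<in> span {u, v}" using assms by auto
  then show ?thesis using that by (auto simp: span_insert span_singleton algebra_simps eq_diff_eq)
qed

text \<open>
  Let \<open>E\<close> span the centre and \<open>J E = (\<alpha>, y)\<close>. Integrability says that \<open>A = ad (J E)\<close> commutes with \<open>J\<close>.
  Hence \<open>A\<close> is complex linear on its image, a complex line, and comparison with \<open>A\<^sup>3 = - 4 det(y) A\<close>
  shows that it is \<open>b J\<close> there with \<open>b\<^sup>2 = 4 det(y)\<close>. In particular \<open>y\<close> is elliptic. The vector \<open>v\<close>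
  is the eigenvector of \<open>\<rho> y\<close> for the eigenvalue \<open>- \<i> b / 2\<close>.
\<close>

lemma complex_structure_reductive_coordinates:
  fixes J :: "real \<times> real \<times> complex \<Rightarrow> real \<times> real \<times> complex" and \<rho> :: "real \<times> complex \<Rightarrow> complex^2^2"
  assumes lin: "linear J" and JJ: "\<And>X. J (J X) = - X" and \<kappa>: "\<kappa> \<noteq> 0"
    and N: "\<And>X Y. (0, br3 \<kappa> (snd (J X)) (snd (J Y))) - (0, br3 \<kappa> (snd X) (snd Y))
        - J (0, br3 \<kappa> (snd X) (snd (J Y))) - J (0, br3 \<kappa> (snd (J X)) (snd Y)) = 0"
    and \<rho>_lin: "linear \<rho>" and \<rho>_br: "\<And>x y. \<rho> (br3 \<kappa> x y) = \<rho> x ** \<rho> y - \<rho> y ** \<rho> x"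
    and \<rho>_tr: "\<And>x. \<rho> x $ 2 $ 2 = - \<rho> x $ 1 $ 1"
    and \<rho>_det: "\<And>x. \<rho> x $ 1 $ 1 * \<rho> x $ 1 $ 1 + \<rho> x $ 1 $ 2 * \<rho> x $ 2 $ 1 = - of_real (det3 \<kappa> x)"
  obtains v l y \<mu> where "v \<noteq> 0" "Re l \<noteq> 0"
    "\<And>X. (l * fst (J X)) *s v + \<rho> (snd (J X)) *v v = \<i> *s ((l * fst X) *s v + \<rho> (snd X) *v v)"
    "\<mu> \<noteq> 0" "\<rho> y *v v = (\<i> * of_real \<mu>) *s v"
proof -
  define E :: "real \<times> real \<times> complex" where "E = (1, 0, 0)"
  define \<alpha> where "\<alpha> = fst (J E)" define y where "y = snd (J E)"
  define A :: "real \<times> real \<times> complex \<Rightarrow> real \<times> real \<times> complex" where "A X = (0, br3 \<kappa> y (snd X))" for X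
  have br0: "br3 \<kappa> 0 x = 0" for x by (simp add: br3_def split_beta zero_prod_def)
  \<comment> \<open>Integrability with the central \<open>E\<close> in the first place: the two
    brackets containing \<open>E\<close> itself drop out.\<close>
  have AJ: "A (J X) = J (A X)" for X
  proof -
    have "J (0, 0) = 0" using linear_0[OF lin] by (simp add: zero_prod_def)
    moreover have "snd E = 0" by (simp add: E_def zero_prod_def)
    ultimately show ?thesis using N[of E X] unfolding A_def y_def by (simp add: br0)
  qed
  have A_lin: "linear A"
    by (rule linearI) (simp_all add: A_def linear_add[OF linear_br3] linear_scale[OF linear_br3])
  have y0: "y \<noteq> 0"
  proof
    assume "y = 0"
    then have JE: "J E = \<alpha> *\<^sub>R E" by (simp add: E_def \<alpha>_def y_def prod_eq_iff)
    then have "J (J E) = (\<alpha> * \<alpha>) *\<^sub>R E" by (simp add: linear_scale[OF lin])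
    then show False using JJ[of E] zero_le_square[of \<alpha>] by (auto simp: E_def)
  qed
  obtain x where "\<forall>a. br3 \<kappa> y (br3 \<kappa> y x) \<noteq> a *\<^sub>R br3 \<kappa> y x"
    using br3_not_eigenvector[OF y0 \<kappa>] by metis
  then have x: "br3 \<kappa> y (br3 \<kappa> y x) \<noteq> a *\<^sub>R br3 \<kappa> y x" for a by blast
  define u where "u = A (0, x)"
  have u: "u = (0, br3 \<kappa> y x)" by (simp add: u_def A_def)
  have Ju: "J u = (0, br3 \<kappa> y (snd (J (0, x))))" by (simp only: u_def AJ[symmetric]) (simp add: A_def)
  have ind: "a = 0 \<and> b = 0" if "a *\<^sub>R u + b *\<^sub>R J u = 0" for a b
  proof -
    have "J (a *\<^sub>R u + b *\<^sub>R J u) = 0" using that by (simp add: linear_0[OF lin])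
    then have "a *\<^sub>R J u - b *\<^sub>R u = 0" by (simp add: linear_add[OF lin] linear_scale[OF lin] JJ)
    then have "a *\<^sub>R (a *\<^sub>R u + b *\<^sub>R J u) - b *\<^sub>R (a *\<^sub>R J u - b *\<^sub>R u) = 0" using that by simp
    then have "(a * a + b * b) *\<^sub>R u = 0" by (simp add: algebra_simps)
    moreover have "u \<noteq> 0" using x[of 0] linear_0[OF linear_br3] by (metis Pair_inject u scaleR_zero_left zero_prod_def)
    ultimately show ?thesis by (auto simp: sum_squares_eq_zero_iff)
  qed
  let ?n = "(fst y, \<kappa> *\<^sub>R snd y)"
  have n0: "?n \<noteq> 0" using y0 \<kappa> by (auto simp: prod_eq_iff)
  have fu: "fst u = 0" "fst (J u) = 0" unfolding Ju by (simp_all add: u)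
  have nu: "?n \<bullet> snd u = 0" "?n \<bullet> snd (J u) = 0" unfolding Ju by (simp_all only: u snd_conv br3_orthogonal)
  have plane: "\<exists>a b. (0, m) = a *\<^sub>R u + b *\<^sub>R J u" if m: "?n \<bullet> m = 0" for m
  proof -
    have "a = 0 \<and> b = 0" if "a *\<^sub>R snd u + b *\<^sub>R snd (J u) = 0" for a b
      by (rule ind) (use that fu in \<open>simp add: prod_eq_iff\<close>)
    from hyperplane3[OF n0 nu m this] obtain a b where "m = a *\<^sub>R snd u + b *\<^sub>R snd (J u)"
      by metis
    then show ?thesis by (intro exI[of _ a] exI[of _ b]) (simp add: prod_eq_iff fu)
  qed
  \<comment> \<open>On the complex line spanned by \<open>u\<close> the map \<open>A\<close> is
    multiplication by a + i b, and \<open>br3_cube\<close> gives (a + i b)^2 = - 4 det y. So a b =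
    0; since \<open>u\<close> is no eigenvector, b is nonzero and a = 0.\<close>
  obtain a b where ab: "A u = a *\<^sub>R u + b *\<^sub>R J u"
    using plane[OF br3_orthogonal[of y \<kappa> "snd u"]] unfolding A_def by blast
  let ?d = "det3 \<kappa> y"
  have "A (A u) = (- 4 * ?d) *\<^sub>R u" using br3_cube[of \<kappa> y x] by (simp add: A_def u)
  moreover have "A (A u) = a *\<^sub>R A u + b *\<^sub>R J (A u)"
    using arg_cong[OF ab, of A] by (simp add: linear_add[OF A_lin] linear_scale[OF A_lin] AJ)
  then have "A (A u) = (a * a - b * b) *\<^sub>R u + (a * b + a * b) *\<^sub>R J u"
    by (simp only: ab linear_add[OF lin] linear_scale[OF lin] JJ scaleR_add_left scaleR_diff_left
        scaleR_add_right scaleR_minus_right scaleR_scaleR mult.commute[of b a])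
       (simp only: add.assoc add.commute add.left_commute diff_conv_add_uminus)
  ultimately have "(a * a - b * b + 4 * ?d) *\<^sub>R u + (a * b + a * b) *\<^sub>R J u = 0"
    by (simp add: algebra_simps)
  from ind[OF this] have q: "a * a - b * b + 4 * ?d = 0" "a * b + a * b = 0" by auto
  have "b \<noteq> 0" using ab x[of a] by (auto simp: A_def u)
  with q have a: "a = 0" and d: "?d = b * b / 4" by auto
  have Au: "A u = b *\<^sub>R J u" using ab a by simp
  let ?Y = "\<rho> y" let ?c = "\<i> * of_real b / 2"
  \<comment> \<open>Write \<open>Y\<close> for \<open>?Y\<close> and c for \<open>?c\<close>. By
    Cayley-Hamilton (Y + c)(Y - c) = 0, because c^2 = - det Y. So a nonzero column
    \<open>?v i\<close> of Y - c is an eigenvector for - c. The columns cannot both vanish: Y has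
    trace 0 and c is nonzero.\<close>
  obtain v where v: "v \<noteq> 0" "?Y *v v = (- ?c) *s v"
  proof -
    let ?v = "\<lambda>i. (\<chi> j. ?Y $ j $ i - (if i = j then ?c else 0))"
    have h: "?Y$1$1 * ?Y$1$1 + ?Y$1$2 * ?Y$2$1 = ?c * ?c"
      by (simp add: \<rho>_det d algebra_simps)
    have e: "?Y *v ?v 1 = (- ?c) *s ?v 1" "?Y *v ?v 2 = (- ?c) *s ?v 2"
      unfolding vec_eq_iff forall_2 matrix_vector_mult_def sum_2 vec_lambda_beta vector_smult_component \<rho>_tr
      using h by (simp_all, algebra+)
    have "?v 1 \<noteq> 0 \<or> ?v 2 \<noteq> 0"
    proof (rule ccontr)
      assume "\<not> ?thesis"
      then have "?Y$1$1 = ?c" "- ?Y$1$1 = ?c" by (auto simp: vec_eq_iff forall_2 \<rho>_tr)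
      then show False using \<open>b \<noteq> 0\<close> by (simp add: complex_eq_iff)
    qed
    then show ?thesis using that[OF _ e(1)] that[OF _ e(2)] by blast
  qed
  \<comment> \<open>The solution of l \<alpha> - c = i l, which says that \<open>\<Lambda>\<close>
    intertwines \<open>J\<close> with i on \<open>E\<close>.\<close>
  define l where "l = ?c / (of_real \<alpha> - \<i>)"
  define \<Lambda> where "\<Lambda> X = (l * fst X) *s v + \<rho> (snd X) *v v" for X :: "real \<times> real \<times> complex"
  have \<Lambda>_lin: "linear \<Lambda>"
    by (rule linearI) (simp_all add: \<Lambda>_def linear_add[OF \<rho>_lin] linear_scale[OF \<rho>_lin]
      matrix_vector_mult_add_rdistrib vec_eq_iff algebra_simps matrix_vector_mult_def sum_2 scaleR_conv_of_real[where 'a=complex])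
  define S where "S = {X. \<Lambda> (J X) = \<i> *s \<Lambda> X}"
  have S_sub: "subspace S"
    by (auto simp: S_def subspace_def linear_0[OF lin] linear_0[OF \<Lambda>_lin] linear_add[OF lin] linear_add[OF \<Lambda>_lin]
        linear_scale[OF lin] linear_scale[OF \<Lambda>_lin] vector_add_ldistrib) (simp add: vec_eq_iff)
  have S_J: "J X \<in> S" if "X \<in> S" for X
    using that by (simp add: S_def JJ linear_neg[OF \<Lambda>_lin])
  have nz: "of_real \<alpha> - \<i> \<noteq> 0" by (simp add: complex_eq_iff)
  have "E \<in> S"
  proof -
    have JE: "J E = (\<alpha>, y)" by (simp add: \<alpha>_def y_def)
    have "l * \<alpha> - ?c = \<i> * l" using nz by (simp add: l_def field_simps)
    moreover have "\<Lambda> (J E) = (l * \<alpha> - ?c) *s v" by (simp add: \<Lambda>_def JE v(2) vec_eq_iff algebra_simps)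
    moreover have "\<rho> (0, 0) = 0" using linear_0[OF \<rho>_lin] by (simp add: zero_prod_def)
    then have "\<Lambda> E = l *s v" by (simp add: \<Lambda>_def E_def)
    ultimately show ?thesis by (simp add: S_def)
  qed
  have "u \<in> S"
  proof -
    let ?U = "\<rho> (br3 \<kappa> y x)"
    \<comment> \<open>The anticommutator of Y with [Y, X] is [Y^2, X], and Y^2 is scalar. Hence
      [Y, U] v = - 2 U Y v = i b U v, to be compared with A u = b J u.\<close>
    have anti: "?Y ** ?U = - (?U ** ?Y)"
      unfolding \<rho>_br using \<rho>_tr[of y] \<rho>_tr[of x]
      by (simp add: vec_eq_iff forall_2 matrix_matrix_mult_def sum_2 algebra_simps)
    have "b *\<^sub>R \<Lambda> (J u) = \<Lambda> (A u)" by (simp add: Au linear_scale[OF \<Lambda>_lin])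
    also have "\<dots> = \<rho> (br3 \<kappa> y (br3 \<kappa> y x)) *v v" by (simp add: \<Lambda>_def A_def u)
    also have "\<dots> = (?Y ** ?U - ?U ** ?Y) *v v" by (simp only: \<rho>_br[of y "br3 \<kappa> y x"])
    also have "\<dots> = (-2) *s (?U *v (?Y *v v))"
      unfolding anti matrix_vector_mul_assoc by (simp add: matrix_vector_mult_def vec_eq_iff sum_2 algebra_simps)
    also have "\<dots> = b *\<^sub>R (\<i> *s \<Lambda> u)"
      unfolding v(2) by (simp add: \<Lambda>_def u matrix_vector_mult_def vec_eq_iff sum_2 scaleR_conv_of_real[where 'a=complex] algebra_simps)
    finally show ?thesis using \<open>b \<noteq> 0\<close> by (simp add: S_def)
  qed
  \<comment> \<open>Since \<open>?n \<bullet> y\<close> is the nonzero number det y, the vector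
    \<open>y\<close> is transversal to the plane orthogonal to \<open>?n\<close>. So
    \<open>E\<close>, \<open>J E\<close>, \<open>u\<close> and \<open>J u\<close> span the whole
    algebra, and all four lie in \<open>S\<close>.\<close>
  have "X \<in> S" for X
  proof -
    have nd: "?n \<bullet> y = ?d" 
      by (simp add: det3_def split_beta inner_prod_def power2_eq_square dot_square_norm)
    define t where "t = ?n \<bullet> snd X / ?d"
    have "?n \<bullet> (snd X - t *\<^sub>R y) = 0"
    proof -
      have "?d \<noteq> 0" using d \<open>b \<noteq> 0\<close> by auto
      then show ?thesis by (simp only: inner_diff_right inner_scaleR_right t_def nd) simp
    qed
    then obtain e f where ef: "(0, snd X - t *\<^sub>R y) = e *\<^sub>R u + f *\<^sub>R J u" using plane by blast
    have "X = (fst X - t * \<alpha>) *\<^sub>R E + t *\<^sub>R J E + (0, snd X - t *\<^sub>R y)"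
      by (simp add: E_def \<alpha>_def y_def prod_eq_iff)
    also have "\<dots> \<in> S" unfolding ef
      by (intro subspace_add[OF S_sub] subspace_scale[OF S_sub] \<open>E \<in> S\<close> \<open>u \<in> S\<close> S_J)
    finally show ?thesis .
  qed
  then have "(l * fst (J X)) *s v + \<rho> (snd (J X)) *v v = \<i> *s ((l * fst X) *s v + \<rho> (snd X) *v v)" for X
    by (simp add: S_def \<Lambda>_def)
  moreover have "Re l \<noteq> 0"
  proof -
    have "l = ?c * (of_real \<alpha> + \<i>) / ((of_real \<alpha> - \<i>) * (of_real \<alpha> + \<i>))"
      unfolding l_def using nz by (simp add: complex_eq_iff)
    also have "(of_real \<alpha> - \<i>) * (of_real \<alpha> + \<i>) = of_real (\<alpha> * \<alpha> + 1)"
      by (simp add: algebra_simps)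
    finally have "Re l = - b / 2 / (\<alpha> * \<alpha> + 1)" by (simp only: Re_divide_of_real) simp
    moreover have "\<alpha> * \<alpha> + 1 \<noteq> 0" using zero_le_square[of \<alpha>] by linarith
    ultimately show ?thesis using \<open>b \<noteq> 0\<close> by simp
  qed
  ultimately show ?thesis
    using v \<open>b \<noteq> 0\<close> by (intro that[of v l "- b / 2" y]) auto
qed

text \<open>Transports the coordinate computation along \<open>\<iota>\<close>; the injectivity of
  \<open>\<iota>\<close> lets the identities for \<open>J\<close> be read off for \<open>J'\<close>.
  The eigenvector relation for \<open>\<rho> y\<close> serves SL(2,R), where it keeps
  \<open>v\<close> away from real directions.\<close>

lemma complex_structure_reductive:
  fixes G :: "'a::euclidean_space monoid" and \<iota> :: "real \<times> real \<times> complex \<Rightarrow> 'a" and \<rho> :: "real \<times> complex \<Rightarrow> complex^2^2"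
  assumes J: "left_invariant_complex_structure G J" and \<kappa>: "\<kappa> \<noteq> 0"
    and \<iota>: "linear \<iota>" "inj \<iota>" and lie: "lie_algebra G = range \<iota>"
    and bracket: "\<And>X Y. lie_bracket G (\<iota> X) (\<iota> Y) = \<iota> (0, br3 \<kappa> (snd X) (snd Y))"
    and \<rho>: "linear \<rho>" "\<And>x y. \<rho> (br3 \<kappa> x y) = \<rho> x ** \<rho> y - \<rho> y ** \<rho> x"
      "\<And>x. \<rho> x $ 2 $ 2 = - \<rho> x $ 1 $ 1"
      "\<And>x. \<rho> x $ 1 $ 1 * \<rho> x $ 1 $ 1 + \<rho> x $ 1 $ 2 * \<rho> x $ 2 $ 1 = - of_real (det3 \<kappa> x)"
  obtains v l y \<mu> where "v \<noteq> 0" "Re l \<noteq> 0"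
    "\<And>X. \<exists>Y. J (\<iota> X) = \<iota> Y \<and> (l * fst Y) *s v + \<rho> (snd Y) *v v = \<i> *s ((l * fst X) *s v + \<rho> (snd X) *v v)"
    "\<mu> \<noteq> 0" "\<rho> y *v v = (\<i> * of_real \<mu>) *s v"
proof -
  define J' where "J' X = inv_into UNIV \<iota> (J (\<iota> X))" for X
  have JG: "J ` range \<iota> \<subseteq> range \<iota>" "\<And>X Y. J (\<iota> X + \<iota> Y) = J (\<iota> X) + J (\<iota> Y)"
      "\<And>c X. J (c *\<^sub>R \<iota> X) = c *\<^sub>R J (\<iota> X)" "\<And>X. J (J (\<iota> X)) = - \<iota> X"
      "\<And>X Y. lie_bracket G (J (\<iota> X)) (J (\<iota> Y)) - lie_bracket G (\<iota> X) (\<iota> Y)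
          - J (lie_bracket G (\<iota> X) (J (\<iota> Y))) - J (lie_bracket G (J (\<iota> X)) (\<iota> Y)) = 0"
    using J by (auto simp: left_invariant_complex_structure_def linear_map_on_def lie)
  have J': "J (\<iota> X) = \<iota> (J' X)" for X
  proof -
    have "J (\<iota> X) \<in> range \<iota>" using JG(1) by blast
    then show ?thesis by (simp add: J'_def f_inv_into_f)
  qed
  have eq: "X = Y" if "\<iota> X = \<iota> Y" for X Y using \<iota>(2) that by (simp add: inj_eq)
  note \<iota>_simps = linear_add[OF \<iota>(1)] linear_scale[OF \<iota>(1)] linear_neg[OF \<iota>(1)] linear_diff[OF \<iota>(1)]
  have "linear J'"
    by (rule linearI; rule eq) (use JG(2,3) in \<open>simp_all add: \<iota>_simps flip: J'\<close>)
  moreover have "J' (J' X) = - X" for X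
    by (rule eq) (simp add: \<iota>_simps JG(4) flip: J')
  moreover have "(0, br3 \<kappa> (snd (J' X)) (snd (J' Y))) - (0, br3 \<kappa> (snd X) (snd Y))
        - J' (0, br3 \<kappa> (snd X) (snd (J' Y))) - J' (0, br3 \<kappa> (snd (J' X)) (snd Y)) = 0" for X Y
    by (rule eq) (use JG(5)[of X Y] in \<open>simp only: \<iota>_simps J' bracket linear_0[OF \<iota>(1)]\<close>)
  ultimately obtain v l y \<mu> where "v \<noteq> 0" "Re l \<noteq> 0"
    "\<And>X. (l * fst (J' X)) *s v + \<rho> (snd (J' X)) *v v = \<i> *s ((l * fst X) *s v + \<rho> (snd X) *v v)"
    "\<mu> \<noteq> 0" "\<rho> y *v v = (\<i> * of_real \<mu>) *s v"
    using complex_structure_reductive_coordinates[OF _ _ \<kappa> _ \<rho>, of J'] by metis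
  then show ?thesis using J' that[of v l \<mu> y] by blast
qed

subsection \<open>Curves in groups of unimodular matrices\<close>

text \<open>The Cayley transform of \<open>t X / 2\<close>, rewritten by means of \<open>X ** X = - d\<close>.\<close>

definition cayley_curve :: "real \<Rightarrow> 'k::real_normed_field^2^2 \<Rightarrow> real \<Rightarrow> 'k^2^2" where
  "cayley_curve d X t = (1 / (1 + t\<^sup>2 * d / 4)) *\<^sub>R ((1 - t\<^sup>2 * d / 4) *\<^sub>R mat 1 + t *\<^sub>R X)"

text \<open>The bound on \<open>e\<close> makes both |t| and |t d| smaller than 1, hence also |t^2
  d|.\<close>

lemma cayley_denominator_pos:
  fixes t d :: real assumes "t \<in> {-e<..<e}" "e \<le> 1 / (1 + \<bar>d\<bar>)" shows "1 + t\<^sup>2 * d / 4 > 0"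
proof -
  have "\<bar>t\<bar> < 1 / (1 + \<bar>d\<bar>)" using assms by (auto simp: abs_if)
  then have t: "\<bar>t\<bar> * (1 + \<bar>d\<bar>) < 1" by (simp add: pos_less_divide_eq)
  have "\<bar>t\<bar> \<le> \<bar>t\<bar> * (1 + \<bar>d\<bar>)" by (simp add: distrib_left)
  then have "\<bar>t\<bar> < 1" using t by simp
  then have "\<bar>t\<bar> * (\<bar>t\<bar> * \<bar>d\<bar>) \<le> 1 * (\<bar>t\<bar> * \<bar>d\<bar>)" by (intro mult_right_mono) auto
  also have "\<dots> < 1" using t by (simp add: distrib_left)
  finally have "\<bar>t\<^sup>2 * d\<bar> < 1" by (simp add: abs_mult power2_eq_square mult.assoc)
  then show ?thesis by (simp add: abs_less_iff)
qed

lemma cayley_curve_0: "cayley_curve d X 0 = mat 1"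
  by (simp add: cayley_curve_def)

lemma cayley_curve_derivative:
  fixes X :: "'k::{real_normed_field,euclidean_space}^2^2"
  shows "(cayley_curve d X has_vector_derivative X) (at 0)"
  unfolding cayley_curve_def[abs_def]
  by (rule has_vector_derivative_eq_rhs, (rule derivative_intros | simp)+)

lemma cayley_curve_smooth:
  fixes X :: "'k::{real_normed_field,euclidean_space}^2^2"
  assumes "e \<le> 1 / (1 + \<bar>d\<bar>)" shows "Cinf_on {-e<..<e} (cayley_curve d X)"
proof -
  have "1 + t\<^sup>2 * d / 4 \<noteq> 0" if "t \<in> {-e<..<e}" for t
    using cayley_denominator_pos[OF that assms] by simp
  then show ?thesis unfolding cayley_curve_def[abs_def] by (intro Cinf_intros) auto
qed

text \<open>With q = t^2 d / 4 and det X = d, the matrix (1 - q) + t X has determinant (1 - q)^2 +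
  t^2 d = (1 - q)^2 + 4 q = (1 + q)^2, which the prefactor cancels.\<close>

lemma det_cayley_curve:
  fixes X :: "'k::{real_normed_field,euclidean_space}^2^2"
  assumes X: "X$2$2 = - X$1$1" "X$1$1 * X$1$1 + X$1$2 * X$2$1 = - of_real d" and t: "1 + t\<^sup>2 * d / 4 \<noteq> 0"
  shows "det (cayley_curve d X t) = 1"
proof -
  let ?q = "of_real (t\<^sup>2 * d / 4) :: 'k"
  let ?c = "1 / (1 + t\<^sup>2 * d / 4)" and ?M = "(1 - t\<^sup>2 * d / 4) *\<^sub>R mat 1 + t *\<^sub>R X"
  have "det ?M = (1 - ?q) * (1 - ?q) - of_real (t\<^sup>2) * (X$1$1 * X$1$1 + X$1$2 * X$2$1)"
    by (simp add: det_2 mat_def X(1) scaleR_conv_of_real[where 'a = 'k] algebra_simps power2_eq_square)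
  also have "\<dots> = (1 + ?q) * (1 + ?q)"
    unfolding X(2) by (simp add: algebra_simps)
  finally have M: "det ?M = (1 + ?q) * (1 + ?q)" .
  have "det (cayley_curve d X t) = (of_real ?c * of_real ?c) * det ?M"
    by (simp only: cayley_curve_def det_2 vector_scaleR_component scaleR_conv_of_real[where 'a = 'k])
      (simp only: algebra_simps)
  also have "\<dots> = of_real (?c * (1 + t\<^sup>2 * d / 4)) * of_real (?c * (1 + t\<^sup>2 * d / 4))"
    unfolding M by (simp only: of_real_mult of_real_add of_real_1 mult_ac)
  also have "?c * (1 + t\<^sup>2 * d / 4) = 1" using t by simp
  finally show ?thesis by simp
qed

lemma trace_tangent_det_1:
  fixes S :: "('k::{real_normed_field,euclidean_space}^2^2) set"
  assumes "X \<in> tangent_space S (mat 1)" "\<And>A. A \<in> S \<Longrightarrow> det A = 1"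
  shows "X$2$2 = - X$1$1"
proof -
  have nth: "((\<lambda>A::'k^2^2. A$i$j) has_derivative (\<lambda>H. H$i$j)) F" for i j F
    by (intro bounded_linear_imp_has_derivative bounded_linear_compose[OF bounded_linear_vec_nth bounded_linear_vec_nth])
  have "((\<lambda>A::'k^2^2. A$1$1 * A$2$2 - A$1$2 * A$2$1) has_derivative
      (\<lambda>H. ((mat 1 :: 'k^2^2) $ 1 $ 1 * H$2$2 + H$1$1 * (mat 1 :: 'k^2^2) $ 2 $ 2) -
          ((mat 1 :: 'k^2^2) $ 1 $ 2 * H$2$1 + H$1$2 * (mat 1 :: 'k^2^2) $ 2 $ 1))) (at (mat 1))"
    by (intro has_derivative_diff has_derivative_mult nth)
  then have "(det has_derivative (\<lambda>H::'k^2^2. H$1$1 + H$2$2)) (at (mat 1))"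
    by (simp add: det_2[abs_def] mat_def add.commute)
  from tangent_space_kernel[OF this assms(2,1)] show ?thesis
    by (simp add: eq_neg_iff_add_eq_0 add.commute)
qed

lemma bounded_bilinear_matrix_mult:
  "bounded_bilinear ((**) :: 'k::{real_normed_field,euclidean_space}^2^2 \<Rightarrow> 'k^2^2 \<Rightarrow> 'k^2^2)"
  unfolding bilinear_conv_bounded_bilinear[symmetric] bilinear_def
  by (auto intro!: linearI simp: matrix_matrix_mult_def vec_eq_iff sum_2 algebra_simps)

subsection \<open>The product of the line with SU(2)\<close>

lemma mult_cnj_cmod: "z * cnj z = of_real (cmod z * cmod z)"
  by (metis complex_norm_square power2_eq_square)

lemma SU2_carrier:
  "A \<in> carrier SU2 \<longleftrightarrow> A$2$2 = cnj (A$1$1) \<and> A$2$1 = - cnj (A$1$2) \<and> A$1$1 * cnj (A$1$1) + A$1$2 * cnj (A$1$2) = 1"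
proof -
  define a b c d where "a = A$1$1" and "b = A$1$2" and "c = A$2$1" and "d = A$2$2"
  have car: "A \<in> carrier SU2 \<longleftrightarrow> (a * cnj a + b * cnj b = 1 \<and> a * cnj c + b * cnj d = 0) \<and>
      (c * cnj a + d * cnj b = 0 \<and> c * cnj c + d * cnj d = 1) \<and> a * d - b * c = 1"
    by (simp add: SU2_def ctranspose_def vec_eq_iff forall_2 matrix_matrix_mult_def sum_2 mat_def det_2
        a_def b_def c_def d_def)
  have "d = cnj a \<and> c = - cnj b" if "a * cnj a + b * cnj b = 1" "c * cnj a + d * cnj b = 0" "a * d - b * c = 1"
    using that by (intro conjI) algebra+
  then show ?thesis unfolding car by (auto simp: a_def b_def c_def d_def algebra_simps)
qed

definition su2_matrix :: "real \<times> complex \<Rightarrow> complex^2^2" where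
  "su2_matrix = (\<lambda>(p, w). \<chi> i j. if i = 1 then (if j = 1 then \<i> * of_real p else w)
     else (if j = 1 then - cnj w else - \<i> * of_real p))"

lemma su2_matrix_nth [simp]:
  "su2_matrix x $ 1 $ 1 = \<i> * of_real (fst x)" "su2_matrix x $ 1 $ 2 = snd x"
  "su2_matrix x $ 2 $ 1 = - cnj (snd x)" "su2_matrix x $ 2 $ 2 = - \<i> * of_real (fst x)"
  by (simp_all add: su2_matrix_def split_beta)

lemma linear_su2_matrix: "linear su2_matrix"
  by (rule linearI) (auto simp: vec_eq_iff forall_2 scaleR_conv_of_real[where 'a = complex] algebra_simps)

text \<open>The upper bound comes from differentiating the determinant and the unitarity equation at
  the identity. For the lower bound the Cayley curve has a real denominator, so it keeps the
  quaternionic form of \<open>su2_matrix\<close> and stays in the group.\<close>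

lemma tangent_space_SU2: "tangent_space (carrier SU2) (mat 1) = range su2_matrix"
proof
  show "tangent_space (carrier SU2) (mat 1) \<subseteq> range su2_matrix"
  proof
    fix X assume X: "X \<in> tangent_space (carrier SU2) (mat 1)"
    have tr: "X$2$2 = - X$1$1" by (rule trace_tangent_det_1[OF X]) (simp add: SU2_def)
    have "linear (ctranspose :: complex^2^2 \<Rightarrow> _)"
      by (rule linearI) (auto simp: ctranspose_def vec_eq_iff)
    then have "((\<lambda>A. ctranspose A) has_derivative (\<lambda>A. ctranspose A)) (at (mat 1 :: complex^2^2))"
      using affine_has_derivative[of ctranspose 0] by simp
    from bounded_bilinear.FDERIV[OF bounded_bilinear_matrix_mult has_derivative_ident this]
    have "((\<lambda>A :: complex^2^2. A ** ctranspose A) has_derivative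
        (\<lambda>H. mat 1 ** ctranspose H + H ** ctranspose (mat 1))) (at (mat 1))" .
    from tangent_space_kernel[OF this _ X, of "mat 1"]
    have "mat 1 ** ctranspose X + X ** ctranspose (mat 1) = 0" by (simp add: SU2_def)
    then have "cnj (X$1$1) + X$1$1 = 0" "cnj (X$2$1) + X$1$2 = 0"
      by (simp_all add: ctranspose_def vec_eq_iff forall_2 matrix_matrix_mult_def sum_2 mat_def)
    then have "X = su2_matrix (Im (X$1$1), X$1$2)"
      using tr by (auto simp: vec_eq_iff forall_2 complex_eq_iff)
    then show "X \<in> range su2_matrix" by blast
  qed
  show "range su2_matrix \<subseteq> tangent_space (carrier SU2) (mat 1)"
  proof clarify
    fix p :: real and w :: complex
    let ?X = "su2_matrix (p, w)" and ?d = "p\<^sup>2 + (cmod w)\<^sup>2"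
    let ?e = "1 / (1 + \<bar>?d\<bar>)"
    have "cayley_curve ?d ?X t \<in> carrier SU2" if "t \<in> {-?e<..<?e}" for t
    proof -
      have t: "1 + t\<^sup>2 * ?d / 4 \<noteq> 0" using cayley_denominator_pos[OF that, of ?d] by simp
      have "det (cayley_curve ?d ?X t) = 1"
        by (rule det_cayley_curve[OF _ _ t]) (simp_all add: mult_cnj_cmod power2_eq_square, simp add: complex_eq_iff)
      moreover have "cayley_curve ?d ?X t $ 2 $ 2 = cnj (cayley_curve ?d ?X t $ 1 $ 1)"
        "cayley_curve ?d ?X t $ 2 $ 1 = - cnj (cayley_curve ?d ?X t $ 1 $ 2)"
        by (simp_all add: cayley_curve_def mat_def complex_eq_iff)
      ultimately show ?thesis unfolding SU2_carrier by (simp add: det_2)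
    qed
    then show "?X \<in> tangent_space (carrier SU2) (mat 1)"
      unfolding tangent_space_def
      by (intro CollectI exI[of _ "cayley_curve ?d ?X"] exI[of _ ?e])
         (auto simp: cayley_curve_0 cayley_curve_derivative intro!: cayley_curve_smooth add_pos_nonneg)
  qed
qed

lemma tangent_space_line_product:
  fixes S :: "'a::euclidean_space set"
  shows "tangent_space (UNIV \<times> S) (a :: real, x) = UNIV \<times> tangent_space S x"
proof (rule equalityI; rule subsetI)
  fix V :: "real \<times> 'a" assume "V \<in> tangent_space (UNIV \<times> S) (a, x)"
  then obtain \<gamma> e where g: "(0::real) < e" "\<gamma> ` {-e<..<e} \<subseteq> UNIV \<times> S" "Cinf_on {-e<..<e} \<gamma>"
      "\<gamma> 0 = (a, x)" "(\<gamma> has_vector_derivative V) (at 0)"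
    unfolding tangent_space_def by blast
  have "Cinf_on {-e<..<e} (\<lambda>t. snd (\<gamma> t))" by (intro Cinf_intros g(3)) simp
  moreover have "((\<lambda>t. snd (\<gamma> t)) has_vector_derivative snd V) (at 0)"
    by (rule bounded_linear.has_vector_derivative[OF bounded_linear_snd g(5)])
  ultimately have "snd V \<in> tangent_space S x"
    unfolding tangent_space_def using g(1,2,4)
    by (intro CollectI exI[of _ "\<lambda>t. snd (\<gamma> t)"] exI[of _ e]) auto
  then show "V \<in> UNIV \<times> tangent_space S x" by (simp add: mem_Times_iff)
next
  fix V :: "real \<times> 'a" assume "V \<in> UNIV \<times> tangent_space S x"
  then obtain c :: real and v where V: "V = (c, v)" "v \<in> tangent_space S x" by auto
  then obtain \<gamma> e where g: "(0::real) < e" "\<gamma> ` {-e<..<e} \<subseteq> S" "Cinf_on {-e<..<e} \<gamma>"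
      "\<gamma> 0 = x" "(\<gamma> has_vector_derivative v) (at 0)"
    unfolding tangent_space_def by blast
  have "Cinf_on {-e<..<e} (\<lambda>t. (a + t * c, \<gamma> t))" by (intro Cinf_intros g(3)) simp_all
  moreover have "((\<lambda>t. (a + t * c, \<gamma> t)) has_vector_derivative (c, v)) (at 0)"
    by (intro has_vector_derivative_Pair g(5)) (auto intro!: derivative_eq_intros)
  ultimately show "V \<in> tangent_space (UNIV \<times> S) (a, x)"
    unfolding tangent_space_def V(1) using g(1,2,4)
    by (intro CollectI exI[of _ "\<lambda>t. (a + t * c, \<gamma> t)"] exI[of _ e]) auto
qed

lemma linear_matrix_mult_left: "linear (\<lambda>B. A ** B)" and linear_matrix_mult_right: "linear (\<lambda>B. B ** A)"
  for A :: "'k::{real_normed_field,euclidean_space}^2^2"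
  by (auto intro!: linearI simp: matrix_matrix_mult_def vec_eq_iff sum_2 algebra_simps)

lemma Real_SU2_translation:
  "((\<lambda>h. g \<otimes>\<^bsub>Real_group \<times>\<times> SU2\<^esub> h) has_derivative (\<lambda>X. (fst X, snd g ** snd X))) (at x within S)"
proof -
  have "linear (\<lambda>X::real \<times> (complex^2^2). (fst X, snd g ** snd X))"
    by (rule linearI) (auto simp: linear_add[OF linear_matrix_mult_left] linear_scale[OF linear_matrix_mult_left])
  then have "((\<lambda>h. (fst g, 0) + (fst h, snd g ** snd h)) has_derivative (\<lambda>X. (fst X, snd g ** snd X))) (at x within S)"
    by (rule affine_has_derivative)
  then show ?thesis by (simp add: mult_DirProd' Real_group_def SU2_def)
qed

lemma
  fixes G :: "(real \<times> (complex^2^2)) monoid"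
  defines "G \<equiv> Real_group \<times>\<times> SU2"
  shows lie_algebra_Real_SU2: "lie_algebra G = range (\<lambda>X. (fst X, su2_matrix (snd X)))"
    and lie_bracket_Real_SU2: "lie_bracket G (s, su2_matrix x) (t, su2_matrix y) =
      (0, su2_matrix x ** su2_matrix y - su2_matrix y ** su2_matrix x)"
    and translation_group_Real_SU2: "translation_group G"
proof -
  have c: "carrier G = UNIV \<times> carrier SU2" "\<one>\<^bsub>G\<^esub> = (0, mat 1)" by (simp_all add: G_def Real_group_def SU2_def)
  have LT: "((\<lambda>h. g \<otimes>\<^bsub>G\<^esub> h) has_derivative (\<lambda>X. (fst X, snd g ** snd X))) (at x within S)" for g x S
    unfolding G_def by (rule Real_SU2_translation)
  show l: "lie_algebra G = range (\<lambda>X. (fst X, su2_matrix (snd X)))"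
    unfolding lie_algebra_def c tangent_space_line_product tangent_space_SU2
    by (auto simp: image_iff) blast
  have "((\<lambda>g. (fst X, 0) + (0, snd g ** snd X)) has_derivative (\<lambda>h. (0, snd h ** snd X))) (at x within S)"
    for S and x X :: "real \<times> (complex^2^2)"
    by (rule affine_has_derivative, rule linearI)
       (auto simp: linear_add[OF linear_matrix_mult_right] linear_scale[OF linear_matrix_mult_right])
  then have E: "((\<lambda>g. (fst X, snd g ** snd X)) has_derivative (\<lambda>h. (0, snd h ** snd X))) (at x within S)"
    for S and x X :: "real \<times> (complex^2^2)" by simp
  have m: "(r, su2_matrix z) \<in> lie_algebra G" for r z
    unfolding l by (rule range_eqI[of _ _ "(r, z)"]) simp
  interpret group G unfolding G_def by (intro DirProd_group group_Real group_SU2)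
  show "lie_bracket G (s, su2_matrix x) (t, su2_matrix y) =
      (0, su2_matrix x ** su2_matrix y - su2_matrix y ** su2_matrix x)"
    by (subst lie_bracket_eq[OF one_closed LT E m m]) simp
  show "translation_group G"
    by unfold_locales (unfold differentiable_def, rule exI, rule LT)
qed

lemma su2_matrix_br3: "su2_matrix (br3 1 x y) = su2_matrix x ** su2_matrix y - su2_matrix y ** su2_matrix x"
  by (simp add: vec_eq_iff forall_2 matrix_matrix_mult_def sum_2)
     (auto simp: br3_def split_beta complex_eq_iff algebra_simps)

text \<open>Bijectivity: |F(s, A)|^2 = exp(2 Re l s) |v|^2 determines \<open>s\<close>, and SU(2)
  acts simply transitively on the sphere of radius |v|.\<close>

theorem biholomorphic_Real_SU2:
  assumes J: "left_invariant_complex_structure (Real_group \<times>\<times> SU2) J"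
  shows "biholomorphic_to (Real_group \<times>\<times> SU2) J (- {0 :: complex^2})"
proof -
  define G where "G = Real_group \<times>\<times> SU2"
  interpret translation_group G unfolding G_def by (rule translation_group_Real_SU2)
  have carrier: "carrier G = UNIV \<times> carrier SU2" and one: "\<one>\<^bsub>G\<^esub> = (0, mat 1)"
    by (simp_all add: G_def Real_group_def SU2_def)
  let ?\<iota> = "\<lambda>X. (fst X, su2_matrix (snd X))"
  note lie = lie_algebra_Real_SU2[folded G_def]
  obtain v l where v: "v \<noteq> 0" and l: "Re l \<noteq> 0"
    and hol: "\<And>X. \<exists>Y. J (?\<iota> X) = ?\<iota> Y \<and> (l * fst Y) *s v + su2_matrix (snd Y) *v v =
        \<i> *s ((l * fst X) *s v + su2_matrix (snd X) *v v)"
  proof (rule complex_structure_reductive[OF J, of 1 ?\<iota> su2_matrix])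
    show "linear ?\<iota>"
      by (rule linearI) (auto simp: linear_add[OF linear_su2_matrix] linear_scale[OF linear_su2_matrix])
    show "inj ?\<iota>" by (rule injI) (auto simp: vec_eq_iff forall_2 complex_eq_iff prod_eq_iff)
    show "lie_bracket (Real_group \<times>\<times> SU2) (?\<iota> X) (?\<iota> Y) = ?\<iota> (0, br3 1 (snd X) (snd Y))" for X Y
      by (simp add: lie_bracket_Real_SU2 su2_matrix_br3)
    show "su2_matrix x $ 1 $ 1 * su2_matrix x $ 1 $ 1 + su2_matrix x $ 1 $ 2 * su2_matrix x $ 2 $ 1 =
        - of_real (det3 1 x)" for x
      by (simp add: det3_def split_beta mult_cnj_cmod power2_eq_square) (simp add: complex_eq_iff)
  qed (use lie linear_su2_matrix su2_matrix_br3 in \<open>auto simp: G_def\<close>)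
  define n where "n = v \<bullet> v"
  have n: "n > 0" using v by (simp add: n_def)
  have n_eq: "of_real n = v$1 * cnj (v$1) + v$2 * cnj (v$2)"
    by (simp add: n_def inner_vec_def sum_2 inner_complex_def complex_eq_iff)
  define F :: "real \<times> (complex^2^2) \<Rightarrow> complex^2" where "F g = exp (l * of_real (fst g)) *s (snd g *v v)" for g
  define k :: complex where "k = 1 / of_real n"
  have k: "k * (v$1 * cnj (v$1) + v$2 * cnj (v$2)) = 1" "cnj k = k" "k * of_real n = 1"
    using n by (simp_all add: k_def flip: n_eq)
  \<comment> \<open>The only matrix with rows (a, b) and (- cnj b, cnj a) that takes
    \<open>v\<close> to \<open>u\<close>, found by solving for a and b. It has determinant 1 exactly
    when |u| = |v|.\<close>
  define M :: "complex^2 \<Rightarrow> complex^2^2" where "M u = (\<chi> i j. k *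
      (if i = 1 then (if j = 1 then u$1 * cnj (v$1) + cnj (u$2) * v$2 else u$1 * cnj (v$2) - cnj (u$2) * v$1)
       else (if j = 1 then u$2 * cnj (v$1) - cnj (u$1) * v$2 else u$2 * cnj (v$2) + cnj (u$1) * v$1)))" for u
  \<comment> \<open>Obtained by solving |w|^2 = exp(2 Re l t) n for \<open>t\<close>.\<close>
  define t where "t w = ln (w \<bullet> w / n) / (2 * Re l)" for w :: "complex^2"
  define F' where "F' w = (t w, M (exp (- l * of_real (t w)) *s w))" for w
  have Mv: "M u *v v = u" for u
    unfolding vec_eq_iff forall_2 matrix_vector_mult_def sum_2 M_def vec_lambda_beta
    using k(1) by (simp, intro conjI; algebra)
  have M_unique: "M (A *v v) = A" if "A \<in> carrier SU2" for A
  proof -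
    have A: "A$2$2 = cnj (A$1$1)" "A$2$1 = - cnj (A$1$2)" using that unfolding SU2_carrier by auto
    show ?thesis
      unfolding vec_eq_iff forall_2 matrix_vector_mult_def sum_2 M_def vec_lambda_beta A
      using k(1) by (simp, intro conjI; algebra)
  qed
  have M_SU2: "M u \<in> carrier SU2" if u: "u \<bullet> u = n" for u
  proof -
    have "of_real n = u$1 * cnj (u$1) + u$2 * cnj (u$2)"
      unfolding u[symmetric] by (simp add: inner_vec_def sum_2 inner_complex_def complex_eq_iff)
    then have "(u$1 * cnj (v$1) + cnj (u$2) * v$2) * (cnj (u$1) * v$1 + u$2 * cnj (v$2)) +
        (u$1 * cnj (v$2) - cnj (u$2) * v$1) * (cnj (u$1) * v$2 - u$2 * cnj (v$1)) = of_real n * of_real n"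
      using n_eq by algebra
    then have "k * (u$1 * cnj (v$1) + cnj (u$2) * v$2) * (k * (cnj (u$1) * v$1 + u$2 * cnj (v$2))) +
        k * (u$1 * cnj (v$2) - cnj (u$2) * v$1) * (k * (cnj (u$1) * v$2 - u$2 * cnj (v$1))) = 1"
      using k(3) by algebra
    then show ?thesis
      unfolding SU2_carrier by (simp add: M_def k(2) algebra_simps)
  qed
  have norm: "(c *s u) \<bullet> (c *s u) = (cmod c)\<^sup>2 * (u \<bullet> u)" for c and u :: "complex^2"
    unfolding cmod_power2 by (simp add: inner_vec_def sum_2 inner_complex_def power2_eq_square algebra_simps)
  have norm_SU2: "(A *v v) \<bullet> (A *v v) = n" if "A \<in> carrier SU2" for A
  proof -
    have "of_real ((A *v v) \<bullet> (A *v v)) = (A *v v)$1 * cnj ((A *v v)$1) + (A *v v)$2 * cnj ((A *v v)$2)"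
      by (simp add: inner_vec_def sum_2 inner_complex_def complex_eq_iff)
    also have "\<dots> = (A$1$1 * cnj (A$1$1) + A$1$2 * cnj (A$1$2)) * (v$1 * cnj (v$1) + v$2 * cnj (v$2))"
    proof -
      have "A$2$2 = cnj (A$1$1)" "A$2$1 = - cnj (A$1$2)" using that unfolding SU2_carrier by auto
      then show ?thesis by (simp add: matrix_vector_mult_def sum_2 algebra_simps)
    qed
    also have "\<dots> = of_real n" using that n_eq unfolding SU2_carrier by simp
    finally show ?thesis by (simp only: of_real_eq_iff)
  qed
  have exp_norm: "(cmod (exp (l * of_real s)))\<^sup>2 = exp (2 * Re l * s)" for s
    by (simp add: power2_eq_square flip: exp_add)
  have t_F: "t (F g) = fst g" if "snd g \<in> carrier SU2" for g
  proof -
    have "F g \<bullet> F g / n = exp (2 * Re l * fst g)"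
      unfolding F_def norm norm_SU2[OF that] exp_norm using n by simp
    then show ?thesis using l by (simp add: t_def)
  qed
  have exp_inv: "exp (- l * of_real s) * exp (l * of_real s) = 1" for s
    by (simp flip: exp_add)
  have F'F: "F' (F g) = g" if "g \<in> carrier G" for g
  proof -
    have g: "snd g \<in> carrier SU2" using that by (auto simp: carrier)
    have "exp (- l * of_real (fst g)) *s F g = snd g *v v"
      using exp_inv[of "fst g"] by (simp add: F_def flip: mult.assoc)
    then show ?thesis by (simp add: F'_def t_F[OF g] M_unique[OF g] prod_eq_iff)
  qed
  have FF': "F (F' w) = w" for w
    using exp_inv[of "t w"] by (simp add: F_def F'_def Mv mult.commute)
  have "biholomorphism_onto G J (- {0}) F"
  proof (rule biholomorphism_onto_equivariant)
    show "diffeomorphism_on (carrier G) (- {0}) F"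
    proof (rule diffeomorphism_onI[where g = F' and W = UNIV and V = "- {0}"])
      show "F ` carrier G \<subseteq> - {0}"
      proof clarsimp
        fix s A assume g: "(s, A) \<in> carrier G" and "F (s, A) = 0"
        then have "A *v v = 0" by (simp add: F_def)
        moreover have "(A *v v) \<bullet> (A *v v) = n" using g by (auto simp: carrier intro: norm_SU2)
        ultimately show False using n by simp
      qed
      show "F' ` (- {0}) \<subseteq> carrier G"
      proof (rule image_subsetI)
        fix w :: "complex^2" assume "w \<in> - {0}"
        then have w: "w \<noteq> 0" by simp
        have "(exp (- l * of_real (t w)) *s w) \<bullet> (exp (- l * of_real (t w)) *s w) = exp (- (2 * Re l * t w)) * (w \<bullet> w)"
          using exp_norm[of "- t w"] by (simp add: norm)
        also have "2 * Re l * t w = ln (w \<bullet> w / n)" using l by (simp add: t_def)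
        also have "exp (- ln (w \<bullet> w / n)) * (w \<bullet> w) = n" using w n by (simp add: exp_minus)
        finally show "F' w \<in> carrier G" by (simp add: F'_def carrier M_SU2)
      qed
      show "Cinf_on UNIV F"
        unfolding F_def matrix_vector_mult_def vector_scalar_mult_def by (intro Cinf_intros) auto
      have U: "open (- {0 :: complex^2})" by (simp add: open_Compl)
      then show "open (- {0 :: complex^2})" .
      have t: "Cinf_on (- {0}) t"
        unfolding t_def
      proof (rule Cinf_on_divide[OF U Cinf_on_ln[OF U Cinf_on_divide[OF U _ Cinf_on_const]] Cinf_on_const])
        show "Cinf_on (- {0}) (\<lambda>w :: complex^2. w \<bullet> w)"
          by (rule Cinf_on_bilinear[OF bounded_bilinear_inner U Cinf_on_id[OF U] Cinf_on_id[OF U]])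
      qed (use n l in auto)
      have cM: "Cinf_on UNIV M"
        unfolding M_def by (intro Cinf_intros) auto
      have cu: "Cinf_on (- {0}) (\<lambda>w. exp (- l * of_real (t w)) *s w)"
        unfolding vector_scalar_mult_def
        by (rule Cinf_on_vec[OF U]) (rule Cinf_on_mult[OF U], (rule Cinf_on_exp Cinf_on_mult
          Cinf_on_bounded_linear[OF bounded_linear_vec_nth] Cinf_on_const Cinf_on_id
          Cinf_on_bounded_linear[OF bounded_linear_of_real] U t)+)
      have "Cinf_on (- {0}) (\<lambda>w. M (exp (- l * of_real (t w)) *s w))"
        by (rule Cinf_on_compose[OF cM open_UNIV U cu]) simp
      then show "Cinf_on (- {0}) F'"
        unfolding F'_def by (rule Cinf_on_Pair[OF U t])
    qed (use F'F FF' in auto)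
    show "F (g \<otimes>\<^bsub>G\<^esub> h) = exp (l * of_real (fst g)) *s (snd g *v F h)" for g h
      by (simp add: F_def G_def mult_DirProd' Real_group_def SU2_def distrib_left exp_add
          matrix_vector_mul_assoc[symmetric] vector_scalar_commute mult.commute)
    have lin: "linear (\<lambda>y. c *s (A *v y))" for c and A :: "complex^2^2"
      by (rule linearI) (auto simp: matrix_vector_right_distrib vector_add_ldistrib vec_eq_iff matrix_vector_mult_def
          sum_2 scaleR_conv_of_real[where 'a = complex] algebra_simps)
    show "((\<lambda>y. exp (l * of_real (fst g)) *s (snd g *v y)) has_derivative
        (\<lambda>y. exp (l * of_real (fst g)) *s (snd g *v y))) (at (F \<one>\<^bsub>G\<^esub>))" for g :: "real \<times> (complex^2^2)"
      by (rule linear_has_derivative[OF lin])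
    show "exp (l * of_real (fst g)) *s (snd g *v (\<i> *s y)) = \<i> *s (exp (l * of_real (fst g)) *s (snd g *v y))" for g :: "real \<times> (complex^2^2)" and y
      by (simp add: vector_scalar_commute mult.commute)
    show "(F has_derivative (\<lambda>X. (l * of_real (fst X)) *s v + snd X *v v)) (at \<one>\<^bsub>G\<^esub> within carrier G)"
    proof (rule has_derivative_at_withinI)
      have bl: "bounded_linear (\<lambda>X :: real \<times> (complex^2^2). l * of_real (fst X))"
        by (intro bounded_linear_compose[OF bounded_linear_mult_right] bounded_linear_compose[OF bounded_linear_of_real] bounded_linear_fst)
      have "((\<lambda>X :: real \<times> (complex^2^2). exp (l * of_real (fst X))) has_derivative (\<lambda>X. exp (l * of_real (fst (0::real, mat 1::complex^2^2))) * (l * of_real (fst X)))) (at (0, mat 1))"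
        by (rule has_derivative_compose[OF bounded_linear_imp_has_derivative[OF bl] DERIV_exp[unfolded has_field_derivative_def]])
      then have e: "((\<lambda>X :: real \<times> (complex^2^2). exp (l * of_real (fst X))) has_derivative (\<lambda>X. l * of_real (fst X))) (at (0, mat 1))" by simp
      have "linear (\<lambda>X :: real \<times> (complex^2^2). snd X *v v)"
        by (rule linearI) (auto simp: vec_eq_iff matrix_vector_mult_def sum_2 scaleR_conv_of_real[where 'a = complex] algebra_simps)
      note m = linear_has_derivative[OF this, of "(0, mat 1)" UNIV]
      have "bilinear ((*s) :: complex \<Rightarrow> complex^2 \<Rightarrow> _)"
        unfolding bilinear_def by (auto intro!: linearI simp: vec_eq_iff scaleR_conv_of_real[where 'a = complex] algebra_simps)
      then have "bounded_bilinear ((*s) :: complex \<Rightarrow> complex^2 \<Rightarrow> _)" by (simp add: bilinear_conv_bounded_bilinear)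
      from bounded_bilinear.FDERIV[OF this e m]
      show "(F has_derivative (\<lambda>X. (l * of_real (fst X)) *s v + snd X *v v)) (at \<one>\<^bsub>G\<^esub>)"
        by (simp add: F_def[abs_def] one add.commute)
    qed
    show "J X \<in> lie_algebra G \<and> (l * of_real (fst (J X))) *s v + snd (J X) *v v =
        \<i> *s ((l * of_real (fst X)) *s v + snd X *v v)" if X: "X \<in> lie_algebra G" for X
    proof -
      obtain Z where Z: "X = ?\<iota> Z" using X unfolding lie by blast
      obtain Y where Y: "J (?\<iota> Z) = ?\<iota> Y" and e: "(l * fst Y) *s v + su2_matrix (snd Y) *v v =
        \<i> *s ((l * fst Z) *s v + su2_matrix (snd Z) *v v)"
        using hol by blast
      show ?thesis unfolding lie Z Y using e by auto
    qed
  qed (simp add: open_Compl)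
  then show ?thesis unfolding biholomorphic_to_def G_def by blast
qed

subsection \<open>The product of the line with the universal cover of SL(2,R)\<close>

lemma tangent_space_linear_image:
  assumes h: "bounded_linear h" and v: "v \<in> tangent_space S x" and T: "h ` S \<subseteq> T"
  shows "h v \<in> tangent_space T (h x)"
proof -
  obtain \<gamma> e where g: "(0::real) < e" "\<gamma> ` {-e<..<e} \<subseteq> S" "Cinf_on {-e<..<e} \<gamma>"
      "\<gamma> 0 = x" "(\<gamma> has_vector_derivative v) (at 0)"
    using v unfolding tangent_space_def by blast
  have "Cinf_on {-e<..<e} (\<lambda>t. h (\<gamma> t))" by (rule Cinf_on_bounded_linear[OF h _ g(3)]) simp
  then show ?thesis
    unfolding tangent_space_def using g T bounded_linear.has_vector_derivative[OF h g(5)]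
    by (intro CollectI exI[of _ "\<lambda>t. h (\<gamma> t)"] exI[of _ e]) auto
qed

text \<open>An isomorphism from the su(1,1) coordinates onto the real traceless matrices:
  \<open>p\<close> is the coefficient of the rotation generator, and the determinant is p^2 - |w|^2,
  which is \<open>det3 (-1)\<close>.\<close>

definition sl2_matrix :: "real \<times> complex \<Rightarrow> real^2^2" where
  "sl2_matrix = (\<lambda>(p, w). \<chi> i j. if i = 1 then (if j = 1 then Re w else p - Im w)
     else (if j = 1 then - p - Im w else - Re w))"

lemma sl2_matrix_nth [simp]:
  "sl2_matrix x $ 1 $ 1 = Re (snd x)" "sl2_matrix x $ 1 $ 2 = fst x - Im (snd x)"
  "sl2_matrix x $ 2 $ 1 = - fst x - Im (snd x)" "sl2_matrix x $ 2 $ 2 = - Re (snd x)"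
  by (simp_all add: sl2_matrix_def split_beta)

lemma linear_sl2_matrix: "linear sl2_matrix"
  by (rule linearI) (auto simp: vec_eq_iff forall_2 algebra_simps)

lemma sl2_matrix_br3: "sl2_matrix (br3 (-1) x y) = sl2_matrix x ** sl2_matrix y - sl2_matrix y ** sl2_matrix x"
  by (simp add: vec_eq_iff forall_2 matrix_matrix_mult_def sum_2)
     (auto simp: br3_def split_beta algebra_simps)

lemma traceless_sl2_matrix:
  assumes "X$2$2 = - X$1$1" shows "X \<in> range sl2_matrix"
proof -
  have "X = sl2_matrix ((X$1$2 - X$2$1) / 2, Complex (X$1$1) (- (X$1$2 + X$2$1) / 2))"
    using assms by (simp add: vec_eq_iff forall_2 field_simps)
  then show ?thesis by blast
qed

lemma aut_factor_i: "aut_factor A \<i> = Complex (A$2$2) (A$2$1)"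
  by (simp add: aut_factor_def complex_eq_iff)

text \<open>A form of the argument condition without the modulus. Its differential at the identity
  ties the angle component of a tangent vector to the lower left matrix entry.\<close>

lemma SL2R_cover_polar: "(A, t) \<in> carrier SL2R_cover \<Longrightarrow> A$2$1 * cos t = A$2$2 * sin t"
proof -
  assume "(A, t) \<in> carrier SL2R_cover"
  then have "aut_factor A \<i> = of_real (cmod (aut_factor A \<i>)) * cis t" by (simp add: SL2R_cover_def)
  then have "A$2$2 = cmod (aut_factor A \<i>) * cos t" "A$2$1 = cmod (aut_factor A \<i>) * sin t"
    by (simp_all add: aut_factor_i complex_eq_iff)
  then show ?thesis by (metis mult.assoc mult.commute)
qed

text \<open>The angle is an argument of d + i c, where (c, d) is the lower row, so its velocity at
  the identity is that of c. Conversely a Cayley curve is lifted by the principal logarithm of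
  \<open>aut_factor\<close>, which is smooth as long as d > 0.\<close>

lemma tangent_space_SL2R_cover:
  "tangent_space (carrier SL2R_cover) (mat 1, 0) = range (\<lambda>x. (sl2_matrix x, sl2_matrix x $ 2 $ 1))"
proof (rule equalityI; rule subsetI)
  fix V :: "(real^2^2) \<times> real" assume V: "V \<in> tangent_space (carrier SL2R_cover) (mat 1, 0)"
  have "fst V \<in> tangent_space {A. det A = 1} (fst (mat 1 :: real^2^2, 0 :: real))"
    by (rule tangent_space_linear_image[OF bounded_linear_fst V]) (auto simp: SL2R_cover_carrier)
  then have "fst V $ 2 $ 2 = - fst V $ 1 $ 1" by (intro trace_tangent_det_1) auto
  then obtain x where x: "fst V = sl2_matrix x" using traceless_sl2_matrix by blast
  have nth: "((\<lambda>y::(real^2^2) \<times> real. fst y $ i $ j) has_derivative (\<lambda>h. fst h $ i $ j)) F" for i j F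
    by (intro bounded_linear_imp_has_derivative bounded_linear_compose[OF bounded_linear_vec_nth]
      bounded_linear_fst)
  have "((\<lambda>y::(real^2^2) \<times> real. fst y $ 2 $ 1 * cos (snd y) - fst y $ 2 $ 2 * sin (snd y)) has_derivative
      (\<lambda>h. fst h $ 2 $ 1 - snd h)) (at (mat 1, 0))"
    by (rule has_derivative_eq_rhs, (rule derivative_intros nth)+) (auto simp: mat_def)
  from tangent_space_kernel[OF this _ V, of 0] have "fst V $ 2 $ 1 - snd V = 0"
    using SL2R_cover_polar by force
  then show "V \<in> range (\<lambda>x. (sl2_matrix x, sl2_matrix x $ 2 $ 1))"
    using x by (intro range_eqI[of _ _ x]) (simp add: prod_eq_iff)
next
  fix V :: "(real^2^2) \<times> real" assume "V \<in> range (\<lambda>x. (sl2_matrix x, sl2_matrix x $ 2 $ 1))"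
  then obtain x where V: "V = (sl2_matrix x, sl2_matrix x $ 2 $ 1)" by blast
  let ?X = "sl2_matrix x" and ?d = "det3 (-1) x"
  \<comment> \<open>The summand for the lower right entry keeps that entry of the Cayley curve
    positive, beyond making the denominator positive.\<close>
  let ?e = "1 / (1 + (\<bar>?d\<bar> + \<bar>?X$2$2\<bar>))"
  let ?\<gamma> = "cayley_curve ?d ?X"
  let ?j = "\<lambda>t. aut_factor (?\<gamma> t) \<i>"
  have e: "0 < ?e" "?e \<le> 1 / (1 + \<bar>?d\<bar>)" by (auto intro!: divide_left_mono add_pos_nonneg mult_pos_pos)
  have pos: "?\<gamma> t $ 2 $ 2 > 0" if t: "t \<in> {-?e<..<?e}" for t
  proof -
    have "\<bar>t\<bar> < ?e" using t by (auto simp: abs_if)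
    then have 1: "\<bar>t\<bar> * (1 + (\<bar>?d\<bar> + \<bar>?X$2$2\<bar>)) < 1" by (simp add: pos_less_divide_eq)
    have 2: "\<bar>t\<bar> \<le> \<bar>t\<bar> * (1 + (\<bar>?d\<bar> + \<bar>?X$2$2\<bar>))" by (simp add: distrib_left)
    then have 3: "\<bar>t\<bar> * (\<bar>t\<bar> * \<bar>?d\<bar>) \<le> 1 * (\<bar>t\<bar> * \<bar>?d\<bar>)" using 1 by (intro mult_right_mono) auto
    have 4: "0 \<le> \<bar>t\<bar> * (\<bar>t\<bar> * \<bar>?d\<bar>)" by simp
    have "\<bar>t\<bar> + \<bar>t\<bar> * \<bar>?d\<bar> + \<bar>t\<bar> * \<bar>?X$2$2\<bar> < 1"
      using 1 by (simp add: distrib_left del: sl2_matrix_nth)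
    then have "\<bar>t\<bar> * (\<bar>t\<bar> * \<bar>?d\<bar>) / 4 + \<bar>t\<bar> * \<bar>?X$2$2\<bar> < 1"
      using 3 4 abs_ge_zero[of t] by linarith
    then have "\<bar>t\<^sup>2 * ?d / 4\<bar> + \<bar>t * ?X$2$2\<bar> < 1"
      by (simp add: abs_mult power2_eq_square mult.assoc del: sl2_matrix_nth)
    then have "1 - t\<^sup>2 * ?d / 4 + t * ?X$2$2 > 0" by (simp add: abs_if split: if_splits del: sl2_matrix_nth)
    moreover have "?\<gamma> t $ 2 $ 2 = (1 - t\<^sup>2 * ?d / 4 + t * ?X$2$2) / (1 + t\<^sup>2 * ?d / 4)"
      by (simp add: cayley_curve_def mat_def del: sl2_matrix_nth)
    ultimately show ?thesis using cayley_denominator_pos[OF t e(2)] by simp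
  qed
  have jn: "?j t \<notin> \<real>\<^sub>\<le>\<^sub>0" if "t \<in> {-?e<..<?e}" for t
    using pos[OF that] by (simp add: aut_factor_i complex_nonpos_Reals_iff)
  let ?c = "\<lambda>t. (?\<gamma> t, Im (Ln (?j t)))"
  have car: "?c t \<in> carrier SL2R_cover" if t: "t \<in> {-?e<..<?e}" for t
  proof -
    have "1 + t\<^sup>2 * ?d / 4 \<noteq> 0" using cayley_denominator_pos[OF t e(2)] by simp
    then have "det (?\<gamma> t) = 1"
      by (rule det_cayley_curve[rotated 2])
         (simp_all add: det3_def split_beta cmod_power2, simp add: power2_eq_square algebra_simps)
    moreover have "?j t \<noteq> 0" using jn[OF t] by auto
    ultimately show ?thesis by (simp add: SL2R_cover_carrier cis_Arg flip: Arg_eq_Im_Ln)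
  qed
  have c\<gamma>: "Cinf_on {-?e<..<?e} ?\<gamma>" by (rule cayley_curve_smooth[OF e(2)])
  have "Cinf_on {-?e<..<?e} (\<lambda>t. Ln (?j t))"
    using jn unfolding aut_factor_def by (intro Cinf_intros c\<gamma>) auto
  then have "Cinf_on {-?e<..<?e} ?c"
    by (intro Cinf_on_Pair c\<gamma> Cinf_on_bounded_linear[OF bounded_linear_Im]) auto
  moreover have "(?c has_vector_derivative V) (at 0)"
  proof -
    have nth: "((\<lambda>t. ?\<gamma> t $ i $ j) has_vector_derivative ?X $ i $ j) (at 0)" for i j
      by (rule bounded_linear.has_vector_derivative[OF bounded_linear_compose[OF bounded_linear_vec_nth bounded_linear_vec_nth] cayley_curve_derivative])
    have "(?j has_vector_derivative of_real (?X$2$1) * \<i> + of_real (?X$2$2)) (at 0)"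
      unfolding aut_factor_def
      by (intro has_vector_derivative_add has_vector_derivative_mult_left
        bounded_linear.has_vector_derivative[OF bounded_linear_of_real nth])
    moreover have "(Ln has_field_derivative 1) (at (?j 0))"
      using has_field_derivative_Ln[of 1] by (simp add: cayley_curve_0 aut_factor_one)
    ultimately have "((Ln \<circ> ?j) has_vector_derivative (of_real (?X$2$1) * \<i> + of_real (?X$2$2)) * 1) (at 0)"
      by (rule field_vector_diff_chain_at)
    from bounded_linear.has_vector_derivative[OF bounded_linear_Im this]
    show ?thesis unfolding V
      by (intro has_vector_derivative_Pair cayley_curve_derivative) (simp add: o_def)
  qed
  ultimately show "V \<in> tangent_space (carrier SL2R_cover) (mat 1, 0)"
    unfolding tangent_space_def using e(1) car
    by (intro CollectI exI[of _ ?c] exI[of _ ?e]) (auto simp: cayley_curve_0 aut_factor_one)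
qed

section \<open>Derivatives of the Moebius action and of the lifted group law\<close>

lemma linear_aut_factor: "linear (\<lambda>A. aut_factor A z)"
  by (rule linearI) (simp_all add: aut_factor_def scaleR_conv_of_real[where 'a = complex] algebra_simps)

lemma aut_factor_derivative: "((\<lambda>A. aut_factor A z) has_derivative (\<lambda>H. aut_factor H z)) (at A within S)"
  by (rule linear_has_derivative[OF linear_aut_factor])

text \<open>The infinitesimal Moebius action at \<open>z\<close>: the quotient rule at the identity,
  where the automorphy factor is 1 and \<open>z\<close> is fixed.\<close>

definition moebius_diff :: "complex \<Rightarrow> real^2^2 \<Rightarrow> complex" where
  "moebius_diff z H = of_real (H$1$1) * z + of_real (H$1$2) - z * aut_factor H z"

lemma moebius_act_one: "moebius_act (mat 1) z = z"
  by (simp add: moebius_act_def aut_factor_one) (simp add: mat_def)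

lemma moebius_act_derivative:
  "((\<lambda>A. moebius_act A z) has_derivative moebius_diff z) (at (mat 1) within S)"
proof -
  have "linear (\<lambda>A::real^2^2. complex_of_real (A$1$1) * z + complex_of_real (A$1$2))"
    by (rule linearI) (simp_all add: scaleR_conv_of_real[where 'a = complex] algebra_simps)
  from has_derivative_divide'[OF linear_has_derivative[OF this] aut_factor_derivative, of "mat 1" z S]
  show ?thesis
    unfolding moebius_act_def by (simp add: aut_factor_one moebius_diff_def[abs_def]) (simp add: mat_def)
qed

text \<open>The imaginary part of this logarithm is the angle correction in the group law. At the
  identity the ratio is 1, where \<open>Ln\<close> has derivative 1.\<close>

lemma aut_factor_ratio_derivative:
  assumes "aut_factor A \<i> \<noteq> 0"
  shows "((\<lambda>B. Ln (aut_factor A (moebius_act B \<i>) / aut_factor A \<i>)) has_derivative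
    (\<lambda>H. of_real (A$2$1) * moebius_diff \<i> H / aut_factor A \<i>)) (at (mat 1) within S)"
proof -
  have "((\<lambda>B. aut_factor A (moebius_act B \<i>) / aut_factor A \<i>) has_derivative
      (\<lambda>H. of_real (A$2$1) * moebius_diff \<i> H / aut_factor A \<i>)) (at (mat 1) within S)"
    unfolding aut_factor_def[of A "moebius_act _ \<i>"]
    by (rule has_derivative_eq_rhs, (rule derivative_intros moebius_act_derivative)+)
       (use assms in \<open>auto simp: fun_eq_iff\<close>)
  moreover have "(Ln has_field_derivative 1) (at (aut_factor A (moebius_act (mat 1) \<i>) / aut_factor A \<i>))"
    using has_field_derivative_Ln[of 1] assms by (simp add: moebius_act_one)
  ultimately show ?thesis
    using has_derivative_compose[of _ _ "mat 1" S Ln] by (fastforce simp: has_field_derivative_def)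
qed

lemma Real_SL2R_cover_translation:
  fixes g :: "real \<times> (real^2^2) \<times> real"
  defines "G \<equiv> Real_group \<times>\<times> SL2R_cover" and "A \<equiv> fst (snd g)"
  assumes g: "g \<in> carrier G"
  shows "((\<lambda>h. g \<otimes>\<^bsub>G\<^esub> h) has_derivative (\<lambda>X. (fst X, A ** fst (snd X),
      snd (snd X) + Im (of_real (A$2$1) * moebius_diff \<i> (fst (snd X)) / aut_factor A \<i>))))
    (at \<one>\<^bsub>G\<^esub> within carrier G)"
proof -
  have one: "\<one>\<^bsub>G\<^esub> = (0, mat 1, 0)" by (simp add: G_def Real_group_def SL2R_cover_one)
  have A: "det A = 1" using g by (auto simp: G_def A_def Real_group_def SL2R_cover_carrier)
  then have j: "aut_factor A \<i> \<noteq> 0" by (simp add: aut_factor_nonzero)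
  have fs: "((\<lambda>h::real \<times> (real^2^2) \<times> real. fst (snd h)) has_derivative (\<lambda>X. fst (snd X))) (at x within S)" for x S
    by (intro has_derivative_fst has_derivative_snd has_derivative_ident)
  have Ln: "((\<lambda>h::real \<times> (real^2^2) \<times> real. Ln (aut_factor A (moebius_act (fst (snd h)) \<i>) / aut_factor A \<i>)) has_derivative
      (\<lambda>X. of_real (A$2$1) * moebius_diff \<i> (fst (snd X)) / aut_factor A \<i>)) (at (0, mat 1, 0) within carrier G)"
    by (rule has_derivative_compose[OF fs]) (simp add: aut_factor_ratio_derivative[OF j])
  have "((\<lambda>h. (fst g + fst h, A ** fst (snd h), snd (snd g) + snd (snd h) +
        Im (Ln (aut_factor A (moebius_act (fst (snd h)) \<i>) / aut_factor A \<i>)))) has_derivative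
      (\<lambda>X. (0 + fst X, A ** fst (snd X), 0 + snd (snd X) +
        Im (of_real (A$2$1) * moebius_diff \<i> (fst (snd X)) / aut_factor A \<i>))))
    (at (0, mat 1, 0) within carrier G)"
    by (intro has_derivative_Pair has_derivative_add has_derivative_const has_derivative_fst has_derivative_snd
        has_derivative_ident bounded_linear.has_derivative[OF bounded_linear_Im Ln]
        has_derivative_compose[OF fs linear_has_derivative[OF linear_matrix_mult_left]])
  \<comment> \<open>\<open>Arg\<close> equals the imaginary part of \<open>Ln\<close> for nonzero
    arguments, which is guaranteed for \<open>h\<close> in the carrier. The formula is therefore
    transferred to the product within the carrier.\<close>
  then show ?thesis
    unfolding one
  proof (rule has_derivative_eq_rhs[OF has_derivative_transform, rotated 2])
    show "(0, mat 1, 0) \<in> carrier G" by (simp add: G_def Real_group_def SL2R_cover_carrier aut_factor_one)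
    fix h assume "h \<in> carrier G"
    then have "det (fst (snd h)) = 1" by (auto simp: G_def Real_group_def SL2R_cover_carrier)
    then have "aut_factor A (moebius_act (fst (snd h)) \<i>) \<noteq> 0"
      using A by (simp add: aut_factor_nonzero Im_moebius_act)
    then show "g \<otimes>\<^bsub>G\<^esub> h = (fst g + fst h, A ** fst (snd h), snd (snd g) + snd (snd h) +
        Im (Ln (aut_factor A (moebius_act (fst (snd h)) \<i>) / aut_factor A \<i>)))"
      using j by (cases g, cases h) (simp add: G_def A_def Real_group_def SL2R_cover_def Arg_eq_Im_Ln)
  qed (auto simp: fun_eq_iff)
qed

lemma
  fixes G :: "(real \<times> (real^2^2) \<times> real) monoid"
  defines "G \<equiv> Real_group \<times>\<times> SL2R_cover"
  defines "\<iota> \<equiv> \<lambda>X :: real \<times> real \<times> complex. (fst X, sl2_matrix (snd X), sl2_matrix (snd X) $ 2 $ 1)"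
  shows lie_algebra_Real_SL2R_cover: "lie_algebra G = range \<iota>"
    and lie_bracket_Real_SL2R_cover: "lie_bracket G (\<iota> X) (\<iota> Y) = \<iota> (0, br3 (-1) (snd X) (snd Y))"
    and translation_group_Real_SL2R_cover: "translation_group G"
proof -
  have c: "carrier G = UNIV \<times> carrier SL2R_cover" "\<one>\<^bsub>G\<^esub> = (0, mat 1, 0)"
    by (simp_all add: G_def Real_group_def SL2R_cover_one)
  define L :: "real \<times> (real^2^2) \<times> real \<Rightarrow> real \<times> (real^2^2) \<times> real \<Rightarrow> real \<times> (real^2^2) \<times> real" where
    "L g X = (fst X, fst (snd g) ** fst (snd X), snd (snd X) +
      Im (of_real (fst (snd g) $2$1) * moebius_diff \<i> (fst (snd X)) / aut_factor (fst (snd g)) \<i>))" for g X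
  have LT: "((\<lambda>h. g \<otimes>\<^bsub>G\<^esub> h) has_derivative L g) (at \<one>\<^bsub>G\<^esub> within carrier G)" if "g \<in> carrier G" for g
    using Real_SL2R_cover_translation that unfolding G_def L_def[abs_def] by blast
  show l: "lie_algebra G = range \<iota>"
    unfolding lie_algebra_def c tangent_space_line_product tangent_space_SL2R_cover \<iota>_def by (auto simp: image_iff) blast
  have fs: "((\<lambda>h::real \<times> (real^2^2) \<times> real. fst (snd h)) has_derivative (\<lambda>X. fst (snd X))) (at x within S)" for x S
    by (intro has_derivative_fst has_derivative_snd has_derivative_ident)
  define E :: "real \<times> (real^2^2) \<times> real \<Rightarrow> real \<times> (real^2^2) \<times> real \<Rightarrow> real \<times> (real^2^2) \<times> real" where
    "E X H = (0, fst (snd H) ** fst (snd X), Im (of_real (fst (snd H) $2$1) * moebius_diff \<i> (fst (snd X))))" for X H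
  have E: "((\<lambda>g. L g X) has_derivative E X) (at \<one>\<^bsub>G\<^esub> within carrier G)" for X
  proof -
    let ?m = "moebius_diff \<i> (fst (snd X))"
    have lin: "linear (\<lambda>A::real^2^2. of_real (A$2$1) * ?m)"
      by (rule linearI) (simp_all add: scaleR_conv_of_real[where 'a = complex] algebra_simps)
    \<comment> \<open>At the identity the lower left entry is 0, so the term from differentiating
      the denominator drops out.\<close>
    have "((\<lambda>A. of_real (A$2$1) * ?m / aut_factor A \<i>) has_derivative (\<lambda>H. of_real (H$2$1) * ?m))
        (at (fst (snd (0 :: real, mat 1 :: real^2^2, 0 :: real))))"
      using has_derivative_divide'[OF linear_has_derivative[OF lin] aut_factor_derivative, of "mat 1" \<i> UNIV]
      by (simp add: aut_factor_one) (simp add: mat_def)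
    from has_derivative_compose[OF fs this, of "carrier G"]
    have "((\<lambda>g::real \<times> (real^2^2) \<times> real. of_real (fst (snd g) $2$1) * ?m / aut_factor (fst (snd g)) \<i>) has_derivative
        (\<lambda>H. of_real (fst (snd H) $2$1) * ?m)) (at (0, mat 1, 0) within carrier G)" .
    then have "((\<lambda>g. L g X) has_derivative (\<lambda>H. (0, fst (snd H) ** fst (snd X), 0 + Im (of_real (fst (snd H) $2$1) * ?m))))
        (at (0, mat 1, 0) within carrier G)"
      unfolding L_def
      by (intro has_derivative_Pair has_derivative_add has_derivative_const
        bounded_linear.has_derivative[OF bounded_linear_Im]
        has_derivative_compose[OF fs linear_has_derivative[OF linear_matrix_mult_right]])
    then show ?thesis by (simp add: c E_def[abs_def])
  qed
  interpret group G unfolding G_def by (intro DirProd_group group_Real group_SL2R_cover)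
  have "lie_bracket G (\<iota> X) (\<iota> Y) = E (\<iota> Y) (\<iota> X) - E (\<iota> X) (\<iota> Y)"
    by (rule lie_bracket_eq[OF one_closed LT E]) (auto simp: l)
  also have "\<dots> = \<iota> (0, br3 (-1) (snd X) (snd Y))"
    unfolding E_def \<iota>_def fst_conv snd_conv sl2_matrix_br3
    by (simp add: matrix_matrix_mult_def sum_2 moebius_diff_def aut_factor_def algebra_simps)
  finally show "lie_bracket G (\<iota> X) (\<iota> Y) = \<iota> (0, br3 (-1) (snd X) (snd Y))" .
  show "translation_group G"
    by unfold_locales (unfold differentiable_def, rule exI, rule LT)
qed

text \<open>The lift of \<open>ln (aut_factor A u)\<close> to the universal cover.\<close>

definition log_aut :: "real^2^2 \<Rightarrow> real \<Rightarrow> complex \<Rightarrow> complex" where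
  "log_aut A t u = \<i> * of_real t + Ln (aut_factor A u / aut_factor A \<i>) + of_real (ln ((A$2$1)\<^sup>2 + (A$2$2)\<^sup>2) / 2)"

text \<open>The definition uses (c^2 + d^2), with (c, d) the lower row, so as to be visibly smooth
  in the matrix entries; half its logarithm is the logarithm of |\<open>aut_factor A \<i>\<close>|,
  which cancels against the denominator inside \<open>Ln\<close>.\<close>

lemma log_aut_eq:
  assumes A: "det A = 1" and u: "Im u > 0"
  shows "log_aut A t u = Complex (ln (cmod (aut_factor A u))) (t + arg_factor A u)"
proof -
  have nz: "aut_factor A u \<noteq> 0" "aut_factor A \<i> \<noteq> 0" using A u by (simp_all add: aut_factor_nonzero)
  have "(A$2$1)\<^sup>2 + (A$2$2)\<^sup>2 = (cmod (aut_factor A \<i>))\<^sup>2" by (simp add: aut_factor_i cmod_power2)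
  then have "ln ((A$2$1)\<^sup>2 + (A$2$2)\<^sup>2) / 2 = ln (cmod (aut_factor A \<i>))"
    using nz by (simp add: ln_realpow)
  moreover have "Re (Ln (aut_factor A u / aut_factor A \<i>)) = ln (cmod (aut_factor A u)) - ln (cmod (aut_factor A \<i>))"
    using nz by (simp add: norm_divide ln_div)
  moreover have "Im (Ln (aut_factor A u / aut_factor A \<i>)) = arg_factor A u"
    using nz by (simp add: Arg_eq_Im_Ln)
  ultimately show ?thesis by (intro complex_eqI) (simp_all add: log_aut_def)
qed

lemma exp_log_aut:
  assumes g: "(A, t) \<in> carrier SL2R_cover" and u: "Im u > 0"
  shows "exp (log_aut A t u) = aut_factor A u"
proof -
  have A: "det A = 1" "cis t = sgn (aut_factor A \<i>)" using g by (auto simp: SL2R_cover_carrier)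
  then have nz: "aut_factor A u \<noteq> 0" "aut_factor A \<i> \<noteq> 0" using u by (simp_all add: aut_factor_nonzero)
  have "exp (log_aut A t u) = of_real (cmod (aut_factor A u)) * (cis t * cis (arg_factor A u))"
    using nz unfolding log_aut_eq[OF A(1) u] exp_eq_polar by (simp add: cis_mult exp_of_real)
  also have "cis t * cis (arg_factor A u) = sgn (aut_factor A u)"
    using nz by (simp add: A(2) cis_Arg sgn_divide sgn_zero_iff)
  finally show ?thesis using nz by (simp add: sgn_div_norm scaleR_conv_of_real)
qed

text \<open>The real part is the logarithm of \<open>aut_factor_mult\<close>, the imaginary part is
  \<open>arg_factor_cocycle\<close>. The choice of angle in the cover makes the identity exact, not
  merely modulo 2 pi i.\<close>

lemma log_aut_mult:
  assumes A: "det A = 1" and B: "det B = 1" and u: "Im u > 0"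
  shows "log_aut (A ** B) (s + t + arg_factor A (moebius_act B \<i>)) u = log_aut A s (moebius_act B u) + log_aut B t u"
proof -
  have AB: "det (A ** B) = 1" using A B by (simp add: det_mul)
  have Bu: "Im (moebius_act B u) > 0" using B u by (rule Im_moebius_act)
  have nz: "aut_factor B u \<noteq> 0" "aut_factor A (moebius_act B u) \<noteq> 0" using A B u Bu by (simp_all add: aut_factor_nonzero)
  show ?thesis
    using arg_factor_cocycle[OF A B u] nz
    by (simp add: log_aut_eq A B AB u Bu aut_factor_mult norm_mult ln_mult complex_eq_iff)
qed

lemma Im_moebius_act_eq:
  assumes "det A = 1" "Im z > 0"
  shows "Im (moebius_act A z) = Im z / (cmod (aut_factor A z))\<^sup>2"
proof -
  let ?j = "aut_factor A z" let ?n = "of_real (A$1$1) * z + of_real (A$1$2)"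
  have "Im ?n * Re ?j - Re ?n * Im ?j = det A * Im z"
    by (simp add: aut_factor_def det_2 algebra_simps)
  then show ?thesis using assms by (simp add: moebius_act_def Im_divide cmod_power2)
qed

definition vec2 :: "complex \<Rightarrow> complex \<Rightarrow> complex^2" where "vec2 x y = (\<chi> k. if k = 1 then x else y)"

lemma vec2_nth [simp]: "vec2 x y $ 1 = x" "vec2 x y $ 2 = y"
  by (simp_all add: vec2_def)

lemma has_derivative_vec2:
  assumes "(f has_derivative f') F" "(g has_derivative g') F"
  shows "((\<lambda>x. vec2 (f x) (g x)) has_derivative (\<lambda>h. vec2 (f' h) (g' h))) F"
  unfolding vec2_def
proof (rule has_derivative_vec_lambda)
  show "((\<lambda>x. if k = 1 then f x else g x) has_derivative (\<lambda>h. if k = 1 then f' h else g' h)) F" for k :: 2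
    using assms by (cases "k = 1") simp_all
qed

text \<open>
  \<open>N\<close> and \<open>M\<close> are the two components of \<open>(l s + X) v\<close> for \<open>v = (z, 1)\<close>, \<open>Im z > 0\<close>.
\<close>

lemma biholomorphic_Real_SL2R_cover_upper:
  fixes G :: "(real \<times> (real^2^2) \<times> real) monoid" and l z :: complex
  defines "G \<equiv> Real_group \<times>\<times> SL2R_cover"
  defines "\<iota> \<equiv> \<lambda>X :: real \<times> real \<times> complex. (fst X, sl2_matrix (snd X), sl2_matrix (snd X) $ 2 $ 1)"
  defines "N \<equiv> \<lambda>X :: real \<times> real \<times> complex. l * of_real (fst X) * z + (of_real (sl2_matrix (snd X) $ 1 $ 1) * z + of_real (sl2_matrix (snd X) $ 1 $ 2))"
  defines "M \<equiv> \<lambda>X :: real \<times> real \<times> complex. l * of_real (fst X) + aut_factor (sl2_matrix (snd X)) z"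
  assumes z: "Im z > 0" and l: "Re l \<noteq> 0"
    and J: "\<And>X. \<exists>Y. J (\<iota> X) = \<iota> Y \<and> N Y = \<i> * N X \<and> M Y = \<i> * M X"
  shows "biholomorphic_to G J {z :: complex^2. Im (z$1) > 0}"
proof -
  interpret translation_group G unfolding G_def by (rule translation_group_Real_SL2R_cover)
  have carrier: "carrier G = UNIV \<times> carrier SL2R_cover" and one: "\<one>\<^bsub>G\<^esub> = (0, mat 1, 0)"
    by (simp_all add: G_def Real_group_def SL2R_cover_one)
  note lie = lie_algebra_Real_SL2R_cover[folded G_def, folded \<iota>_def]
  let ?U = "{z :: complex^2. Im (z$1) > 0}"
  define F :: "real \<times> (real^2^2) \<times> real \<Rightarrow> complex^2" where
    "F g = vec2 (moebius_act (fst (snd g)) z) (l * of_real (fst g) + log_aut (fst (snd g)) (snd (snd g)) z)" for g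
  \<comment> \<open>For y = F(s, A, t) one has Im(y$1) = Im z / |cz + d|^2 and Re(y$2) = Re l s + ln
    |cz + d|; eliminating |cz + d| gives \<open>s\<close>. Then \<open>E y\<close> is the lifted
    logarithm of cz + d.\<close>
  define r where "r y = (Re (y$2) - ln (Im z / Im (y$1)) / 2) / Re l" for y :: "complex^2"
  define E where "E y = y$2 - l * of_real (r y)" for y :: "complex^2"
  \<comment> \<open>Since \<open>z\<close> is not real, each complex number x is a z + b for a
    unique real row (a, b). The rows of \<open>B y\<close> represent the prescribed numerator
    \<open>y$1 * exp (E y)\<close> and denominator \<open>exp (E y)\<close>.\<close>
  define B :: "complex^2 \<Rightarrow> real^2^2" where "B y = (\<chi> i j. let x = (if i = 1 then y$1 * exp (E y) else exp (E y))
      in if j = 1 then Im x / Im z else Re x - Im x / Im z * Re z)" for y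
  define F' where "F' y = (r y, B y, Im (E y) - Im (Ln (exp (E y) / aut_factor (B y) \<i>)))" for y
  have row: "of_real (Im x / Im z) * z + of_real (Re x - Im x / Im z * Re z) = x" for x
    using z by (simp add: complex_eq_iff)
  have B1: "of_real (B y $ 1 $ 1) * z + of_real (B y $ 1 $ 2) = y$1 * exp (E y)"
    and B2: "aut_factor (B y) z = exp (E y)" for y
  proof -
    have "(2 :: 2) = 1 \<longleftrightarrow> False" by simp
    then show "of_real (B y $ 1 $ 1) * z + of_real (B y $ 1 $ 2) = y$1 * exp (E y)"
      and "aut_factor (B y) z = exp (E y)"
      by (simp_all only: B_def Let_def aut_factor_def vec_lambda_beta simp_thms if_True if_False row)
  qed
  have ReE: "Re (E y) = ln (Im z / Im (y$1)) / 2" for y using l by (simp add: E_def r_def)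
  have cmod_exp: "(cmod (exp (E y)))\<^sup>2 = Im z / Im (y$1)" if "y \<in> ?U" for y
  proof -
    have "(cmod (exp (E y)))\<^sup>2 = exp (2 * Re (E y))" by (simp add: power2_eq_square flip: exp_add)
    then show ?thesis using that z by (simp add: ReE)
  qed
  have detB: "det (B y) = 1" if y: "y \<in> ?U" for y
  proof -
    let ?n = "of_real (B y $ 1 $ 1) * z + of_real (B y $ 1 $ 2)" let ?j = "aut_factor (B y) z"
    have "det (B y) * Im z = Im ?n * Re ?j - Re ?n * Im ?j"
      by (simp add: aut_factor_def det_2 algebra_simps)
    also have "\<dots> = Im (y$1) * (cmod (exp (E y)))\<^sup>2"
      unfolding B1 B2 cmod_power2 by (simp add: power2_eq_square algebra_simps)
    also have "\<dots> = Im z" unfolding cmod_exp[OF y] using y z by simp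
    finally show ?thesis using z by simp
  qed
  have nz: "aut_factor (B y) \<i> \<noteq> 0" if "y \<in> ?U" for y using detB[OF that] by (simp add: aut_factor_nonzero)
  have ArgE: "Im (Ln (exp (E y) / aut_factor (B y) \<i>)) = Arg (exp (E y) / aut_factor (B y) \<i>)" if "y \<in> ?U" for y
    using nz[OF that] by (simp add: Arg_eq_Im_Ln)
  have Fcarrier: "F' y \<in> carrier G" if y: "y \<in> ?U" for y
  proof -
    have "cis (Im (E y)) = sgn (exp (E y))"
      by (subst exp_eq_polar) (simp add: sgn_div_norm norm_mult scaleR_conv_of_real)
    then have "cis (Im (E y) - Arg (exp (E y) / aut_factor (B y) \<i>)) = sgn (aut_factor (B y) \<i>)"
      using nz[OF y] by (simp add: cis_divide[symmetric] cis_Arg sgn_divide sgn_zero_iff)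
    then show ?thesis by (simp add: F'_def carrier SL2R_cover_carrier detB[OF y] ArgE[OF y])
  qed
  have FF': "F (F' y) = y" if y: "y \<in> ?U" for y
  proof -
    have "moebius_act (B y) z = y$1" unfolding moebius_act_def B1 B2 by simp
    moreover have "log_aut (B y) (Im (E y) - Im (Ln (exp (E y) / aut_factor (B y) \<i>))) z = E y"
      unfolding ArgE[OF y] by (simp add: log_aut_eq detB[OF y] z B2 complex_eq_iff)
    ultimately show ?thesis by (simp add: F_def F'_def vec_eq_iff forall_2 E_def)
  qed
  have F_U: "F g \<in> ?U" if "g \<in> carrier G" for g
    using that z by (auto simp: carrier F_def SL2R_cover_carrier Im_moebius_act)
  have F'F: "F' (F g) = g" if g: "g \<in> carrier G" for g
  proof -
    obtain s A t where g_eq: "g = (s, A, t)" by (rule prod_cases3)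
    have c: "(A, t) \<in> carrier SL2R_cover" and A: "det A = 1" using g by (auto simp: g_eq carrier SL2R_cover_carrier)
    have j: "aut_factor A z \<noteq> 0" "aut_factor A \<i> \<noteq> 0" using A z by (simp_all add: aut_factor_nonzero)
    have "Im z / Im (moebius_act A z) = (cmod (aut_factor A z))\<^sup>2"
      using z j by (simp add: Im_moebius_act_eq[OF A z])
    then have r: "r (F g) = s"
      using l j by (simp add: r_def F_def g_eq log_aut_eq[OF A z] ln_realpow)
    then have E: "E (F g) = log_aut A t z" by (simp add: E_def F_def g_eq)
    then have eE: "exp (E (F g)) = aut_factor A z" using exp_log_aut[OF c z] by simp
    have "F g $ 1 * exp (E (F g)) = of_real (A$1$1) * z + of_real (A$1$2)"
      unfolding eE using j by (simp add: F_def g_eq moebius_act_def)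
    then have B: "B (F g) = A"
      using z by (simp add: B_def Let_def vec_eq_iff forall_2 eE aut_factor_def)
    show ?thesis
      unfolding F'_def ArgE[OF F_U[OF g]]
      unfolding eE B r unfolding E log_aut_eq[OF A z] by (simp add: g_eq)
  qed
  \<comment> \<open>The product with the conjugate has the same argument as the quotient but is
    continuous also where the denominator vanishes. So \<open>W\<close> is open, and at zeros of
    either factor the product is 0 and is excluded.\<close>
  define W where "W = {g :: real \<times> (real^2^2) \<times> real. aut_factor (fst (snd g)) z * cnj (aut_factor (fst (snd g)) \<i>) \<notin> \<real>\<^sub>\<le>\<^sub>0}"
  have W: "aut_factor (fst (snd g)) z \<noteq> 0" "aut_factor (fst (snd g)) \<i> \<noteq> 0"
      "aut_factor (fst (snd g)) z / aut_factor (fst (snd g)) \<i> \<notin> \<real>\<^sub>\<le>\<^sub>0" if "g \<in> W" for g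
  proof -
    let ?a = "aut_factor (fst (snd g)) z" and ?b = "aut_factor (fst (snd g)) \<i>"
    have w: "?a * cnj ?b \<notin> \<real>\<^sub>\<le>\<^sub>0" using that by (simp add: W_def)
    then show n: "?a \<noteq> 0" "?b \<noteq> 0" by auto
    show "?a / ?b \<notin> \<real>\<^sub>\<le>\<^sub>0"
    proof
      assume "?a / ?b \<in> \<real>\<^sub>\<le>\<^sub>0"
      then obtain x where x: "x \<le> 0" "?a / ?b = of_real x" by (auto elim: nonpos_Reals_cases)
      then have "?a * cnj ?b = of_real x * (?b * cnj ?b)" using n by (simp add: field_simps)
      also have "\<dots> = of_real (x * (cmod ?b * cmod ?b))" by (simp add: mult_cnj_cmod)
      finally have "?a * cnj ?b \<in> \<real>\<^sub>\<le>\<^sub>0" using x(1) by (simp add: mult_nonpos_nonneg del: of_real_mult)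
      then show False using w by simp
    qed
  qed
  have openW: "open W"
  proof -
    have "continuous_on UNIV (\<lambda>g :: real \<times> (real^2^2) \<times> real. aut_factor (fst (snd g)) z * cnj (aut_factor (fst (snd g)) \<i>))"
      unfolding aut_factor_def by (intro continuous_intros)
    from open_vimage[OF _ this, of "- \<real>\<^sub>\<le>\<^sub>0"] show ?thesis
      by (simp add: W_def vimage_def open_Compl)
  qed
  have carrierW: "carrier G \<subseteq> W"
  proof
    fix g assume "g \<in> carrier G"
    then have A: "det (fst (snd g)) = 1" by (auto simp: carrier SL2R_cover_carrier)
    let ?a = "aut_factor (fst (snd g)) z" and ?b = "aut_factor (fst (snd g)) \<i>"
    have b: "?b \<noteq> 0" using A by (simp add: aut_factor_nonzero)
    have "?a / ?b \<in> \<real>\<^sub>\<le>\<^sub>0" if w: "?a * cnj ?b \<in> \<real>\<^sub>\<le>\<^sub>0"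
    proof -
      obtain x where x: "x \<le> 0" "?a * cnj ?b = of_real x" using w by (auto elim: nonpos_Reals_cases)
      have "?a / ?b = (?a * cnj ?b) / (?b * cnj ?b)" using b by simp
      also have "\<dots> = of_real (x / (cmod ?b * cmod ?b))" by (simp add: x(2) mult_cnj_cmod)
      finally show ?thesis using x(1) by (simp add: divide_nonpos_nonneg del: of_real_divide)
    qed
    then show "g \<in> W" using aut_factor_ratio[OF A z, of \<i>] by (auto simp: W_def)
  qed
  have cF: "Cinf_on W F"
  proof -
    have a: "Cinf_on W (\<lambda>g. aut_factor (fst (snd g)) w)" for w
      unfolding aut_factor_def by (intro Cinf_intros openW)
    have ln: "Cinf_on W (\<lambda>g. ln ((fst (snd g) $2$1)\<^sup>2 + (fst (snd g) $2$2)\<^sup>2))"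
    proof (intro Cinf_intros openW)
      show "0 < (fst (snd g) $2$1)\<^sup>2 + (fst (snd g) $2$2)\<^sup>2" if "g \<in> W" for g
        using W(2)[OF that] by (auto simp: aut_factor_i complex_eq_iff sum_power2_gt_zero_iff)
    qed
    have Ln: "Cinf_on W (\<lambda>g. Ln (aut_factor (fst (snd g)) z / aut_factor (fst (snd g)) \<i>))"
      by (rule Cinf_on_Ln[OF openW Cinf_on_divide[OF openW a a]]) (use W in auto)
    have "Cinf_on W (\<lambda>g. log_aut (fst (snd g)) (snd (snd g)) z)"
      unfolding log_aut_def
      by (rule Cinf_on_add[OF openW Cinf_on_add[OF openW _ Ln] Cinf_on_bounded_linear[OF bounded_linear_of_real openW
        Cinf_on_divide[OF openW ln Cinf_on_const]]]) (intro Cinf_intros openW, simp)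
    moreover have "Cinf_on W (\<lambda>g. moebius_act (fst (snd g)) z)"
      unfolding moebius_act_def using W(1) by (intro Cinf_on_divide[OF openW _ a] Cinf_intros openW) auto
    ultimately show ?thesis unfolding F_def vec2_def by (intro Cinf_intros openW)
  qed
  have openU: "open ?U" by (intro open_Collect_less continuous_intros)
  have cF': "Cinf_on ?U F'"
  proof -
    have ln: "Cinf_on ?U (\<lambda>y. ln (Im z / Im (y$1)))"
      by (intro Cinf_intros openU) (use z in auto)
    have r: "Cinf_on ?U (\<lambda>y. r y)"
      unfolding r_def
      by (rule Cinf_on_divide[OF openU Cinf_on_diff[OF openU _ Cinf_on_divide[OF openU ln Cinf_on_const]] Cinf_on_const])
         (intro Cinf_intros openU, use l in auto)
    then have E: "Cinf_on ?U (\<lambda>y. E y)"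
      unfolding E_def by (intro Cinf_on_diff Cinf_on_mult Cinf_on_const Cinf_on_bounded_linear[OF bounded_linear_of_real]
        Cinf_on_bounded_linear[OF bounded_linear_vec_nth] Cinf_on_id openU)
    have e: "Cinf_on ?U (\<lambda>y. exp (E y))" by (rule Cinf_on_exp[OF openU E])
    have entry: "Cinf_on ?U (\<lambda>y. if Q then Im (f y) / Im z else Re (f y) - Im (f y) / Im z * Re z)"
      if f: "Cinf_on ?U f" for Q f
    proof -
      have "Cinf_on ?U (\<lambda>y. Im (f y) / Im z)"
        by (rule Cinf_on_divide[OF openU Cinf_on_bounded_linear[OF bounded_linear_Im openU f] Cinf_on_const]) (use z in simp)
      moreover from this have "Cinf_on ?U (\<lambda>y. Re (f y) - Im (f y) / Im z * Re z)"
        by (intro Cinf_on_diff[OF openU Cinf_on_bounded_linear[OF bounded_linear_Re openU f]] Cinf_on_mult[OF openU] Cinf_on_const)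
      ultimately show ?thesis by (cases Q) simp_all
    qed
    have y1: "Cinf_on ?U (\<lambda>y. y$1 * exp (E y))"
      by (intro Cinf_on_mult[OF openU] e Cinf_on_bounded_linear[OF bounded_linear_vec_nth openU] Cinf_on_id openU)
    have B: "Cinf_on ?U (\<lambda>y. B y)"
      unfolding B_def Let_def
    proof (intro Cinf_on_vec[OF openU] entry)
      show "Cinf_on ?U (\<lambda>y. if i = 1 then y$1 * exp (E y) else exp (E y))" for i :: 2
        using y1 e by (cases "i = 1") simp_all
    qed
    have "Cinf_on ?U (\<lambda>y. aut_factor (B y) \<i>)"
      by (rule Cinf_on_linear[OF linear_aut_factor openU B])
    moreover have "exp (E y) / aut_factor (B y) \<i> \<notin> \<real>\<^sub>\<le>\<^sub>0" if "y \<in> ?U" for y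
      using aut_factor_ratio[OF detB[OF that] z, of \<i>] by (simp add: B2)
    ultimately have "Cinf_on ?U (\<lambda>y. Ln (exp (E y) / aut_factor (B y) \<i>))"
      using nz by (intro Cinf_on_Ln[OF openU Cinf_on_divide[OF openU e]]) auto
    then show ?thesis unfolding F'_def
      by (intro Cinf_on_Pair[OF openU r] Cinf_on_Pair[OF openU B] Cinf_on_diff[OF openU]
        Cinf_on_bounded_linear[OF bounded_linear_Im openU] E)
  qed
  have "biholomorphism_onto G J ?U F"
  proof (rule biholomorphism_onto_equivariant[OF openU])
    show "diffeomorphism_on (carrier G) ?U F"
      by (rule diffeomorphism_onI[OF _ _ F'F FF' openW carrierW cF openU subset_refl cF'])
         (use F_U Fcarrier in auto)
    show "F (g \<otimes>\<^bsub>G\<^esub> h) = vec2 (moebius_act (fst (snd g)) (F h $ 1))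
        (l * of_real (fst g) + log_aut (fst (snd g)) (snd (snd g)) (F h $ 1) + F h $ 2)"
      if g: "g \<in> carrier G" and h: "h \<in> carrier G" for g h
    proof -
      obtain s A t where g_eq: "g = (s, A, t)" by (rule prod_cases3)
      obtain s' A' t' where h_eq: "h = (s', A', t')" by (rule prod_cases3)
      have A: "det A = 1" "det A' = 1" using g h by (auto simp: g_eq h_eq carrier SL2R_cover_carrier)
      have "Im (moebius_act A' z) > 0" using A z by (simp add: Im_moebius_act)
      then have "moebius_act (A ** A') z = moebius_act A (moebius_act A' z)"
        using A z by (intro moebius_act_mult aut_factor_nonzero) auto
      then show ?thesis
        using log_aut_mult[OF A z, of t t']
        by (simp add: g_eq h_eq G_def Real_group_def SL2R_cover_mult F_def vec_eq_iff forall_2 algebra_simps)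
    qed
    have lin: "linear (\<lambda>h::complex^2. vec2 (a * h$1) (b * h$1 + h$2))" for a b
      by (rule linearI) (auto simp: vec_eq_iff forall_2 scaleR_conv_of_real[where 'a = complex] algebra_simps)
    \<comment> \<open>The derivative at \<open>z\<close> of the Moebius map of the matrix
      \<open>g\<close>; \<open>z\<close> is the first coordinate of \<open>F\<close> at the
      identity.\<close>
    define m where "m g = (of_real (g$1$1) * aut_factor g z - (of_real (g$1$1) * z + of_real (g$1$2)) * of_real (g$2$1)) /
        (aut_factor g z * aut_factor g z)" for g :: "real^2^2"
    show "((\<lambda>y. vec2 (moebius_act (fst (snd g)) (y$1)) (l * of_real (fst g) + log_aut (fst (snd g)) (snd (snd g)) (y$1) + y$2))
        has_derivative (\<lambda>h. vec2 (m (fst (snd g)) * h$1) (of_real (fst (snd g) $2$1) / aut_factor (fst (snd g)) z * h$1 + h$2)))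
        (at (F \<one>\<^bsub>G\<^esub>))" if g: "g \<in> carrier G" for g
    proof -
      let ?A = "fst (snd g)"
      have A: "det ?A = 1" using g by (auto simp: carrier SL2R_cover_carrier)
      have j: "aut_factor ?A z \<noteq> 0" "aut_factor ?A \<i> \<noteq> 0" using A z by (simp_all add: aut_factor_nonzero)
      have F1: "F \<one>\<^bsub>G\<^esub> $ 1 = z" by (simp add: F_def one moebius_act_one)
      have dm: "((\<lambda>u. moebius_act ?A u) has_field_derivative m ?A) (at (F \<one>\<^bsub>G\<^esub> $ 1))"
        unfolding F1
        unfolding moebius_act_def aut_factor_def m_def
        by (rule derivative_eq_intros refl | use j in \<open>simp add: aut_factor_def\<close>)+
      have dl: "((\<lambda>u. log_aut ?A (snd (snd g)) u) has_field_derivative of_real (?A$2$1) / aut_factor ?A z) (at (F \<one>\<^bsub>G\<^esub> $ 1))"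
      proof -
        have "((\<lambda>u. aut_factor ?A u / aut_factor ?A \<i>) has_field_derivative of_real (?A$2$1) / aut_factor ?A \<i>) (at z)"
          unfolding aut_factor_def[of ?A]
          by (rule derivative_eq_intros refl | use j in \<open>simp add: aut_factor_def\<close>)+
        from DERIV_chain2[OF has_field_derivative_Ln[OF aut_factor_ratio[OF A z, of \<i>]] this]
        have "((\<lambda>u. Ln (aut_factor ?A u / aut_factor ?A \<i>)) has_field_derivative of_real (?A$2$1) / aut_factor ?A z) (at z)"
          using j by simp
        from DERIV_add[OF DERIV_add[OF DERIV_const this] DERIV_const] show ?thesis
          unfolding log_aut_def F1 by simp
      qed
      have nth: "((\<lambda>y::complex^2. y$i) has_derivative (\<lambda>h. h$i)) F" for i F
        by (rule bounded_linear_imp_has_derivative[OF bounded_linear_vec_nth])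
      have "((\<lambda>y. l * of_real (fst g) + log_aut ?A (snd (snd g)) (y$1) + y$2) has_derivative
          (\<lambda>h. 0 + of_real (?A$2$1) / aut_factor ?A z * h$1 + h$2)) (at (F \<one>\<^bsub>G\<^esub>))"
        by (intro has_derivative_add has_derivative_const nth
          has_derivative_compose[OF nth dl[unfolded has_field_derivative_def]])
      from has_derivative_vec2[OF has_derivative_compose[OF nth dm[unfolded has_field_derivative_def]] this]
      show ?thesis by simp
    qed
    show "vec2 (m (fst (snd g)) * (\<i> *s y)$1) (of_real (fst (snd g) $2$1) / aut_factor (fst (snd g)) z * (\<i> *s y)$1 + (\<i> *s y)$2) =
        \<i> *s vec2 (m (fst (snd g)) * y$1) (of_real (fst (snd g) $2$1) / aut_factor (fst (snd g)) z * y$1 + y$2)" for g y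
      by (simp add: vec_eq_iff forall_2 algebra_simps)
    let ?D = "\<lambda>X. vec2 (moebius_diff z (fst (snd X))) (l * of_real (fst X) + (\<i> * of_real (snd (snd X)) +
        (aut_factor (fst (snd X)) z - aut_factor (fst (snd X)) \<i>) + of_real (fst (snd X) $2$2)))"
    show "(F has_derivative ?D) (at \<one>\<^bsub>G\<^esub> within carrier G)"
    proof (rule has_derivative_at_withinI)
      have fs: "((\<lambda>h::real \<times> (real^2^2) \<times> real. fst (snd h)) has_derivative (\<lambda>X. fst (snd X))) (at \<one>\<^bsub>G\<^esub>)"
        by (intro has_derivative_fst has_derivative_snd has_derivative_ident)
      have f1: "fst (snd \<one>\<^bsub>G\<^esub>) = mat 1" by (simp add: one)
      have "((\<lambda>A. aut_factor A z / aut_factor A \<i>) has_derivative (\<lambda>H. aut_factor H z - aut_factor H \<i>)) (at (mat 1))"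
        using has_derivative_divide'[OF aut_factor_derivative aut_factor_derivative, of "mat 1" \<i> z UNIV]
        by (simp add: aut_factor_one)
      moreover have "(Ln has_derivative (\<lambda>h. h)) (at (aut_factor (mat 1) z / aut_factor (mat 1) \<i>))"
        using has_field_derivative_Ln[of 1] by (simp add: aut_factor_one has_field_derivative_def mult_1[abs_def])
      ultimately have 1: "((\<lambda>A. Ln (aut_factor A z / aut_factor A \<i>)) has_derivative (\<lambda>H. aut_factor H z - aut_factor H \<i>)) (at (fst (snd \<one>\<^bsub>G\<^esub>)))"
        unfolding f1 by (rule has_derivative_compose)
      have nth: "((\<lambda>A::real^2^2. A$i$j) has_derivative (\<lambda>H. H$i$j)) F" for i j F
        by (intro bounded_linear_imp_has_derivative bounded_linear_compose[OF bounded_linear_vec_nth bounded_linear_vec_nth])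
      have 2: "((\<lambda>A::real^2^2. ln ((A$2$1)\<^sup>2 + (A$2$2)\<^sup>2) / 2) has_derivative (\<lambda>H. H$2$2)) (at (fst (snd \<one>\<^bsub>G\<^esub>)))"
      proof -
        have "((\<lambda>A::real^2^2. (A$2$1)\<^sup>2 + (A$2$2)\<^sup>2) has_derivative (\<lambda>H. 2 * H$2$2)) (at (mat 1))"
          unfolding power2_eq_square
          by (rule has_derivative_eq_rhs[OF has_derivative_add[OF has_derivative_mult[OF nth nth] has_derivative_mult[OF nth nth]]])
            (simp add: mat_def fun_eq_iff)
        moreover have "(ln has_derivative (\<lambda>h. h)) (at (((mat 1 :: real^2^2)$2$1)\<^sup>2 + ((mat 1 :: real^2^2)$2$2)\<^sup>2))"
          using DERIV_ln[of "1::real"] by (simp add: mat_def has_field_derivative_def mult_1[abs_def])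
        ultimately have "((\<lambda>A::real^2^2. ln ((A$2$1)\<^sup>2 + (A$2$2)\<^sup>2)) has_derivative (\<lambda>H. 2 * H$2$2)) (at (mat 1))"
          by (rule has_derivative_compose)
        from bounded_linear.has_derivative[OF bounded_linear_divide[of 2] this] show ?thesis unfolding f1 by simp
      qed
      have 3: "((\<lambda>A. moebius_act A z) has_derivative moebius_diff z) (at (fst (snd \<one>\<^bsub>G\<^esub>)))"
        unfolding f1 by (rule moebius_act_derivative)
      have "((\<lambda>g::real \<times> (real^2^2) \<times> real. l * of_real (fst g)) has_derivative (\<lambda>X. l * of_real (fst X))) (at \<one>\<^bsub>G\<^esub>)"
        "((\<lambda>g::real \<times> (real^2^2) \<times> real. \<i> * of_real (snd (snd g))) has_derivative (\<lambda>X. \<i> * of_real (snd (snd X)))) (at \<one>\<^bsub>G\<^esub>)"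
        by (auto intro!: linear_has_derivative linearI simp: scaleR_conv_of_real algebra_simps)
      then have 4: "((\<lambda>g. l * of_real (fst g) + log_aut (fst (snd g)) (snd (snd g)) z) has_derivative
          (\<lambda>X. l * of_real (fst X) + (\<i> * of_real (snd (snd X)) +
        (aut_factor (fst (snd X)) z - aut_factor (fst (snd X)) \<i>) + of_real (fst (snd X) $2$2)))) (at \<one>\<^bsub>G\<^esub>)"
        unfolding log_aut_def
        by (intro has_derivative_add has_derivative_compose[OF fs 1]
          bounded_linear.has_derivative[OF bounded_linear_of_real has_derivative_compose[OF fs 2]])
      show "(F has_derivative ?D) (at \<one>\<^bsub>G\<^esub>)"
        unfolding F_def by (rule has_derivative_vec2[OF has_derivative_compose[OF fs 3] 4])
    qed
    show "J X \<in> lie_algebra G \<and> ?D (J X) = \<i> *s ?D X" if X: "X \<in> lie_algebra G" for X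
    proof -
      \<comment> \<open>At (z, 1) the differential of (w1 / w2, log w2) is (dw1 - z dw2, dw2). On
        the range of \<open>\<iota>\<close> the angle term i t cancels the imaginary part of
        \<open>aut_factor\<close> at i.\<close>
      have D: "?D (\<iota> Z) = vec2 (N Z - z * M Z) (M Z)" for Z
        by (simp add: vec_eq_iff forall_2 \<iota>_def N_def M_def moebius_diff_def aut_factor_def algebra_simps)
      obtain Z where Z: "X = \<iota> Z" using X unfolding lie by blast
      obtain Y where Y: "J (\<iota> Z) = \<iota> Y" "N Y = \<i> * N Z" "M Y = \<i> * M Z" using J by blast
      have "\<iota> Y \<in> lie_algebra G" unfolding lie by blast
      moreover have "?D (\<iota> Y) = \<i> *s ?D (\<iota> Z)"
        unfolding D Y by (simp add: vec_eq_iff forall_2 algebra_simps)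
      ultimately show ?thesis unfolding Z Y(1) by blast
    qed
  qed
  then show ?thesis unfolding biholomorphic_to_def by blast
qed

text \<open>The matrix \<open>\<rho> y\<close> is real with the nonzero imaginary eigenvalue i
  \<mu>, so its eigenvector \<open>v\<close> is no multiple of a real vector. Hence \<open>v\<close>
  can be scaled to (z, 1) with \<open>z\<close> off the real axis.\<close>

theorem biholomorphic_Real_SL2R_cover:
  assumes J: "left_invariant_complex_structure (Real_group \<times>\<times> SL2R_cover) J"
  shows "biholomorphic_to (Real_group \<times>\<times> SL2R_cover) J {z :: complex^2. Im (z$1) > 0}"
proof -
  define G where "G = Real_group \<times>\<times> SL2R_cover"
  interpret translation_group G unfolding G_def by (rule translation_group_Real_SL2R_cover)
  let ?U = "{z :: complex^2. Im (z$1) > 0}"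
  define \<iota> where "\<iota> = (\<lambda>X :: real \<times> real \<times> complex. (fst X, sl2_matrix (snd X), sl2_matrix (snd X) $ 2 $ 1))"
  define \<rho> :: "real \<times> complex \<Rightarrow> complex^2^2" where "\<rho> x = (\<chi> i j. of_real (sl2_matrix x $ i $ j))" for x
  define N where "N l z X = l * of_real (fst X) * z +
      (of_real (sl2_matrix (snd X) $ 1 $ 1) * z + of_real (sl2_matrix (snd X) $ 1 $ 2))"
    for l z :: complex and X :: "real \<times> real \<times> complex"
  define M where "M l z X = l * of_real (fst X) + aut_factor (sl2_matrix (snd X)) z"
    for l z :: complex and X :: "real \<times> real \<times> complex"
  note lie = lie_algebra_Real_SL2R_cover[folded G_def, folded \<iota>_def]
  have upper: "biholomorphic_to G J' ?U"
    if "Im z > 0" "Re l \<noteq> 0" "\<And>X. \<exists>Y. J' (\<iota> X) = \<iota> Y \<and> N l z Y = \<i> * N l z X \<and> M l z Y = \<i> * M l z X" for J' l z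
    using biholomorphic_Real_SL2R_cover_upper[of z l J'] that unfolding G_def \<iota>_def N_def M_def by blast
  have \<iota>: "linear \<iota>"
    unfolding \<iota>_def by (rule linearI) (auto simp: linear_add[OF linear_sl2_matrix] linear_scale[OF linear_sl2_matrix] algebra_simps)
  obtain v l y \<mu> where v: "v \<noteq> 0" and l: "Re l \<noteq> 0"
    and hol: "\<And>X. \<exists>Y. J (\<iota> X) = \<iota> Y \<and> (l * of_real (fst Y)) *s v + \<rho> (snd Y) *v v =
        \<i> *s ((l * of_real (fst X)) *s v + \<rho> (snd X) *v v)"
    and \<mu>: "\<mu> \<noteq> 0" "\<rho> y *v v = (\<i> * of_real \<mu>) *s v"
  proof (rule complex_structure_reductive[OF J, of "-1" \<iota> \<rho>])
    show "linear \<iota>" by (rule \<iota>)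
    show "inj \<iota>" by (rule injI) (auto simp: \<iota>_def vec_eq_iff forall_2 complex_eq_iff prod_eq_iff)
    show "lie_algebra (Real_group \<times>\<times> SL2R_cover) = range \<iota>" using lie by (simp add: G_def)
    show "lie_bracket (Real_group \<times>\<times> SL2R_cover) (\<iota> X) (\<iota> Y) = \<iota> (0, br3 (-1) (snd X) (snd Y))" for X Y
      unfolding \<iota>_def by (rule lie_bracket_Real_SL2R_cover)
    show "linear \<rho>"
      by (rule linearI) (simp_all add: \<rho>_def vec_eq_iff linear_add[OF linear_sl2_matrix] linear_scale[OF linear_sl2_matrix]
        scaleR_conv_of_real[where 'a = complex] del: sl2_matrix_nth)
    show "\<rho> (br3 (-1) x y) = \<rho> x ** \<rho> y - \<rho> y ** \<rho> x" for x y
      unfolding \<rho>_def sl2_matrix_br3 by (simp add: vec_eq_iff matrix_matrix_mult_def sum_2 del: sl2_matrix_nth)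
    show "\<rho> x $ 1 $ 1 * \<rho> x $ 1 $ 1 + \<rho> x $ 1 $ 2 * \<rho> x $ 2 $ 1 = - of_real (det3 (-1) x)" for x
      by (simp add: \<rho>_def det3_def split_beta cmod_power2 complex_eq_iff) (simp add: power2_eq_square algebra_simps)
  qed (auto simp: \<rho>_def)
  have v2: "v$2 \<noteq> 0"
  proof
    assume 0: "v$2 = 0"
    then have "v$1 \<noteq> 0" using v by (simp add: vec_eq_iff forall_2)
    moreover have "of_real (sl2_matrix y $ 1 $ 1) * v$1 = \<i> * of_real \<mu> * v$1"
      using \<mu>(2) 0 by (simp add: vec_eq_iff forall_2 matrix_vector_mult_def sum_2 \<rho>_def del: sl2_matrix_nth)
    ultimately have "of_real (sl2_matrix y $ 1 $ 1) = \<i> * of_real \<mu>" by (metis mult_right_cancel)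
    then show False using \<mu>(1) by (simp add: complex_eq_iff)
  qed
  define z where "z = v$1 / v$2"
  have v1: "v$1 = z * v$2" using v2 by (simp add: z_def)
  have Imz: "Im z \<noteq> 0"
  proof
    assume "Im z = 0"
    then obtain x where x: "z = of_real x" by (metis complex_is_Real_iff Reals_cases)
    have "(of_real (sl2_matrix y $ 2 $ 1) * z + of_real (sl2_matrix y $ 2 $ 2)) * v$2 = (\<i> * of_real \<mu>) * v$2"
      using \<mu>(2) by (simp add: vec_eq_iff forall_2 matrix_vector_mult_def sum_2 \<rho>_def v1 algebra_simps del: sl2_matrix_nth)
    then have "of_real (sl2_matrix y $ 2 $ 1) * z + of_real (sl2_matrix y $ 2 $ 2) = \<i> * of_real \<mu>" using v2 by simp
    then show False using \<mu>(1) by (simp add: x complex_eq_iff)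
  qed
  have hol': "\<exists>Y. J (\<iota> X) = \<iota> Y \<and> N l z Y = \<i> * N l z X \<and> M l z Y = \<i> * M l z X" for X
  proof -
    obtain Y where Y: "J (\<iota> X) = \<iota> Y" and e: "(l * of_real (fst Y)) *s v + \<rho> (snd Y) *v v =
        \<i> *s ((l * of_real (fst X)) *s v + \<rho> (snd X) *v v)" using hol by blast
    have NM: "((l * of_real (fst Z)) *s v + \<rho> (snd Z) *v v) $ 1 = N l z Z * v$2"
      "((l * of_real (fst Z)) *s v + \<rho> (snd Z) *v v) $ 2 = M l z Z * v$2" for Z
      by (simp_all add: N_def M_def aut_factor_def matrix_vector_mult_def sum_2 \<rho>_def v1 algebra_simps del: sl2_matrix_nth)
    have "N l z Y * v$2 = \<i> * (N l z X * v$2)" "M l z Y * v$2 = \<i> * (M l z X * v$2)"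
      unfolding NM[symmetric] e by (simp_all add: distrib_left)
    then show ?thesis using Y v2 by (intro exI[of _ Y]) simp
  qed
  show ?thesis
  proof (cases "Im z > 0")
    case True
    then show ?thesis using upper[OF _ l hol'] by (simp add: G_def)
  next
    case False
    have minus: "biholomorphic_to G (\<lambda>X. - J X) ?U"
    proof (rule upper)
      \<comment> \<open>Real matrices commute with conjugation, so conjugating \<open>z\<close> and
        \<open>l\<close> conjugates \<open>N\<close> and \<open>M\<close> and replaces i by -
        i.\<close>
      show "Im (cnj z) > 0" "Re (cnj l) \<noteq> 0" using False Imz l by auto
      fix X
      have c: "N (cnj l) (cnj z) Z = cnj (N l z Z)" "M (cnj l) (cnj z) Z = cnj (M l z Z)" for Z
        by (simp_all add: N_def M_def aut_factor_def del: sl2_matrix_nth)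
      have neg: "N l z (- Z) = - N l z Z" "M l z (- Z) = - M l z Z" for Z
        by (simp_all add: N_def M_def aut_factor_def linear_neg[OF linear_sl2_matrix] del: sl2_matrix_nth)
      obtain Y where "J (\<iota> X) = \<iota> Y" "N l z Y = \<i> * N l z X" "M l z Y = \<i> * M l z X" using hol' by blast
      then show "\<exists>Y. - J (\<iota> X) = \<iota> Y \<and> N (cnj l) (cnj z) Y = \<i> * N (cnj l) (cnj z) X \<and>
          M (cnj l) (cnj z) Y = \<i> * M (cnj l) (cnj z) X"
        by (intro exI[of _ "- Y"]) (simp add: linear_neg[OF \<iota>] c neg)
    qed
    \<comment> \<open>Reflection in the imaginary axis on the first factor, conjugation on the
      second: an antiholomorphic involution that preserves the upper half plane condition.\<close>
    define \<kappa> where "\<kappa> y = vec2 (- cnj (y$1)) (cnj (y$2))" for y :: "complex^2"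
    have bl: "bounded_linear \<kappa>"
      by (intro linear_conv_bounded_linear[THEN iffD1] linearI)
         (simp_all add: \<kappa>_def vec_eq_iff forall_2)
    have JG: "J X \<in> lie_algebra G" if "X \<in> lie_algebra G" for X
      using that hol' unfolding lie by (metis rangeE rangeI)
    show ?thesis
      unfolding G_def[symmetric]
      by (rule biholomorphic_to_conjugate[OF minus bl _ _ _ JG]) (auto simp: \<kappa>_def vec_eq_iff forall_2)
  qed
qed

theorem mainTheorem3:
  shows "(\<forall>J. left_invariant_complex_structure (Real_group \<times>\<times> SL2R_cover) J \<longrightarrow>
            biholomorphic_to (Real_group \<times>\<times> SL2R_cover) J {z :: complex^2. Im (z$1) > 0}) \<and>
         (\<forall>J. left_invariant_complex_structure (Real_group \<times>\<times> SU2) J \<longrightarrow>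
            biholomorphic_to (Real_group \<times>\<times> SU2) J (- {0 :: complex^2})) \<and>
         (\<forall>J. left_invariant_complex_structure
               (Real_group \<times>\<times> (Heisenberg :: ((complex^'m) \<times> real) monoid)) J \<longrightarrow>
            biholomorphic_to (Real_group \<times>\<times> (Heisenberg :: ((complex^'m) \<times> real) monoid)) J
              (UNIV :: (complex^'m option) set)) \<and>
         (\<forall>(P :: 'm set) \<psi>. linear_map_on (abelian_part P) (cartan_u (- P)) \<psi> \<longrightarrow>
            biholomorphic_to (GH P \<psi>) gh_J (UNIV :: (complex^'m option) set))"
  using biholomorphic_Real_SL2R_cover biholomorphic_Real_SU2 biholomorphic_Real_Heisenberg biholomorphic_GH by blast

end
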